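(* Let $\mathcal{T}$ be a $k$-linear, Hom-finite, Krull-Schmidt triangulated category equipped with a linear generator $G$. Then $\mathcal{T}$ has Rouquier dimension $1$ if and only if $G\not\cong G[1]$.
   Context: $k$ is an algebraically closed field. For a triangulated category $\mathcal{T}$ with suspension $[1]$, write $\mathcal{T}(X,Y)$ for the space of morphisms $X\to Y$. For $X\in\mathcal{T}$: $\langle X\rangle$ is the smallest thick subcategory containing $X$; $\langle X\rangle_1$ is the smallest full additive subcategory of $\mathcal{T}$ containing $X$ and closed under direct summands and under the suspension functor and its inverse; inductively, for $m\ge2$, $\langle X\rangle_m$ is the full subcategory of objects $A$ fitting into a triangle $B\to A\to C\to B[1]$ with $B\in\langle X\rangle_1$ and $C\in\langle X\rangle_{m-1}$. $G$ is a classical generator if $\langle G\rangle=\mathcal{T}$. If $n\ge1$ is the smallest integer with $\langle G\rangle_n=\mathcal{T}$, the generation time of $G$ is $n-1$. The Rouquier dimension of $\mathcal{T}$ is the infimum of the generation times of its classical generators. A linear generator is a classical generator $G$ such that: (G1) the isomorphism classes of indecomposable objects of $\langle G\rangle_1$ are totally ordered by: $Q\le P$ if and only if $\mathcal{T}(P,Q)\cong k$; moreover if $Q\le P$ and $Q\not\cong P$ then $\mathcal{T}(Q,P)=0$; (G2) $P\le P[1]$ for each indecomposable $P\in\langle G\rangle_1$; (G3) for indecomposables $P,Q\in\langle G\rangle_1$, $P\le Q\le P[1]$ implies $Q\cong P$ or $Q\cong P[1]$; (G4) for indecomposables $R\le Q\le P$ in $\langle G\rangle_1$, any (nonzero) morphism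 $P\to R$ factors as a composite $P\to Q\to R$. *)

theory Defs
  imports "HOL-Computational_Algebra.Polynomial" "HOL-Library.Extended_Nat"
begin

section \<open>Linear triangulated categories\<close>

text \<open>
  The objects are the elements of the type \<open>'o\<close>. The morphism spaces \<open>Hom T X Y\<close> are subspaces
  of one ambient \<open>'k\<close>-vector space \<open>'m\<close>, so that linear algebra from the library applies. This is
  no restriction, since any family of vector spaces embeds in its direct sum. The spaces for
  different pairs of objects may overlap: composition and the action of the suspension on morphisms
  carry the objects as arguments, and nothing is required of them outside the morphism spaces.
\<close>

record ('k, 'o, 'm) tricat =
  mscale :: "'k \<Rightarrow> 'm \<Rightarrow> 'm"
  Hom :: "'o \<Rightarrow> 'o \<Rightarrow> 'm set"
  mid :: "'o \<Rightarrow> 'm"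
  \<comment> \<open>\<open>mcomp T X Y Z g f\<close> is the composite of \<open>f : X \<rightarrow> Y\<close> followed by \<open>g : Y \<rightarrow> Z\<close>\<close>
  mcomp :: "'o \<Rightarrow> 'o \<Rightarrow> 'o \<Rightarrow> 'm \<Rightarrow> 'm \<Rightarrow> 'm"
  shift :: "'o \<Rightarrow> 'o"
  mshift :: "'o \<Rightarrow> 'o \<Rightarrow> 'm \<Rightarrow> 'm"
  \<comment> \<open>\<open>tri T X Y Z f g h\<close>: \<open>X \<rightarrow> Y \<rightarrow> Z \<rightarrow> X[1]\<close> with maps \<open>f, g, h\<close> is a distinguished triangle\<close>
  tri :: "'o \<Rightarrow> 'o \<Rightarrow> 'o \<Rightarrow> 'm \<Rightarrow> 'm \<Rightarrow> 'm \<Rightarrow> bool"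

definition iso_map :: "('k, 'o, 'm) tricat \<Rightarrow> 'o \<Rightarrow> 'o \<Rightarrow> 'm \<Rightarrow> bool" where
  "iso_map T X Y f \<longleftrightarrow>
     f \<in> Hom T X Y \<and>
     (\<exists>g\<in>Hom T Y X. mcomp T X Y X g f = mid T X \<and> mcomp T Y X Y f g = mid T Y)"

definition isomorphic :: "('k, 'o, 'm) tricat \<Rightarrow> 'o \<Rightarrow> 'o \<Rightarrow> bool" where
  "isomorphic T X Y \<longleftrightarrow> (\<exists>f. iso_map T X Y f)"

definition zero_obj :: "('k, 'o, 'm::zero) tricat \<Rightarrow> 'o \<Rightarrow> bool" where
  "zero_obj T Z \<longleftrightarrow> (\<forall>X. Hom T X Z = {0} \<and> Hom T Z X = {0})"

definition biproduct :: "('k, 'o, 'm::{zero, plus}) tricat \<Rightarrow> 'o \<Rightarrow> 'o \<Rightarrow> 'o \<Rightarrow> bool" where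
  "biproduct T X Y S \<longleftrightarrow>
     (\<exists>i\<in>Hom T X S. \<exists>j\<in>Hom T Y S. \<exists>p\<in>Hom T S X. \<exists>q\<in>Hom T S Y.
        mcomp T X S X p i = mid T X \<and> mcomp T Y S Y q j = mid T Y \<and>
        mcomp T Y S X p j = 0 \<and> mcomp T X S Y q i = 0 \<and>
        mcomp T S X S i p + mcomp T S Y S j q = mid T S)"

locale klinear_category =
  fixes T :: "('k::field, 'o, 'm::ab_group_add) tricat"
  assumes vs: "vector_space (mscale T)"
    and Hom_subspace: "module.subspace (mscale T) (Hom T X Y)"
    and mid_Hom: "mid T X \<in> Hom T X X"
    and mcomp_Hom: "f \<in> Hom T X Y \<Longrightarrow> g \<in> Hom T Y Z \<Longrightarrow> mcomp T X Y Z g f \<in> Hom T X Z"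
    and mcomp_mid_left: "f \<in> Hom T X Y \<Longrightarrow> mcomp T X Y Y (mid T Y) f = f"
    and mcomp_mid_right: "f \<in> Hom T X Y \<Longrightarrow> mcomp T X X Y f (mid T X) = f"
    and mcomp_assoc: "f \<in> Hom T W X \<Longrightarrow> g \<in> Hom T X Y \<Longrightarrow> h \<in> Hom T Y Z \<Longrightarrow>
          mcomp T W Y Z h (mcomp T W X Y g f) = mcomp T W X Z (mcomp T X Y Z h g) f"
    and mcomp_add_left: "f \<in> Hom T X Y \<Longrightarrow> g \<in> Hom T Y Z \<Longrightarrow> g' \<in> Hom T Y Z \<Longrightarrow>
          mcomp T X Y Z (g + g') f = mcomp T X Y Z g f + mcomp T X Y Z g' f"
    and mcomp_add_right: "f \<in> Hom T X Y \<Longrightarrow> f' \<in> Hom T X Y \<Longrightarrow> g \<in> Hom T Y Z \<Longrightarrow>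
          mcomp T X Y Z g (f + f') = mcomp T X Y Z g f + mcomp T X Y Z g f'"
    and mcomp_scale_left: "f \<in> Hom T X Y \<Longrightarrow> g \<in> Hom T Y Z \<Longrightarrow>
          mcomp T X Y Z (mscale T r g) f = mscale T r (mcomp T X Y Z g f)"
    and mcomp_scale_right: "f \<in> Hom T X Y \<Longrightarrow> g \<in> Hom T Y Z \<Longrightarrow>
          mcomp T X Y Z g (mscale T r f) = mscale T r (mcomp T X Y Z g f)"

locale klinear_additive_category = klinear_category +
  assumes ex_zero_obj: "\<exists>Z. zero_obj T Z"
    and ex_biproduct: "\<exists>S. biproduct T X Y S"

text \<open>
  The suspension is a \<open>'k\<close>-linear autoequivalence, not necessarily an automorphism; the triangles
  satisfy Verdier's axioms, including the octahedral axiom.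
\<close>

locale klinear_triangulated_category = klinear_additive_category +
  assumes mshift_mid: "mshift T X X (mid T X) = mid T (shift T X)"
    and mshift_mcomp: "f \<in> Hom T X Y \<Longrightarrow> g \<in> Hom T Y Z \<Longrightarrow>
          mshift T X Z (mcomp T X Y Z g f) =
            mcomp T (shift T X) (shift T Y) (shift T Z) (mshift T Y Z g) (mshift T X Y f)"
    and mshift_add: "f \<in> Hom T X Y \<Longrightarrow> f' \<in> Hom T X Y \<Longrightarrow>
          mshift T X Y (f + f') = mshift T X Y f + mshift T X Y f'"
    and mshift_scale: "f \<in> Hom T X Y \<Longrightarrow>
          mshift T X Y (mscale T r f) = mscale T r (mshift T X Y f)"
    and mshift_fully_faithful:
          "bij_betw (mshift T X Y) (Hom T X Y) (Hom T (shift T X) (shift T Y))"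
    and shift_ess_surj: "\<exists>X. isomorphic T (shift T X) Y"
    and tri_Hom: "tri T X Y Z f g h \<Longrightarrow>
          f \<in> Hom T X Y \<and> g \<in> Hom T Y Z \<and> h \<in> Hom T Z (shift T X)"
    and tri_iso: "tri T X Y Z f g h \<Longrightarrow>
          f' \<in> Hom T X' Y' \<Longrightarrow> g' \<in> Hom T Y' Z' \<Longrightarrow> h' \<in> Hom T Z' (shift T X') \<Longrightarrow>
          iso_map T X X' a \<Longrightarrow> iso_map T Y Y' b \<Longrightarrow> iso_map T Z Z' c \<Longrightarrow>
          mcomp T X Y Y' b f = mcomp T X X' Y' f' a \<Longrightarrow>
          mcomp T Y Z Z' c g = mcomp T Y Y' Z' g' b \<Longrightarrow>
          mcomp T Z (shift T X) (shift T X') (mshift T X X' a) h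
            = mcomp T Z Z' (shift T X') h' c \<Longrightarrow>
          tri T X' Y' Z' f' g' h'"
    and tri_mid: "zero_obj T Z \<Longrightarrow> tri T X X Z (mid T X) 0 0"
    and tri_complete: "f \<in> Hom T X Y \<Longrightarrow> \<exists>Z g h. tri T X Y Z f g h"
    and tri_rotate: "f \<in> Hom T X Y \<Longrightarrow> g \<in> Hom T Y Z \<Longrightarrow> h \<in> Hom T Z (shift T X) \<Longrightarrow>
          tri T X Y Z f g h \<longleftrightarrow> tri T Y Z (shift T X) g h (- mshift T X Y f)"
    and tri_morphism: "tri T X Y Z f g h \<Longrightarrow> tri T X' Y' Z' f' g' h' \<Longrightarrow>
          a \<in> Hom T X X' \<Longrightarrow> b \<in> Hom T Y Y' \<Longrightarrow>
          mcomp T X Y Y' b f = mcomp T X X' Y' f' a \<Longrightarrow>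
          \<exists>c\<in>Hom T Z Z'.
            mcomp T Y Z Z' c g = mcomp T Y Y' Z' g' b \<and>
            mcomp T Z (shift T X) (shift T X') (mshift T X X' a) h
              = mcomp T Z Z' (shift T X') h' c"
    and tri_octahedral: "tri T X Y Z' u j k \<Longrightarrow> tri T Y Z X' v l i \<Longrightarrow>
          tri T X Z Y' (mcomp T X Y Z v u) m n \<Longrightarrow>
          \<exists>f\<in>Hom T Z' Y'. \<exists>g\<in>Hom T Y' X'.
            tri T Z' Y' X' f g
              (mcomp T X' (shift T Y) (shift T Z') (mshift T Y Z' j) i) \<and>
            mcomp T Y Z' Y' f j = mcomp T Y Z Y' m v \<and>
            mcomp T Z' Y' (shift T X) n f = k \<and>
            mcomp T Z Y' X' g m = l \<and>
            mcomp T Y' X' (shift T Y) i g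
              = mcomp T Y' (shift T X) (shift T Y) (mshift T X Y u) n"

definition hom_finite :: "('k::field, 'o, 'm::ab_group_add) tricat \<Rightarrow> bool" where
  "hom_finite T \<longleftrightarrow> (\<forall>X Y. \<exists>B. finite B \<and> Hom T X Y = module.span (mscale T) B)"

definition indecomposable :: "('k, 'o, 'm::{zero, plus}) tricat \<Rightarrow> 'o \<Rightarrow> bool" where
  "indecomposable T X \<longleftrightarrow>
     \<not> zero_obj T X \<and> (\<forall>A B. biproduct T A B X \<longrightarrow> zero_obj T A \<or> zero_obj T B)"

inductive finite_direct_sum :: "('k, 'o, 'm::{zero, plus}) tricat \<Rightarrow> 'o list \<Rightarrow> 'o \<Rightarrow> bool"
  for T where
  "zero_obj T S \<Longrightarrow> finite_direct_sum T [] S"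
| "finite_direct_sum T Xs R \<Longrightarrow> biproduct T X R S \<Longrightarrow> finite_direct_sum T (X # Xs) S"

text \<open>The endomorphism ring of \<open>X\<close> is nonzero and its non-units are closed under addition.\<close>

definition local_End :: "('k, 'o, 'm::{zero, plus}) tricat \<Rightarrow> 'o \<Rightarrow> bool" where
  "local_End T X \<longleftrightarrow>
     mid T X \<noteq> 0 \<and>
     (\<forall>f\<in>Hom T X X. \<forall>g\<in>Hom T X X.
        \<not> iso_map T X X f \<longrightarrow> \<not> iso_map T X X g \<longrightarrow> \<not> iso_map T X X (f + g))"

definition krull_schmidt :: "('k, 'o, 'm::{zero, plus}) tricat \<Rightarrow> bool" where
  "krull_schmidt T \<longleftrightarrow>
     (\<forall>X. \<exists>Xs. finite_direct_sum T Xs X \<and> (\<forall>Y\<in>set Xs. local_End T Y))"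


section \<open>Generation and Rouquier dimension\<close>

text \<open>
  Full subcategories are given by their sets of objects. Closure under direct summands entails
  closure under isomorphism (an object isomorphic to \<open>X\<close> is a summand of \<open>X\<close> with complement \<open>0\<close>).
  Hence the implication from \<open>shift T X \<in> S\<close> to \<open>X \<in> S\<close> is closure under the inverse suspension,
  whichever quasi-inverse of the suspension is chosen.
\<close>

definition additive_summand_shift_closed ::
    "('k, 'o, 'm::{zero, plus}) tricat \<Rightarrow> 'o set \<Rightarrow> bool" where
  "additive_summand_shift_closed T S \<longleftrightarrow>
     (\<forall>Z. zero_obj T Z \<longrightarrow> Z \<in> S) \<and>
     (\<forall>X Y B. X \<in> S \<longrightarrow> Y \<in> S \<longrightarrow> biproduct T X Y B \<longrightarrow> B \<in> S) \<and>
     (\<forall>X Y B. B \<in> S \<longrightarrow> biproduct T X Y B \<longrightarrow> X \<in> S) \<and>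
     (\<forall>X. shift T X \<in> S \<longleftrightarrow> X \<in> S)"

definition thick :: "('k, 'o, 'm::{zero, plus}) tricat \<Rightarrow> 'o set \<Rightarrow> bool" where
  "thick T S \<longleftrightarrow>
     (\<forall>Z. zero_obj T Z \<longrightarrow> Z \<in> S) \<and>
     (\<forall>X. shift T X \<in> S \<longleftrightarrow> X \<in> S) \<and>
     (\<forall>X Y Z f g h. tri T X Y Z f g h \<longrightarrow> X \<in> S \<longrightarrow> Y \<in> S \<longrightarrow> Z \<in> S) \<and>
     (\<forall>X Y B. B \<in> S \<longrightarrow> biproduct T X Y B \<longrightarrow> X \<in> S)"

text \<open>\<open>generated_in T X m\<close> is \<open>\<langle>X\<rangle>\<^sub>m\<close> for \<open>m \<ge> 1\<close>; the value at \<open>0\<close> is never used.\<close>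

fun generated_in :: "('k, 'o, 'm::{zero, plus}) tricat \<Rightarrow> 'o \<Rightarrow> nat \<Rightarrow> 'o set" where
  "generated_in T X 0 = {Z. zero_obj T Z}"
| "generated_in T X (Suc 0) = additive_summand_shift_closed T hull {X}"
| "generated_in T X (Suc (Suc m)) =
     {A. \<exists>B\<in>generated_in T X (Suc 0). \<exists>C\<in>generated_in T X (Suc m). \<exists>f g h. tri T B A C f g h}"

definition classical_generator :: "('k, 'o, 'm::{zero, plus}) tricat \<Rightarrow> 'o \<Rightarrow> bool" where
  "classical_generator T G \<longleftrightarrow> thick T hull {G} = UNIV"

definition generation_time :: "('k, 'o, 'm::{zero, plus}) tricat \<Rightarrow> 'o \<Rightarrow> enat" where
  "generation_time T G =
     (if \<exists>n\<ge>1. generated_in T G n = UNIV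
      then enat ((LEAST n. n \<ge> 1 \<and> generated_in T G n = UNIV) - 1)
      else \<infinity>)"

definition rouquier_dimension :: "('k, 'o, 'm::{zero, plus}) tricat \<Rightarrow> enat" where
  "rouquier_dimension T = (INF G\<in>{G. classical_generator T G}. generation_time T G)"


section \<open>Linear generators\<close>

text \<open>\<open>lin_le T Q P\<close> is \<open>Q \<le> P\<close>: the space of morphisms from \<open>P\<close> to \<open>Q\<close> is isomorphic to \<open>'k\<close>.\<close>

definition lin_le :: "('k::field, 'o, 'm::ab_group_add) tricat \<Rightarrow> 'o \<Rightarrow> 'o \<Rightarrow> bool" where
  "lin_le T Q P \<longleftrightarrow>
     (\<exists>\<phi>. Vector_Spaces.linear (*) (mscale T) \<phi> \<and> bij_betw \<phi> UNIV (Hom T P Q))"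

locale linear_generator =
  fixes T :: "('k::field, 'o, 'm::ab_group_add) tricat" and G :: 'o and I :: "'o set"
  defines "I \<equiv> {P \<in> generated_in T G 1. indecomposable T P}"
  assumes generator: "classical_generator T G"
    and G1_refl: "P \<in> I \<Longrightarrow> lin_le T P P"
    and G1_antisym: "P \<in> I \<Longrightarrow> Q \<in> I \<Longrightarrow> lin_le T P Q \<Longrightarrow> lin_le T Q P \<Longrightarrow> isomorphic T P Q"
    and G1_trans: "P \<in> I \<Longrightarrow> Q \<in> I \<Longrightarrow> R \<in> I \<Longrightarrow>
          lin_le T P Q \<Longrightarrow> lin_le T Q R \<Longrightarrow> lin_le T P R"
    and G1_total: "P \<in> I \<Longrightarrow> Q \<in> I \<Longrightarrow> lin_le T P Q \<or> lin_le T Q P"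
    and G1_zero: "P \<in> I \<Longrightarrow> Q \<in> I \<Longrightarrow> lin_le T Q P \<Longrightarrow> \<not> isomorphic T Q P \<Longrightarrow>
          Hom T Q P = {0}"
    and G2: "P \<in> I \<Longrightarrow> lin_le T P (shift T P)"
    and G3: "P \<in> I \<Longrightarrow> Q \<in> I \<Longrightarrow> lin_le T P Q \<Longrightarrow> lin_le T Q (shift T P) \<Longrightarrow>
          isomorphic T Q P \<or> isomorphic T Q (shift T P)"
    and G4: "P \<in> I \<Longrightarrow> Q \<in> I \<Longrightarrow> R \<in> I \<Longrightarrow> lin_le T R Q \<Longrightarrow> lin_le T Q P \<Longrightarrow>
          f \<in> Hom T P R \<Longrightarrow> f \<noteq> 0 \<Longrightarrow>
          \<exists>a\<in>Hom T P Q. \<exists>b\<in>Hom T Q R. f = mcomp T P Q R b a"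

end

theory Submission
  imports Defs
begin

text \<open>
  Let \<open>addG\<close> be \<open>\<langle>G\<rangle>\<^sub>1\<close> and \<open>ind\<close> the class of its indecomposables. By the axioms of a linear generator,
  the nonzero morphism spaces between members of \<open>ind\<close> are lines, and composites of nonzero maps are
  nonzero: \<open>ind\<close> is, up to equivalence, the linear category of a totally ordered set.

  Upper bound. Over such a category matrices can be diagonalised. If a map \<open>f : N \<rightarrow> M\<close> in \<open>addG\<close> is
  nonzero, a suitable nonzero entry of its matrix is a pivot (\<open>pivot\<close>): all other nonzero entries in
  its row and column factor through it, so \<open>f\<close> is the direct sum of the pivot \<open>Q \<rightarrow> R\<close> and a map with
  a smaller source. Hence \<open>f\<close> vanishes on a direct summand of its source and is injective on a
  complement (\<open>kernel_split\<close>). It follows that the functor \<open>Hom(-, A)\<close> on \<open>addG\<close> is finitely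
  generated for every object \<open>A\<close> (\<open>all_covered\<close>): the objects whose extensions preserve this property
  form a thick subcategory containing \<open>G\<close>. Applying this to \<open>A\<close> and then to the kernel of a cover,
  every object is the cone of a map in \<open>addG\<close> (\<open>presentation\<close>), that is, \<open>\<langle>G\<rangle>\<^sub>2\<close> is everything and the
  Rouquier dimension is at most 1. It remains to decide when some object \<open>W\<close> satisfies \<open>\<langle>W\<rangle>\<^sub>1 = \<T>\<close>.

  If \<open>G\<close> is not isomorphic to its suspension, some indecomposable \<open>Q\<close> in \<open>ind\<close> is not isomorphic to
  its suspension, and its suspensions form a strictly increasing sequence \<open>P j\<close>, \<open>j \<in> \<int>\<close>. An object
  \<open>Y\<close> gives the sequence of spaces \<open>Hom(P j, Y)\<close>. Its maps are isomorphisms for all but finitely many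
  \<open>j\<close>, since this holds for \<open>G\<close> and is inherited by thick closures (\<open>finite_jumps\<close>). For the cone of
  \<open>P (j + i) \<rightarrow> P j\<close> the sequence is an interval of length \<open>i\<close>, and an object of which this interval is
  a summand has jumps at both of its ends. So only finitely many lengths occur for a given \<open>W\<close> and
  for the members of \<open>\<langle>W\<rangle>\<^sub>1\<close>, whereas all lengths occur in \<open>\<T>\<close> (\<open>no_additive_generator\<close>).

  If \<open>G\<close> is isomorphic to its suspension, every member of \<open>ind\<close> is a direct summand of \<open>G\<close>, so \<open>ind\<close>
  has finitely many isomorphism classes. Splitting off pivots writes the cone of a map in \<open>addG\<close> as a
  sum of objects of \<open>addG\<close> and cones of nonzero maps \<open>Q \<rightarrow> R\<close> between members of \<open>ind\<close>
  (\<open>cone_decomposition\<close>); there are finitely many of the latter up to isomorphism, and their sum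
  together with \<open>G\<close> is the required \<open>W\<close> (\<open>additive_generator\<close>).
\<close>

section \<open>Linear categories\<close>

context klinear_category
begin

abbreviation cmp :: "'o \<Rightarrow> 'o \<Rightarrow> 'o \<Rightarrow> 'm \<Rightarrow> 'm \<Rightarrow> 'm" where "cmp \<equiv> mcomp T"
abbreviation hom :: "'o \<Rightarrow> 'o \<Rightarrow> 'm set" where "hom \<equiv> Hom T"
abbreviation idm :: "'o \<Rightarrow> 'm" where "idm \<equiv> mid T"

sublocale V: vector_space "mscale T"
  by (rule vs)

lemma zero_Hom [simp]: "0 \<in> hom X Y"
  using Hom_subspace V.subspace_0 by blast

lemma add_Hom [simp]: "f \<in> hom X Y \<Longrightarrow> g \<in> hom X Y \<Longrightarrow> f + g \<in> hom X Y"
  using Hom_subspace V.subspace_add by blast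

lemma scale_Hom [simp]: "f \<in> hom X Y \<Longrightarrow> mscale T r f \<in> hom X Y"
  using Hom_subspace V.subspace_scale by blast

lemma uminus_Hom [simp]: "f \<in> hom X Y \<Longrightarrow> - f \<in> hom X Y"
  using Hom_subspace V.subspace_neg by blast

lemma diff_Hom [simp]: "f \<in> hom X Y \<Longrightarrow> g \<in> hom X Y \<Longrightarrow> f - g \<in> hom X Y"
  using Hom_subspace V.subspace_diff by blast

lemma sum_Hom [simp]: "(\<And>l. l \<in> L \<Longrightarrow> f l \<in> hom X Y) \<Longrightarrow> sum f L \<in> hom X Y"
  using V.subspace_sum[OF Hom_subspace] by blast

declare mid_Hom [simp] mcomp_Hom [simp] mcomp_mid_left [simp] mcomp_mid_right [simp]

lemma comp_assoc [simp]:
  "f \<in> hom W X \<Longrightarrow> g \<in> hom X Y \<Longrightarrow> h \<in> hom Y Z \<Longrightarrow>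
    cmp W X Z (cmp X Y Z h g) f = cmp W Y Z h (cmp W X Y g f)"
  by (simp add: mcomp_assoc)

text \<open>An equation between composites, prepared for rewriting inside right-nested composites.\<close>

lemma comp_eq_assoc:
  "cmp X Y Z g f = k \<Longrightarrow> f \<in> hom X Y \<Longrightarrow> g \<in> hom Y Z \<Longrightarrow> w \<in> hom W X \<Longrightarrow>
    cmp W Y Z g (cmp W X Y f w) = cmp W X Z k w"
  by (simp add: mcomp_assoc)

lemma comp_zero_right [simp]: "g \<in> hom Y Z \<Longrightarrow> cmp X Y Z g 0 = 0"
  using mcomp_add_right[of 0 X Y 0 g Z] by simp

lemma comp_zero_left [simp]: "f \<in> hom X Y \<Longrightarrow> cmp X Y Z 0 f = 0"
  using mcomp_add_left[of f X Y 0 Z 0] by simp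

lemma comp_uminus_right [simp]:
  "f \<in> hom X Y \<Longrightarrow> g \<in> hom Y Z \<Longrightarrow> cmp X Y Z g (- f) = - cmp X Y Z g f"
  using mcomp_add_right[of f X Y "- f" g Z] by (simp add: eq_neg_iff_add_eq_0 add.commute)

lemma comp_uminus_left [simp]:
  "f \<in> hom X Y \<Longrightarrow> g \<in> hom Y Z \<Longrightarrow> cmp X Y Z (- g) f = - cmp X Y Z g f"
  using mcomp_add_left[of f X Y g Z "- g"] by (simp add: eq_neg_iff_add_eq_0 add.commute)

lemma comp_diff_right:
  "f \<in> hom X Y \<Longrightarrow> f' \<in> hom X Y \<Longrightarrow> g \<in> hom Y Z \<Longrightarrow>
    cmp X Y Z g (f - f') = cmp X Y Z g f - cmp X Y Z g f'"
  using mcomp_add_right[of f X Y "- f'" g Z] by simp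

lemma comp_diff_left:
  "f \<in> hom X Y \<Longrightarrow> g \<in> hom Y Z \<Longrightarrow> g' \<in> hom Y Z \<Longrightarrow>
    cmp X Y Z (g - g') f = cmp X Y Z g f - cmp X Y Z g' f"
  using mcomp_add_left[of f X Y g Z "- g'"] by simp

lemma comp_sum_right:
  "finite L \<Longrightarrow> g \<in> hom Y Z \<Longrightarrow> (\<And>l. l \<in> L \<Longrightarrow> f l \<in> hom X Y) \<Longrightarrow>
    cmp X Y Z g (sum f L) = (\<Sum>l\<in>L. cmp X Y Z g (f l))"
  by (induction L rule: finite_induct) (simp_all add: mcomp_add_right)

lemma comp_sum_left:
  "finite L \<Longrightarrow> f \<in> hom X Y \<Longrightarrow> (\<And>l. l \<in> L \<Longrightarrow> g l \<in> hom Y Z) \<Longrightarrow>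
    cmp X Y Z (sum g L) f = (\<Sum>l\<in>L. cmp X Y Z (g l) f)"
  by (induction L rule: finite_induct) (simp_all add: mcomp_add_left)

lemmas comp_linear = mcomp_add_left mcomp_add_right comp_diff_left comp_diff_right
  mcomp_scale_left mcomp_scale_right

subsection \<open>Isomorphisms, zero objects and biproducts\<close>

lemma zero_obj_Hom: "zero_obj T Z \<Longrightarrow> f \<in> hom X Z \<Longrightarrow> f = 0" "zero_obj T Z \<Longrightarrow> f \<in> hom Z X \<Longrightarrow> f = 0"
  by (auto simp: zero_obj_def)

lemma zero_obj_iff: "zero_obj T Z \<longleftrightarrow> idm Z = 0"
proof
  assume "zero_obj T Z"
  then show "idm Z = 0" using zero_obj_Hom(1)[of Z "idm Z" Z] by simp
next
  assume z: "idm Z = 0"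
  have "f = 0" if "f \<in> hom X Z" for f X
    using mcomp_mid_left[OF that] that by (simp add: z)
  moreover have "f = 0" if "f \<in> hom Z X" for f X
    using mcomp_mid_right[OF that] that by (simp add: z)
  ultimately show "zero_obj T Z"
    unfolding zero_obj_def by (auto simp del: zero_Hom intro: zero_Hom)
qed

lemma iso_mapI:
  "f \<in> hom X Y \<Longrightarrow> g \<in> hom Y X \<Longrightarrow> cmp X Y X g f = idm X \<Longrightarrow> cmp Y X Y f g = idm Y \<Longrightarrow>
    iso_map T X Y f"
  unfolding iso_map_def by blast

lemma iso_mapE:
  assumes "iso_map T X Y f"
  obtains g where "f \<in> hom X Y" "g \<in> hom Y X" "cmp X Y X g f = idm X" "cmp Y X Y f g = idm Y"
  using assms unfolding iso_map_def by blast

lemma isomorphicE: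
  assumes "isomorphic T X Y"
  obtains f g where "f \<in> hom X Y" "g \<in> hom Y X" "cmp X Y X g f = idm X" "cmp Y X Y f g = idm Y"
  using assms unfolding isomorphic_def iso_map_def by blast

lemma isomorphicI:
  "f \<in> hom X Y \<Longrightarrow> g \<in> hom Y X \<Longrightarrow> cmp X Y X g f = idm X \<Longrightarrow> cmp Y X Y f g = idm Y \<Longrightarrow>
    isomorphic T X Y"
  unfolding isomorphic_def iso_map_def by blast

lemma iso_map_id: "iso_map T X X (idm X)"
  by (rule iso_mapI[of _ _ _ "idm X"]) simp_all

lemma isomorphic_refl: "isomorphic T X X"
  unfolding isomorphic_def using iso_map_id by blast

lemma isomorphic_sym: "isomorphic T X Y \<Longrightarrow> isomorphic T Y X"
  unfolding isomorphic_def iso_map_def by blast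

lemma isomorphic_trans:
  assumes "isomorphic T X Y" "isomorphic T Y Z"
  shows "isomorphic T X Z"
proof -
  obtain f g where 1: "f \<in> hom X Y" "g \<in> hom Y X" "cmp X Y X g f = idm X" "cmp Y X Y f g = idm Y"
    using assms(1) by (rule isomorphicE)
  obtain f' g' where 2: "f' \<in> hom Y Z" "g' \<in> hom Z Y" "cmp Y Z Y g' f' = idm Y" "cmp Z Y Z f' g' = idm Z"
    using assms(2) by (rule isomorphicE)
  note a = comp_eq_assoc[OF 2(3) 2(1,2)] comp_eq_assoc[OF 1(4) 1(2,1)]
  show ?thesis
    by (rule isomorphicI[of "cmp X Y Z f' f" _ _ "cmp Z Y X g g'"]) (use 1 2 in \<open>simp_all add: a\<close>)
qed

lemma biproductE:
  assumes "biproduct T X Y S"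
  obtains i j p q where "i \<in> hom X S" "j \<in> hom Y S" "p \<in> hom S X" "q \<in> hom S Y"
    "cmp X S X p i = idm X" "cmp Y S Y q j = idm Y" "cmp Y S X p j = 0" "cmp X S Y q i = 0"
    "cmp S X S i p + cmp S Y S j q = idm S"
  using assms unfolding biproduct_def by blast

lemma biproductI:
  assumes "i \<in> hom X S" "j \<in> hom Y S" "p \<in> hom S X" "q \<in> hom S Y"
    "cmp X S X p i = idm X" "cmp Y S Y q j = idm Y" "cmp Y S X p j = 0" "cmp X S Y q i = 0"
    "cmp S X S i p + cmp S Y S j q = idm S"
  shows "biproduct T X Y S"
  using assms unfolding biproduct_def by blast

lemma biproduct_commute: "biproduct T X Y S \<Longrightarrow> biproduct T Y X S"
  unfolding biproduct_def by (metis add.commute)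

text \<open>An object isomorphic to \<open>S\<close> is a summand of \<open>S\<close> with complement zero.\<close>

lemma biproduct_isoI:
  assumes "isomorphic T X S" "zero_obj T Z"
  shows "biproduct T X Z S"
proof -
  obtain f g where 1: "f \<in> hom X S" "g \<in> hom S X" "cmp X S X g f = idm X" "cmp S X S f g = idm S"
    using assms(1) by (rule isomorphicE)
  have "idm Z = 0" using assms(2) zero_obj_iff by blast
  then show ?thesis
    by (intro biproductI[of f X S 0 Z g 0]) (use 1 in simp_all)
qed

text \<open>
  A map \<open>e\<close> is invertible as soon as \<open>e - 1\<close> has square zero. This is how endomorphisms of a
  triangle that fix two of its objects are shown to be isomorphisms.
\<close>

lemma square_zero_iso:
  assumes "e \<in> hom A A" "cmp A A A (e - idm A) (e - idm A) = 0"
  shows "iso_map T A A e"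
proof (rule iso_mapI[of _ _ _ "idm A + idm A - e"])
  have "cmp A A A (e - idm A) (e - idm A) = cmp A A A e e - e - (e - idm A)"
    using assms(1) by (simp add: comp_linear)
  then have "cmp A A A e e = e + e - idm A"
    using assms(2) by (simp add: algebra_simps)
  then show "cmp A A A (idm A + idm A - e) e = idm A" "cmp A A A e (idm A + idm A - e) = idm A"
    using assms(1) by (simp_all add: comp_linear)
qed (use assms in simp_all)

end

section \<open>Triangles\<close>

context klinear_triangulated_category
begin

abbreviation sh :: "'b \<Rightarrow> 'b" where "sh \<equiv> shift T"
abbreviation ms :: "'b \<Rightarrow> 'b \<Rightarrow> 'c \<Rightarrow> 'c" where "ms \<equiv> mshift T"

subsection \<open>The suspension\<close>

lemma ms_Hom [simp]: "f \<in> hom X Y \<Longrightarrow> ms X Y f \<in> hom (sh X) (sh Y)"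
  using mshift_fully_faithful bij_betwE by blast

declare mshift_mid [simp] mshift_add [simp] mshift_scale [simp]

lemma ms_comp [simp]: "f \<in> hom X Y \<Longrightarrow> g \<in> hom Y Z \<Longrightarrow>
    cmp (sh X) (sh Y) (sh Z) (ms Y Z g) (ms X Y f) = ms X Z (cmp X Y Z g f)"
  by (simp add: mshift_mcomp)

lemma ms_zero [simp]: "ms X Y 0 = 0"
  using mshift_add[of 0 X Y 0] by simp

lemma ms_uminus [simp]: "f \<in> hom X Y \<Longrightarrow> ms X Y (- f) = - ms X Y f"
  using mshift_add[of f X Y "- f"] by (simp add: eq_neg_iff_add_eq_0 add.commute)

lemma ms_eq_iff: "f \<in> hom X Y \<Longrightarrow> g \<in> hom X Y \<Longrightarrow> ms X Y f = ms X Y g \<longleftrightarrow> f = g"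
  using mshift_fully_faithful by (metis bij_betw_def inj_onD)

lemma ms_eq_0_iff [simp]: "f \<in> hom X Y \<Longrightarrow> ms X Y f = 0 \<longleftrightarrow> f = 0"
  using ms_eq_iff[of f X Y 0] by simp

lemma ms_full:
  assumes "g \<in> hom (sh X) (sh Y)"
  obtains f where "f \<in> hom X Y" "g = ms X Y f"
  using assms mshift_fully_faithful by (metis bij_betw_def imageE)

lemma zero_obj_shift [simp]: "zero_obj T (sh Z) \<longleftrightarrow> zero_obj T Z"
  using ms_eq_0_iff[of "idm Z" Z Z] by (simp add: zero_obj_iff)

lemma iso_map_shift:
  assumes "iso_map T X Y f" shows "iso_map T (sh X) (sh Y) (ms X Y f)"
proof -
  obtain g where "f \<in> hom X Y" "g \<in> hom Y X" "cmp X Y X g f = idm X" "cmp Y X Y f g = idm Y"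
    using assms by (rule iso_mapE)
  then show ?thesis by (intro iso_mapI[of _ _ _ "ms Y X g"]) simp_all
qed

lemma isomorphic_shift [simp]: "isomorphic T (sh X) (sh Y) \<longleftrightarrow> isomorphic T X Y"
proof
  assume "isomorphic T (sh X) (sh Y)"
  then obtain f g where fg: "f \<in> hom (sh X) (sh Y)" "g \<in> hom (sh Y) (sh X)"
    "cmp (sh X) (sh Y) (sh X) g f = idm (sh X)" "cmp (sh Y) (sh X) (sh Y) f g = idm (sh Y)"
    by (rule isomorphicE)
  obtain f' g' where "f' \<in> hom X Y" "f = ms X Y f'" "g' \<in> hom Y X" "g = ms Y X g'"
    using fg ms_full by metis
  then show "isomorphic T X Y"
    using fg by (intro isomorphicI[of f' _ _ g'])
      (simp_all flip: ms_eq_iff[of _ X X] ms_eq_iff[of _ Y Y])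
next
  assume "isomorphic T X Y"
  then show "isomorphic T (sh X) (sh Y)"
    unfolding isomorphic_def using iso_map_shift by blast
qed

lemma biproduct_shift:
  assumes "biproduct T X Y S" shows "biproduct T (sh X) (sh Y) (sh S)"
proof -
  obtain i j p q where b: "i \<in> hom X S" "j \<in> hom Y S" "p \<in> hom S X" "q \<in> hom S Y"
    "cmp X S X p i = idm X" "cmp Y S Y q j = idm Y" "cmp Y S X p j = 0" "cmp X S Y q i = 0"
    "cmp S X S i p + cmp S Y S j q = idm S"
    using assms by (rule biproductE)
  show ?thesis
    by (rule biproductI[of "ms X S i" _ _ "ms Y S j" _ "ms S X p" "ms S Y q"])
      (use b in \<open>simp_all flip: mshift_add\<close>)
qed

lemma unshift:
  obtains X where "isomorphic T (sh X) Y"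
  using shift_ess_surj by blast

subsection \<open>Exactness\<close>

lemma tri_homs:
  assumes "tri T X Y Z f g h"
  shows "f \<in> hom X Y" "g \<in> hom Y Z" "h \<in> hom Z (sh X)"
  using tri_Hom[OF assms] by auto

lemma tri_rot:
  assumes "tri T X Y Z f g h" shows "tri T Y Z (sh X) g h (- ms X Y f)"
  using assms tri_homs[OF assms] tri_rotate by blast

lemma tri_gf: assumes "tri T X Y Z f g h" shows "cmp X Y Z g f = 0"
proof -
  note H = tri_homs[OF assms]
  obtain U where U: "zero_obj T U" using ex_zero_obj by blast
  obtain c where "c \<in> hom U Z" "cmp X U Z c 0 = cmp X Y Z g f"
    using tri_morphism[OF tri_mid[OF U, of X] assms mid_Hom H(1)] H by force
  then show ?thesis using U by simp
qed

lemma tri_hg: "tri T X Y Z f g h \<Longrightarrow> cmp Y Z (sh X) h g = 0"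
  using tri_gf tri_rot by blast

lemma tri_fh: assumes "tri T X Y Z f g h" shows "cmp Z (sh X) (sh Y) (ms X Y f) h = 0"
  using tri_hg[OF tri_rot[OF assms]] tri_homs[OF assms] by simp

lemma lift_through_f:
  assumes "tri T X Y Z f g h" "w \<in> hom W Y" "cmp W Y Z g w = 0"
  obtains v where "v \<in> hom W X" "w = cmp W X Y f v"
proof -
  note H = tri_homs[OF assms(1)]
  obtain U where U: "zero_obj T U" using ex_zero_obj by blast
  have 1: "tri T W U (sh W) 0 0 (- idm (sh W))"
    using tri_rot[OF tri_mid[OF U, of W]] by simp
  obtain c where c: "c \<in> hom (sh W) (sh X)"
     "cmp (sh W) (sh W) (sh Y) (ms W Y w) (- idm (sh W)) = cmp (sh W) (sh X) (sh Y) (- ms X Y f) c"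
    using tri_morphism[OF 1 tri_rot[OF assms(1)] assms(2) zero_Hom] H assms by auto
  obtain v where v: "v \<in> hom W X" "c = ms W X v" using c(1) by (rule ms_full)
  have "ms W Y w = ms W Y (cmp W X Y f v)"
    using c H v assms(2) by simp
  then have "w = cmp W X Y f v" using ms_eq_iff v H assms(2) by simp
  with v that show thesis by blast
qed

lemma lift_through_g:
  assumes "tri T X Y Z f g h" "w \<in> hom W Z" "cmp W Z (sh X) h w = 0"
  obtains v where "v \<in> hom W Y" "w = cmp W Y Z g v"
  using lift_through_f[OF tri_rot[OF assms(1)] assms(2,3)] by blast

lemma lift_through_h:
  assumes "tri T X Y Z f g h" "w \<in> hom W (sh X)" "cmp W (sh X) (sh Y) (ms X Y f) w = 0"
  obtains v where "v \<in> hom W Z" "w = cmp W Z (sh X) h v"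
  using lift_through_g[OF tri_rot[OF assms(1)] assms(2)] assms tri_homs[OF assms(1)] by auto

lemma extend_along_g:
  assumes "tri T X Y Z f g h" "w \<in> hom Y W" "cmp X Y W w f = 0"
  obtains v where "v \<in> hom Z W" "w = cmp Y Z W v g"
proof -
  note H = tri_homs[OF assms(1)]
  obtain U where U: "zero_obj T U" using ex_zero_obj by blast
  have "tri T W W (sh U) (idm W) 0 (- ms U W 0)"
    using tri_mid[of "sh U" W] U by simp
  then have 1: "tri T U W W 0 (idm W) 0"
    using tri_rotate[of 0 U W "idm W" W 0] by simp
  show thesis
    using tri_morphism[OF assms(1) 1, of 0 w] assms H that by auto
qed

lemma extend_along_h:
  assumes "tri T X Y Z f g h" "w \<in> hom Z W" "cmp Y Z W w g = 0"
  obtains v where "v \<in> hom (sh X) W" "w = cmp Z (sh X) W v h"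
  using extend_along_g[OF tri_rot[OF assms(1)] assms(2,3)] by blast

lemma tri_shift_iff:
  assumes "f \<in> hom X Y" "g \<in> hom Y Z" "h \<in> hom Z (sh X)"
  shows "tri T (sh X) (sh Y) (sh Z) (- ms X Y f) (- ms Y Z g) (- ms Z (sh X) h) \<longleftrightarrow> tri T X Y Z f g h"
proof -
  have "tri T X Y Z f g h \<longleftrightarrow> tri T Y Z (sh X) g h (- ms X Y f)"
    using assms by (rule tri_rotate)
  also have "\<dots> \<longleftrightarrow> tri T Z (sh X) (sh Y) h (- ms X Y f) (- ms Y Z g)"
    using assms by (intro tri_rotate) simp_all
  also have "\<dots> \<longleftrightarrow> tri T (sh X) (sh Y) (sh Z) (- ms X Y f) (- ms Y Z g) (- ms Z (sh X) h)"
    using assms by (intro tri_rotate) simp_all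
  finally show ?thesis by simp
qed


text \<open>Every map is the second map of a distinguished triangle, every map into a suspension the third.\<close>

lemma complete_to_third:
  assumes "f \<in> hom X Y"
  obtains W w u where "tri T W X Y w f u"
proof -
  obtain C g h where t: "tri T X Y C f g h" using tri_complete[OF assms] by blast
  note H = tri_homs[OF t]
  obtain W where "isomorphic T (sh W) C" by (rule unshift)
  then obtain \<phi> \<psi> where p: "\<phi> \<in> hom (sh W) C" "\<psi> \<in> hom C (sh W)"
    "cmp (sh W) C (sh W) \<psi> \<phi> = idm (sh W)" "cmp C (sh W) C \<phi> \<psi> = idm C" by (rule isomorphicE)
  obtain w where w: "w \<in> hom W X" "cmp (sh W) C (sh X) h \<phi> = ms W X w"
    using ms_full[of "cmp (sh W) C (sh X) h \<phi>" W X] H p by auto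
  have "iso_map T C (sh W) \<psi>" using p by (intro iso_mapI[of _ _ _ \<phi>]) simp_all
  then have "tri T X Y (sh W) f (cmp Y C (sh W) \<psi> g) (- ms W X (- w))"
    by (intro tri_iso[OF t _ _ _ iso_map_id iso_map_id, where c = \<psi>])
      (use H p w in \<open>simp_all flip: w(2)\<close>)
  then have "tri T W X Y (- w) f (cmp Y C (sh W) \<psi> g)"
    using tri_rotate[of "- w" W X f Y "cmp Y C (sh W) \<psi> g"] H p w by simp
  then show thesis by (rule that)
qed

lemma complete_to_first:
  assumes "h \<in> hom Z (sh X)"
  obtains Y f g where "tri T X Y Z f g h"
proof -
  obtain W w u where t: "tri T W Z (sh X) w h u" using assms by (rule complete_to_third)
  note H = tri_homs[OF t]
  obtain f where f: "f \<in> hom X W" "u = ms X W f" using H(3) by (rule ms_full)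
  then have "tri T X W Z (- f) w h"
    using tri_rotate[of "- f" X W w Z h] t H by simp
  then show thesis by (rule that)
qed

text \<open>An endomorphism of a triangle that is the identity on two of its objects is invertible.\<close>

lemma tri_third_endo_iso:
  assumes "tri T X Y Z f g h" "e \<in> hom Z Z" "cmp Y Z Z e g = g" "cmp Z Z (sh X) h e = h"
  shows "iso_map T Z Z e"
proof (rule square_zero_iso)
  note H = tri_homs[OF assms(1)]
  have "cmp Z Z (sh X) h (e - idm Z) = 0" using assms H by (simp add: comp_linear)
  then obtain v where v: "v \<in> hom Z Y" "e - idm Z = cmp Z Y Z g v"
    using lift_through_g[OF assms(1), of "e - idm Z" Z] assms by auto
  have "cmp Y Z Z (e - idm Z) g = 0" using assms H by (simp add: comp_linear)
  then have "cmp Z Z Z (e - idm Z) (cmp Z Y Z g v) = 0"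
    using comp_eq_assoc[of Y Z Z "e - idm Z" g 0 v Z] v H assms(2) by simp
  then show "cmp Z Z Z (e - idm Z) (e - idm Z) = 0" using v by simp
qed (rule assms)

lemma tri_second_endo_iso:
  assumes "tri T X Y Z f g h" "e \<in> hom Y Y" "cmp X Y Y e f = f" "cmp Y Y Z g e = g"
  shows "iso_map T Y Y e"
proof (rule square_zero_iso)
  note H = tri_homs[OF assms(1)]
  have "cmp Y Y Z g (e - idm Y) = 0" using assms H by (simp add: comp_linear)
  then obtain v where v: "v \<in> hom Y X" "e - idm Y = cmp Y X Y f v"
    using lift_through_f[OF assms(1), of "e - idm Y" Y] assms by auto
  have "cmp X Y Y (e - idm Y) f = 0" using assms H by (simp add: comp_linear)
  then have "cmp Y Y Y (e - idm Y) (cmp Y X Y f v) = 0"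
    using comp_eq_assoc[of X Y Y "e - idm Y" f 0 v Y] v H assms(2) by simp
  then show "cmp Y Y Y (e - idm Y) (e - idm Y) = 0" using v by simp
qed (rule assms)

subsection \<open>Retracts are direct summands\<close>

lemma retract_complement:
  assumes s: "s \<in> hom A S" and r: "r \<in> hom S A" and rs: "cmp A S A r s = idm A"
  obtains C j q where "tri T A S C s q 0" "j \<in> hom C S" "q \<in> hom S C" "cmp C S C q j = idm C"
    "cmp C S A r j = 0" "cmp A S C q s = 0" "cmp S A S s r + cmp S C S j q = idm S"
proof -
  obtain C q h where t: "tri T A S C s q h" using tri_complete[OF s] by blast
  note H = tri_homs[OF t]
  have "cmp C (sh S) (sh A) (ms S A r) (cmp C (sh A) (sh S) (ms A S s) h) = h"
    using comp_eq_assoc[of "sh A" "sh S" "sh A" "ms S A r" "ms A S s" "idm (sh A)" h C] H r s rs by simp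
  then have h0: "h = 0" using tri_fh[OF t] r by simp
  obtain j' where j': "j' \<in> hom C S" "idm C = cmp C S C q j'"
    using lift_through_g[OF t, of "idm C" C] h0 by auto
  define j where "j = j' - cmp C A S s (cmp C S A r j')"
  have qs: "cmp A S C q s = 0" using t by (rule tri_gf)
  have jH: "j \<in> hom C S" using j' s r unfolding j_def by simp
  have qj: "cmp C S C q j = idm C"
    using j' s r H unfolding j_def by (simp add: comp_linear comp_eq_assoc[OF qs])
  have rj: "cmp C S A r j = 0"
    using j' s r H unfolding j_def by (simp add: comp_linear comp_eq_assoc[OF rs])
  define n where "n = idm S - cmp S A S s r - cmp S C S j q"
  have nH: "n \<in> hom S S" using jH s r H unfolding n_def by simp
  have "cmp S S C q n = 0"
    using jH s r H unfolding n_def by (simp add: comp_linear comp_eq_assoc[OF qs] comp_eq_assoc[OF qj])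
  then obtain v where v: "v \<in> hom S A" "n = cmp S A S s v"
    using lift_through_f[OF t nH] by blast
  have "cmp S S A r n = 0"
    using jH s r H unfolding n_def by (simp add: comp_linear comp_eq_assoc[OF rs] comp_eq_assoc[OF rj])
  then have "v = 0" using v r s by (simp add: comp_eq_assoc[OF rs])
  then have "n = 0" using v s by simp
  then have "cmp S A S s r + cmp S C S j q = idm S" unfolding n_def by (simp add: algebra_simps)
  with that t h0 jH H qj rj qs show thesis by blast
qed

lemma retract_biproduct:
  assumes "s \<in> hom A S" "r \<in> hom S A" "cmp A S A r s = idm A"
  shows "\<exists>C. biproduct T A C S"
proof -
  obtain C j q where "tri T A S C s q 0" "j \<in> hom C S" "q \<in> hom S C" "cmp C S C q j = idm C"
    "cmp C S A r j = 0" "cmp A S C q s = 0" "cmp S A S s r + cmp S C S j q = idm S"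
    using assms by (rule retract_complement)
  then show ?thesis using assms by (intro exI biproductI[of s _ _ j _ r q]) 
qed

lemma biproduct_triangle:
  assumes i: "i \<in> hom X S" "j \<in> hom Y S" "p \<in> hom S X" "q \<in> hom S Y"
    "cmp X S X p i = idm X" "cmp Y S Y q j = idm Y" "cmp Y S X p j = 0" "cmp X S Y q i = 0"
    "cmp S X S i p + cmp S Y S j q = idm S"
  shows "tri T X S Y i q 0"
proof -
  obtain C j' q' where c: "tri T X S C i q' 0" "j' \<in> hom C S" "q' \<in> hom S C" "cmp C S C q' j' = idm C"
    "cmp C S X p j' = 0" "cmp X S C q' i = 0" "cmp S X S i p + cmp S C S j' q' = idm S"
    using i(1,3,5) by (rule retract_complement)
  have 1: "cmp S C S j' q' = cmp S Y S j q" using c(7) i(9) by (metis add_left_cancel)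
  have 2: "cmp S C Y (cmp C S Y q j') q' = q"
    using arg_cong[OF 1, of "cmp S S Y q"] i c by (simp add: comp_eq_assoc[OF i(6)])
  have 3: "cmp S Y C (cmp Y S C q' j) q = q'"
    using arg_cong[OF 1, of "cmp S S C q'"] i c by (simp add: comp_eq_assoc[OF c(4)])
  have "cmp Y S Y (cmp S C Y (cmp C S Y q j') q') j = idm Y"
    using 2 i by simp
  moreover have "cmp C S C (cmp S Y C (cmp Y S C q' j) q) j' = idm C"
    using 3 c by simp
  ultimately have "iso_map T C Y (cmp C S Y q j')"
    using i c by (intro iso_mapI[of _ _ _ "cmp Y S C q' j"]) simp_all
  then show ?thesis
    by (intro tri_iso[OF c(1) _ _ _ iso_map_id iso_map_id, where c = "cmp C S Y q j'"]) (use i c 2 in simp_all)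
qed

end

section \<open>Closed classes of objects\<close>

context klinear_triangulated_category
begin

text \<open>The smallest closed class containing \<open>X\<close> is \<open>\<langle>X\<rangle>\<^sub>1\<close>.\<close>

abbreviation closed :: "'b set \<Rightarrow> bool" where "closed \<equiv> additive_summand_shift_closed T"

lemma closed_zero: "closed S \<Longrightarrow> zero_obj T Z \<Longrightarrow> Z \<in> S"
  unfolding additive_summand_shift_closed_def by blast

lemma closed_biproduct: "closed S \<Longrightarrow> X \<in> S \<Longrightarrow> Y \<in> S \<Longrightarrow> biproduct T X Y B \<Longrightarrow> B \<in> S"
  unfolding additive_summand_shift_closed_def by blast

lemma closed_summand: "closed S \<Longrightarrow> B \<in> S \<Longrightarrow> biproduct T X Y B \<Longrightarrow> X \<in> S"
  unfolding additive_summand_shift_closed_def by blast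

lemma closed_shift: "closed S \<Longrightarrow> sh X \<in> S \<longleftrightarrow> X \<in> S"
  unfolding additive_summand_shift_closed_def by blast

lemma closed_iso:
  assumes "closed S" "isomorphic T X Y" "X \<in> S" shows "Y \<in> S"
proof -
  obtain U where "zero_obj T U" using ex_zero_obj by blast
  then have "biproduct T Y U X"
    using isomorphic_sym[OF assms(2)] by (intro biproduct_isoI)
  then show ?thesis by (rule closed_summand[OF assms(1,3)])
qed

lemma closed_retract:
  assumes S: "closed S" "B \<in> S" and d: "d \<in> hom A B" "c \<in> hom B A" "iso_map T A A (cmp A B A c d)"
  shows "A \<in> S"
proof -
  obtain e where e: "e \<in> hom A A" "cmp A A A e (cmp A B A c d) = idm A"
    using d(3) by (rule iso_mapE)
  have "\<exists>C. biproduct T A C B"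
    by (rule retract_biproduct[of d _ _ "cmp B A A e c"]) (use d e in simp_all)
  then show ?thesis using closed_summand[OF S] by blast
qed

lemma closed_retract_sum:
  assumes S: "closed S" "B \<in> S" "B' \<in> S"
    and d: "d \<in> hom A B" "c \<in> hom B A" "d' \<in> hom A B'" "c' \<in> hom B' A"
    and iso: "iso_map T A A (cmp A B A c d + cmp A B' A c' d')"
  shows "A \<in> S"
proof -
  obtain R where R: "biproduct T B B' R" using ex_biproduct by blast
  obtain i j p q where b: "i \<in> hom B R" "j \<in> hom B' R" "p \<in> hom R B" "q \<in> hom R B'"
    "cmp B R B p i = idm B" "cmp B' R B' q j = idm B'" "cmp B' R B p j = 0" "cmp B R B' q i = 0"
    "cmp R B R i p + cmp R B' R j q = idm R"
    using R by (rule biproductE)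
  note bs = comp_eq_assoc[OF b(5)] comp_eq_assoc[OF b(6)] comp_eq_assoc[OF b(7)] comp_eq_assoc[OF b(8)]
  have "cmp A R A (cmp R B A c p + cmp R B' A c' q) (cmp A B R i d + cmp A B' R j d')
    = cmp A B A c d + cmp A B' A c' d'"
    using b d by (simp add: comp_linear bs)
  then show ?thesis
    using closed_retract[OF S(1), of R "cmp A B R i d + cmp A B' R j d'" A
        "cmp R B A c p + cmp R B' A c' q"] closed_biproduct[OF S R] b d iso by simp
qed

lemma closed_hull: "closed (closed hull W)"
proof (rule hull_in)
  fix \<S> :: "'b set set"
  assume c: "Ball \<S> closed"
  show "closed (\<Inter>\<S>)"
    unfolding additive_summand_shift_closed_def
  proof (intro conjI allI impI)
    show "Z \<in> \<Inter>\<S>" if "zero_obj T Z" for Z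
      using c that closed_zero by blast
    show "B \<in> \<Inter>\<S>" if "X \<in> \<Inter>\<S>" "Y \<in> \<Inter>\<S>" "biproduct T X Y B" for X Y B
      using c that closed_biproduct by blast
    show "X \<in> \<Inter>\<S>" if "B \<in> \<Inter>\<S>" "biproduct T X Y B" for X Y B
      using c that closed_summand by blast
    show "sh X \<in> \<Inter>\<S> \<longleftrightarrow> X \<in> \<Inter>\<S>" for X
      using c closed_shift by (simp add: Ball_def)
  qed
qed

lemma thick_hull_UNIV:
  "classical_generator T G \<Longrightarrow> thick T S \<Longrightarrow> G \<in> S \<Longrightarrow> X \<in> S"
  unfolding classical_generator_def using hull_minimal[of "{G}" S "thick T"] by auto

lemma thick_biproduct:
  assumes S: "thick T S" and XY: "X \<in> S" "Y \<in> S" and B: "biproduct T X Y B"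
  shows "B \<in> S"
proof -
  obtain i j p q where "i \<in> hom X B" "j \<in> hom Y B" "p \<in> hom B X" "q \<in> hom B Y"
    "cmp X B X p i = idm X" "cmp Y B Y q j = idm Y" "cmp Y B X p j = 0" "cmp X B Y q i = 0"
    "cmp B X B i p + cmp B Y B j q = idm B"
    using B by (rule biproductE)
  then have "tri T X B Y i q 0" by (rule biproduct_triangle)
  then have "tri T Y (sh X) (sh B) 0 (- ms X B i) (- ms B Y q)"
    by (intro tri_rot) 
  moreover have "sh X \<in> S" using S XY unfolding thick_def by blast
  ultimately have "sh B \<in> S" using S XY unfolding thick_def by blast
  then show ?thesis using S unfolding thick_def by blast
qed

lemma thick_closed:
  assumes "thick T S" shows "closed S"
  unfolding additive_summand_shift_closed_def
proof (intro conjI allI impI)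
  show "Z \<in> S" if "zero_obj T Z" for Z
    using assms that by (simp add: thick_def)
  show "B \<in> S" if "X \<in> S" "Y \<in> S" "biproduct T X Y B" for X Y B
    using assms that by (rule thick_biproduct)
  show "X \<in> S" if "B \<in> S" "biproduct T X Y B" for X Y B
    using assms that unfolding thick_def by blast
  show "sh X \<in> S \<longleftrightarrow> X \<in> S" for X
    using assms by (simp add: thick_def)
qed

end

section \<open>Linear generators\<close>

lemma (in klinear_category) lin_le_iff:
  "lin_le T Q P \<longleftrightarrow> (\<exists>e\<in>hom P Q. e \<noteq> 0 \<and> (\<forall>f\<in>hom P Q. \<exists>r. f = mscale T r e))"
proof
  assume "lin_le T Q P"
  then obtain \<phi> where l: "Vector_Spaces.linear (*) (mscale T) \<phi>" and b: "bij_betw \<phi> UNIV (hom P Q)"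
    unfolding lin_le_def by blast
  interpret l: Vector_Spaces.linear "(*)" "mscale T" \<phi> by (rule l)
  have "\<phi> 1 \<noteq> 0" using b l.zero by (metis UNIV_I bij_betw_def inj_onD zero_neq_one)
  moreover have "\<exists>r. f = mscale T r (\<phi> 1)" if f: "f \<in> hom P Q" for f
  proof -
    obtain r where "f = \<phi> r" using b f by (metis bij_betw_def imageE)
    then show ?thesis using l.scale[of r 1] by auto
  qed
  moreover have "\<phi> 1 \<in> hom P Q" using b bij_betwE by blast
  ultimately show "\<exists>e\<in>hom P Q. e \<noteq> 0 \<and> (\<forall>f\<in>hom P Q. \<exists>r. f = mscale T r e)" by blast
next
  assume "\<exists>e\<in>hom P Q. e \<noteq> 0 \<and> (\<forall>f\<in>hom P Q. \<exists>r. f = mscale T r e)"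
  then obtain e where e: "e \<in> hom P Q" "e \<noteq> 0" "\<And>f. f \<in> hom P Q \<Longrightarrow> \<exists>r. f = mscale T r e" by blast
  interpret k: vector_space "(*) :: 'k \<Rightarrow> 'k \<Rightarrow> 'k"
    by unfold_locales (simp_all add: algebra_simps)
  have "module_hom (*) (mscale T) (\<lambda>r. mscale T r e)"
    unfolding module_hom_iff
    using k.module_axioms V.module_axioms
    by (simp add: V.scale_left_distrib)
  then have "Vector_Spaces.linear (*) (mscale T) (\<lambda>r. mscale T r e)"
    using k.vector_space_axioms V.vector_space_axioms
    by (simp add: Vector_Spaces.linear_def)
  moreover have "bij_betw (\<lambda>r. mscale T r e) UNIV (hom P Q)"
    unfolding bij_betw_def inj_on_def using e by auto
  ultimately show "lin_le T Q P" unfolding lin_le_def by blast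
qed

lemma (in klinear_category) local_End_imp_indecomposable:
  assumes "local_End T X" shows "indecomposable T X"
  unfolding indecomposable_def
proof (intro conjI allI impI)
  show "\<not> zero_obj T X" using assms by (simp add: local_End_def zero_obj_iff)
  fix A B assume "biproduct T A B X"
  then obtain i j p q where b: "i \<in> hom A X" "j \<in> hom B X" "p \<in> hom X A" "q \<in> hom X B"
    "cmp A X A p i = idm A" "cmp B X B q j = idm B" "cmp B X A p j = 0" "cmp A X B q i = 0"
    "cmp X A X i p + cmp X B X j q = idm X"
    by (rule biproductE)
  have z: "zero_obj T A'" if h: "iso_map T X X (cmp X B' X j' q')" "j' \<in> hom B' X" "q' \<in> hom X B'"
    "i' \<in> hom A' X" "p' \<in> hom X A'" "cmp A' X A' p' i' = idm A'" "cmp A' X B' q' i' = 0" 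
    for A' B' i' j' p' q'
  proof -
    obtain e where e: "e \<in> hom X X" "cmp X X X e (cmp X B' X j' q') = idm X"
      using h(1) by (rule iso_mapE)
    have "cmp A' X X (cmp X X X e (cmp X B' X j' q')) i' = 0"
      using h(2-) e(1) by simp
    then have "i' = 0" using e h by simp
    then show ?thesis using h(5,6) by (simp add: zero_obj_iff)
  qed
  have "iso_map T X X (cmp X A X i p) \<or> iso_map T X X (cmp X B X j q)"
    using assms b iso_map_id[of X] unfolding local_End_def by (metis mcomp_Hom)
  then show "zero_obj T A \<or> zero_obj T B"
    using z[where B' = A and A' = B] z[where B' = B and A' = A] b by blast
qed

text \<open>A Krull-Schmidt triangulated category with a linear generator \<open>G\<close>.\<close>

locale linearly_generated = klinear_triangulated_category T
  for T :: "('k::field, 'o, 'm::ab_group_add) tricat" +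
  fixes G :: 'o
  assumes lin: "linear_generator T G" and ks: "krull_schmidt T"
begin

text \<open>\<open>addG\<close> is \<open>\<langle>G\<rangle>\<^sub>1\<close>.\<close>

definition addG :: "'o set" where "addG = closed hull {G}"

text \<open>\<open>ind\<close> is the class of indecomposable objects on which the axioms of a linear generator bear.\<close>

definition ind :: "'o set" where "ind = {P \<in> addG. indecomposable T P}"

lemma closed_addG: "closed addG"
  unfolding addG_def by (rule closed_hull)

lemma G_addG: "G \<in> addG"
  unfolding addG_def using hull_inc[of G "{G}" closed] by simp

lemma ind_addG: "P \<in> ind \<Longrightarrow> P \<in> addG"
  by (simp add: ind_def)

lemma generator_ind: "{P \<in> generated_in T G 1. indecomposable T P} = ind"
  by (simp add: ind_def addG_def)

lemmas G1_refl = linear_generator.G1_refl[OF lin, unfolded generator_ind]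
  and G1_antisym = linear_generator.G1_antisym[OF lin, unfolded generator_ind]
  and G1_trans = linear_generator.G1_trans[OF lin, unfolded generator_ind]
  and G1_total = linear_generator.G1_total[OF lin, unfolded generator_ind]
  and G1_zero = linear_generator.G1_zero[OF lin, unfolded generator_ind]
  and G2 = linear_generator.G2[OF lin, unfolded generator_ind]
  and G4 = linear_generator.G4[OF lin, unfolded generator_ind]

lemma thick_UNIV: "thick T S \<Longrightarrow> G \<in> S \<Longrightarrow> X \<in> S"
  using thick_hull_UNIV linear_generator.generator[OF lin] by blast

text \<open>
  This description of \<open>ind\<close> by one-dimensional endomorphism spaces, unlike the definition, is visibly
  invariant under isomorphism and suspension.
\<close>

lemma ind_iff:
  assumes "P \<in> addG"
  shows "P \<in> ind \<longleftrightarrow> idm P \<noteq> 0 \<and> (\<forall>f\<in>hom P P. \<exists>r. f = mscale T r (idm P))"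
proof
  assume P: "P \<in> ind"
  then have id0: "idm P \<noteq> 0" by (simp add: ind_def indecomposable_def zero_obj_iff)
  obtain e where e: "e \<in> hom P P" "\<And>f. f \<in> hom P P \<Longrightarrow> \<exists>r. f = mscale T r e"
    using G1_refl[OF P] unfolding lin_le_iff by blast
  obtain r where r: "idm P = mscale T r e" using e mid_Hom by blast
  then have "r \<noteq> 0" using id0 by auto
  then have "e = mscale T (inverse r) (idm P)" by (simp add: r)
  then have "\<forall>f\<in>hom P P. \<exists>r. f = mscale T r (idm P)"
    using e(2) by (metis V.scale_scale)
  with id0 show "idm P \<noteq> 0 \<and> (\<forall>f\<in>hom P P. \<exists>r. f = mscale T r (idm P))" by blast
next
  assume P: "idm P \<noteq> 0 \<and> (\<forall>f\<in>hom P P. \<exists>r. f = mscale T r (idm P))"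
  have "iso_map T P P f" if f: "f \<in> hom P P" "f \<noteq> 0" for f
  proof -
    obtain r where r: "f = mscale T r (idm P)" using P f by blast
    then have "r \<noteq> 0" using f by auto
    then show ?thesis
      using r by (intro iso_mapI[of _ _ _ "mscale T (inverse r) (idm P)"])
        (simp_all add: comp_linear)
  qed
  moreover have "\<not> iso_map T P P 0"
    using P by (auto elim: iso_mapE)
  ultimately have "local_End T P" using P unfolding local_End_def by force
  then show "P \<in> ind" using assms local_End_imp_indecomposable by (simp add: ind_def)
qed

lemma ind_idm: "P \<in> ind \<Longrightarrow> idm P \<noteq> 0"
  using ind_iff ind_addG by blast

lemma ind_endo: "P \<in> ind \<Longrightarrow> f \<in> hom P P \<Longrightarrow> \<exists>r. f = mscale T r (idm P)"
  using ind_iff ind_addG by blast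

lemma ind_iso:
  assumes P: "P \<in> ind" and PQ: "isomorphic T P Q" shows "Q \<in> ind"
proof -
  have Q: "Q \<in> addG" using closed_iso[OF closed_addG PQ] ind_addG P by blast
  obtain f g where b: "f \<in> hom P Q" "g \<in> hom Q P" "cmp P Q P g f = idm P" "cmp Q P Q f g = idm Q"
    using PQ by (rule isomorphicE)
  have "idm Q \<noteq> 0"
  proof
    assume "idm Q = 0"
    then have "f = 0" using mcomp_mid_left[OF b(1)] b(1) by simp
    then show False using b ind_idm[OF P] by simp
  qed
  moreover have "\<exists>r. h = mscale T r (idm Q)" if h: "h \<in> hom Q Q" for h
  proof -
    obtain r where r: "cmp P Q P g (cmp P Q Q h f) = mscale T r (idm P)"
      using ind_endo[OF P] b h by (meson mcomp_Hom)
    have "h = cmp Q P Q f (cmp Q P P (cmp P Q P g (cmp P Q Q h f)) g)"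
      using b h by (simp add: comp_eq_assoc[OF b(4)])
    also have "\<dots> = mscale T r (idm Q)"
      unfolding r using b by (simp add: comp_linear)
    finally show ?thesis by blast
  qed
  ultimately show ?thesis using ind_iff[OF Q] by blast
qed

lemma ind_shift [simp]: "sh P \<in> ind \<longleftrightarrow> P \<in> ind"
proof -
  have "(\<forall>f\<in>hom (sh P) (sh P). \<exists>r. f = mscale T r (idm (sh P))) \<longleftrightarrow>
      (\<forall>f\<in>hom P P. \<exists>r. f = mscale T r (idm P))"
    (is "?L \<longleftrightarrow> ?R")
  proof
    assume L: ?L
    show ?R
    proof
      fix f assume f: "f \<in> hom P P"
      then obtain r where "ms P P f = mscale T r (idm (sh P))" using L ms_Hom by blast
      then have "ms P P f = ms P P (mscale T r (idm P))" by simp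
      then show "\<exists>r. f = mscale T r (idm P)" using ms_eq_iff f by (metis mid_Hom scale_Hom)
    qed
  next
    assume R: ?R
    show ?L
    proof
      fix f assume "f \<in> hom (sh P) (sh P)"
      then obtain f' where "f' \<in> hom P P" "f = ms P P f'" by (rule ms_full)
      then show "\<exists>r. f = mscale T r (idm (sh P))" using R by force
    qed
  qed
  moreover have "idm (sh P) = 0 \<longleftrightarrow> idm P = 0" using zero_obj_shift zero_obj_iff by blast
  moreover have "sh P \<in> addG \<longleftrightarrow> P \<in> addG" by (rule closed_shift[OF closed_addG])
  ultimately show ?thesis using ind_iff ind_addG by blast
qed

subsection \<open>The linear order on the indecomposables\<close>

text \<open>Between indecomposables, \<open>Q \<le> P\<close> holds if and only if there is a nonzero map \<open>P \<rightarrow> Q\<close>.\<close>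

lemma nonzero_le:
  assumes "P \<in> ind" "Q \<in> ind" "f \<in> hom P Q" "f \<noteq> 0"
  shows "lin_le T Q P"
proof (rule ccontr)
  assume n: "\<not> lin_le T Q P"
  then have PQ: "lin_le T P Q" using G1_total assms by blast
  have "isomorphic T P Q"
    using G1_zero[OF assms(2,1) PQ] assms(3,4) by auto
  then obtain g h where b: "g \<in> hom P Q" "h \<in> hom Q P" "cmp P Q P h g = idm P" "cmp Q P Q g h = idm Q"
    by (rule isomorphicE)
  have "\<exists>r. k = mscale T r g" if k: "k \<in> hom P Q" for k
  proof -
    obtain r where r: "cmp P Q P h k = mscale T r (idm P)"
      using ind_endo[OF assms(1)] b k by (meson mcomp_Hom)
    have "k = cmp P P Q g (cmp P Q P h k)" using b k by (simp add: comp_eq_assoc[OF b(4)])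
    then show ?thesis unfolding r using b by (auto simp: comp_linear)
  qed
  moreover have "g \<noteq> 0" using b ind_idm[OF assms(1)] by auto
  ultimately show False using n b unfolding lin_le_iff by blast
qed

lemma le_nonzero: "lin_le T Q P \<Longrightarrow> \<exists>f\<in>hom P Q. f \<noteq> 0"
  unfolding lin_le_iff by blast

lemma iso_nonzero:
  assumes "A \<in> ind" "isomorphic T A B" shows "\<exists>f\<in>hom A B. f \<noteq> 0"
proof -
  obtain f g where "f \<in> hom A B" "g \<in> hom B A" "cmp A B A g f = idm A"
    using assms(2) by (rule isomorphicE)
  then show ?thesis using ind_idm[OF assms(1)] by (intro bexI[of _ f]) auto
qed

lemma one_dim:
  assumes "P \<in> ind" "Q \<in> ind" "f \<in> hom P Q" "f \<noteq> 0" "h \<in> hom P Q"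
  shows "\<exists>r. h = mscale T r f"
proof -
  obtain e where e: "\<And>f. f \<in> hom P Q \<Longrightarrow> \<exists>r. f = mscale T r e"
    using nonzero_le[OF assms(1-4)] unfolding lin_le_iff by blast
  obtain r s where rs: "f = mscale T r e" "h = mscale T s e" using e assms by blast
  then have "r \<noteq> 0" using assms by auto
  then have "h = mscale T (s / r) f" using rs by simp
  then show ?thesis ..
qed

lemma comp_nonzero:
  assumes P: "P \<in> ind" "Q \<in> ind" "R \<in> ind"
    and f: "f \<in> hom P Q" "f \<noteq> 0" and g: "g \<in> hom Q R" "g \<noteq> 0"
  shows "cmp P Q R g f \<noteq> 0"
proof
  assume z: "cmp P Q R g f = 0"
  have le: "lin_le T Q P" "lin_le T R Q" using nonzero_le assms by blast+
  then have "lin_le T R P" using G1_trans P by blast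
  then obtain h where h: "h \<in> hom P R" "h \<noteq> 0" using le_nonzero by blast
  obtain a b where ab: "a \<in> hom P Q" "b \<in> hom Q R" "h = cmp P Q R b a"
    using G4[OF P le(2,1) h] by blast
  obtain r s where "a = mscale T r f" "b = mscale T s g"
    using one_dim[OF P(1,2) f ab(1)] one_dim[OF P(2,3) g ab(2)] by blast
  then have "h = 0" using ab f g z by (simp add: comp_linear)
  with h show False by blast
qed

text \<open>
  Given nonzero maps \<open>P \<rightarrow> Q \<rightarrow> R\<close>, every map \<open>P \<rightarrow> R\<close> is a multiple of their composite, so it factors
  through either of them.
\<close>

lemma factor_scaled:
  assumes P: "P \<in> ind" "Q \<in> ind" "R \<in> ind"
    and f: "f \<in> hom P Q" "f \<noteq> 0" and g: "g \<in> hom Q R" "g \<noteq> 0" and h: "h \<in> hom P R"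
  shows "\<exists>r. h = cmp P Q R g (mscale T r f)" "\<exists>r. h = cmp P Q R (mscale T r g) f"
proof -
  obtain r where "h = mscale T r (cmp P Q R g f)"
    using one_dim[OF P(1,3) _ comp_nonzero[OF P f g] h] f g by auto
  then have "h = cmp P Q R g (mscale T r f)" "h = cmp P Q R (mscale T r g) f"
    using f g by (simp_all add: comp_linear)
  then show "\<exists>r. h = cmp P Q R g (mscale T r f)" "\<exists>r. h = cmp P Q R (mscale T r g) f" by blast+
qed

subsection \<open>Resolutions of the identity\<close>

text \<open>
  A resolution of \<open>N\<close> writes its identity as a finite sum of maps that factor through indecomposables.
  The summands need not be orthogonal idempotents: only the sum formula is used. Arbitrary finite index
  sets allow an index to be removed when a summand is split off.
\<close>

definition resolution :: "nat set \<Rightarrow> 'o \<Rightarrow> (nat \<Rightarrow> 'o) \<Rightarrow> (nat \<Rightarrow> 'm) \<Rightarrow> (nat \<Rightarrow> 'm) \<Rightarrow> bool" where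
  "resolution L N X i p \<longleftrightarrow> finite L \<and>
     (\<forall>l\<in>L. X l \<in> ind \<and> i l \<in> hom (X l) N \<and> p l \<in> hom N (X l)) \<and>
     idm N = (\<Sum>l\<in>L. cmp N (X l) N (i l) (p l))"

lemma resolutionD:
  assumes "resolution L N X i p"
  shows "finite L" "idm N = (\<Sum>l\<in>L. cmp N (X l) N (i l) (p l))"
    and "l \<in> L \<Longrightarrow> X l \<in> ind" "l \<in> L \<Longrightarrow> i l \<in> hom (X l) N" "l \<in> L \<Longrightarrow> p l \<in> hom N (X l)"
  using assms unfolding resolution_def by blast+

lemma resolution_sum_right:
  assumes "resolution L N X i p" "f \<in> hom N M"
  shows "f = (\<Sum>l\<in>L. cmp N (X l) M (cmp (X l) N M f (i l)) (p l))"
proof -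
  note R = resolutionD[OF assms(1)]
  have "f = cmp N N M f (\<Sum>l\<in>L. cmp N (X l) N (i l) (p l))"
    using assms(2) by (simp flip: R(2))
  also have "\<dots> = (\<Sum>l\<in>L. cmp N N M f (cmp N (X l) N (i l) (p l)))"
    using R assms by (intro comp_sum_right) simp_all
  also have "\<dots> = (\<Sum>l\<in>L. cmp N (X l) M (cmp (X l) N M f (i l)) (p l))"
    using R assms by (intro sum.cong) simp_all
  finally show ?thesis .
qed

lemma resolution_sum_left:
  assumes "resolution L N X i p" "f \<in> hom M N"
  shows "f = (\<Sum>l\<in>L. cmp M (X l) N (i l) (cmp M N (X l) (p l) f))"
proof -
  note R = resolutionD[OF assms(1)]
  have "f = cmp M N N (\<Sum>l\<in>L. cmp N (X l) N (i l) (p l)) f"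
    using assms(2) by (simp flip: R(2))
  also have "\<dots> = (\<Sum>l\<in>L. cmp M N N (cmp N (X l) N (i l) (p l)) f)"
    using R assms by (intro comp_sum_left) simp_all
  also have "\<dots> = (\<Sum>l\<in>L. cmp M (X l) N (i l) (cmp M N (X l) (p l) f))"
    using R assms by (intro sum.cong) simp_all
  finally show ?thesis .
qed

lemma finite_direct_sum_resolution:
  assumes "finite_direct_sum T Xs N" "N \<in> addG" "\<forall>Y\<in>set Xs. local_End T Y"
  shows "\<exists>X i p. resolution {..<length Xs} N X i p"
  using assms
proof (induction rule: finite_direct_sum.induct)
  case (1 S)
  then show ?case by (auto simp: resolution_def zero_obj_iff)
next
  case (2 Xs R P S)
  obtain i j p q where b: "i \<in> hom P S" "j \<in> hom R S" "p \<in> hom S P" "q \<in> hom S R"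
    "cmp P S P p i = idm P" "cmp R S R q j = idm R" "cmp R S P p j = 0" "cmp P S R q i = 0"
    "cmp S P S i p + cmp S R S j q = idm S"
    using \<open>biproduct T P R S\<close> by (rule biproductE)
  have "P \<in> addG" "R \<in> addG"
    using closed_summand[OF closed_addG] 2 biproduct_commute by blast+
  then have P: "P \<in> ind" using 2 local_End_imp_indecomposable by (simp add: ind_def)
  obtain X i' p' where r: "resolution {..<length Xs} R X i' p'" using 2 \<open>R \<in> addG\<close> by auto
  note rd = resolutionD[OF r]
  define X' where "X' = case_nat P X"
  define i'' where "i'' = case_nat i (\<lambda>l. cmp (X l) R S j (i' l))"
  define p'' where "p'' = case_nat p (\<lambda>l. cmp S R (X l) (p' l) q)"
  have "cmp S R S j q = (\<Sum>l<length Xs. cmp S (X l) S (cmp (X l) R S j (i' l)) (cmp S R (X l) (p' l) q))"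
  proof -
    have "cmp S R S j q = cmp S R S j (\<Sum>l<length Xs. cmp S (X l) R (i' l) (cmp S R (X l) (p' l) q))"
      using resolution_sum_left[OF r b(4)] by simp
    also have "\<dots> = (\<Sum>l<length Xs. cmp S R S j (cmp S (X l) R (i' l) (cmp S R (X l) (p' l) q)))"
      using rd b by (intro comp_sum_right) simp_all
    also have "\<dots> = (\<Sum>l<length Xs. cmp S (X l) S (cmp (X l) R S j (i' l)) (cmp S R (X l) (p' l) q))"
      using rd b by (intro sum.cong) simp_all
    finally show ?thesis .
  qed
  then have "idm S = (\<Sum>l<length (P # Xs). cmp S (X' l) S (i'' l) (p'' l))"
    using b(9) by (simp add: sum.lessThan_Suc_shift X'_def i''_def p''_def del: sum.lessThan_Suc)
  moreover have "X' l \<in> ind \<and> i'' l \<in> hom (X' l) S \<and> p'' l \<in> hom S (X' l)" if "l < length (P # Xs)" for l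
    using that b P rd by (cases l) (simp_all add: X'_def i''_def p''_def)
  ultimately show ?case unfolding resolution_def by blast
qed

lemma ex_resolution:
  assumes "N \<in> addG"
  obtains L X i p where "resolution L N X i p"
  using assms finite_direct_sum_resolution ks unfolding krull_schmidt_def by metis

end

section \<open>Splitting maps between sums of indecomposables\<close>

text \<open>
  Stated for a relation on indices, because the order on indecomposables is antisymmetric only up to
  isomorphism.
\<close>

lemma finite_least:
  assumes "finite A" "A \<noteq> {}" "\<And>x y. x \<in> A \<Longrightarrow> y \<in> A \<Longrightarrow> le x y \<or> le y x"
    "\<And>x y z. x \<in> A \<Longrightarrow> y \<in> A \<Longrightarrow> z \<in> A \<Longrightarrow> le x y \<Longrightarrow> le y z \<Longrightarrow> le x z"
  shows "\<exists>x\<in>A. \<forall>y\<in>A. le x y"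
  using assms
proof (induction A rule: finite_ne_induct)
  case (singleton x)
  then show ?case by blast
next
  case (insert x F)
  have "\<exists>x\<in>F. \<forall>y\<in>F. le x y"
  proof (rule insert.IH)
    show "le x y \<or> le y x" if "x \<in> F" "y \<in> F" for x y
      using insert.prems(1) that by simp
    show "le x z" if "x \<in> F" "y \<in> F" "z \<in> F" "le x y" "le y z" for x y z
      using insert.prems(2)[of x y z] that by simp
  qed
  then obtain m where m: "m \<in> F" "\<forall>y\<in>F. le m y" by blast
  have "le x x" using insert.prems(1) by blast
  show ?case
  proof (cases "le x m")
    case True
    then have "le x y" if "y \<in> F" for y
      using m that insert.prems(2)[of x m y] by blast
    then show ?thesis using \<open>le x x\<close> by blast
  next
    case False
    then have "le m x" using insert.prems(1) m by blast
    then show ?thesis using m by blast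
  qed
qed

context linearly_generated
begin

lemma ind_scalar_one:
  assumes "P \<in> ind" "c \<in> hom P P" "\<phi> \<in> hom P Q" "\<phi> \<noteq> 0" "cmp P P Q \<phi> c = \<phi>"
  shows "c = idm P"
proof -
  obtain r where r: "c = mscale T r (idm P)" using ind_endo assms by blast
  then have "mscale T r \<phi> = mscale T 1 \<phi>" using assms by (simp add: comp_linear)
  then have "r = 1" using assms(4) by (simp del: V.scale_one)
  then show ?thesis using r by simp
qed

lemma ind_scalar_one':
  assumes "P \<in> ind" "c \<in> hom P P" "\<phi> \<in> hom Q P" "\<phi> \<noteq> 0" "cmp Q P P c \<phi> = \<phi>"
  shows "c = idm P"
proof -
  obtain r where r: "c = mscale T r (idm P)" using ind_endo assms by blast
  then have "mscale T r \<phi> = mscale T 1 \<phi>" using assms by (simp add: comp_linear)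
  then have "r = 1" using assms(4) by (simp del: V.scale_one)
  then show ?thesis using r by simp
qed

text \<open>
  The column of the pivot is a least one among the source summands on which \<open>f\<close> does not vanish, its
  row a greatest one among the rows in which that column is nonzero. All nonzero entries \<open>X m \<rightarrow> Y s\<close> in
  its row then factor through \<open>X l\<close>, and all nonzero entries \<open>X l \<rightarrow> Y t\<close> in its column factor through
  \<open>Y s\<close>. The maps \<open>a\<close> and \<open>b\<close> collect the factors. Together with \<open>i l\<close> and \<open>q\<close> they split off
  \<open>X l\<close> and \<open>R = Y s\<close>, compatibly with \<open>f\<close>.
\<close>

lemma pivot:
  assumes res: "resolution L N X i p" and M: "M \<in> addG" and f: "f \<in> hom N M" "f \<noteq> 0"
  obtains l R a b q \<phi> where "l \<in> L" "R \<in> ind" "a \<in> hom N (X l)" "b \<in> hom R M" "q \<in> hom M R"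
    "\<phi> \<in> hom (X l) R" "\<phi> \<noteq> 0" "cmp (X l) N (X l) a (i l) = idm (X l)" "cmp R M R q b = idm R"
    "cmp (X l) N M f (i l) = cmp (X l) R M b \<phi>" "cmp N M R q f = cmp N (X l) R \<phi> a"
proof -
  note rd = resolutionD[OF res]
  obtain K Y j q where res': "resolution K M Y j q" using M by (rule ex_resolution)
  note rd' = resolutionD[OF res']
  define A where "A = {l \<in> L. cmp (X l) N M f (i l) \<noteq> 0}"
  have "A \<noteq> {}"
  proof
    assume "A = {}"
    then have "(\<Sum>l\<in>L. cmp N (X l) M (cmp (X l) N M f (i l)) (p l)) = 0"
      using rd by (intro sum.neutral) (auto simp: A_def)
    then show False using resolution_sum_right[OF res f(1)] f(2) by metis
  qed
  have "\<exists>l\<in>A. \<forall>m\<in>A. lin_le T (X l) (X m)"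
  proof (rule finite_least)
    have A: "X l \<in> ind" if "l \<in> A" for l using that rd by (simp add: A_def)
    show "lin_le T (X l) (X m) \<or> lin_le T (X m) (X l)" if "l \<in> A" "m \<in> A" for l m
      using G1_total A that by simp
    show "lin_le T (X l) (X n)"
      if "l \<in> A" "m \<in> A" "n \<in> A" "lin_le T (X l) (X m)" "lin_le T (X m) (X n)" for l m n
      using G1_trans[of "X l" "X m" "X n"] A that by simp
  qed (use rd \<open>A \<noteq> {}\<close> in \<open>simp_all add: A_def\<close>)
  then obtain l where l: "l \<in> L" "cmp (X l) N M f (i l) \<noteq> 0"
    and l_min: "\<And>m. m \<in> L \<Longrightarrow> cmp (X m) N M f (i m) \<noteq> 0 \<Longrightarrow> lin_le T (X l) (X m)"
    by (auto simp: A_def)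
  define g where "g = cmp (X l) N M f (i l)"
  have g: "g \<in> hom (X l) M" "g \<noteq> 0" using l rd f by (simp_all add: g_def)
  define B where "B = {t \<in> K. cmp (X l) M (Y t) (q t) g \<noteq> 0}"
  have "B \<noteq> {}"
  proof
    assume "B = {}"
    then have "(\<Sum>t\<in>K. cmp (X l) (Y t) M (j t) (cmp (X l) M (Y t) (q t) g)) = 0"
      using rd' by (intro sum.neutral) (auto simp: B_def)
    then show False using resolution_sum_left[OF res' g(1)] g(2) by metis
  qed
  have "\<exists>s\<in>B. \<forall>t\<in>B. lin_le T (Y t) (Y s)"
  proof (rule finite_least[where le = "\<lambda>s t. lin_le T (Y t) (Y s)"])
    have B: "Y t \<in> ind" if "t \<in> B" for t using that rd' by (simp add: B_def)
    show "lin_le T (Y t) (Y s) \<or> lin_le T (Y s) (Y t)" if "s \<in> B" "t \<in> B" for s t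
      using G1_total B that by simp
    show "lin_le T (Y r) (Y s)"
      if "s \<in> B" "t \<in> B" "r \<in> B" "lin_le T (Y t) (Y s)" "lin_le T (Y r) (Y t)" for s t r
      using G1_trans[of "Y r" "Y t" "Y s"] B that by simp
  qed (use rd' \<open>B \<noteq> {}\<close> in \<open>simp_all add: B_def\<close>)
  then obtain s where s: "s \<in> K" "cmp (X l) M (Y s) (q s) g \<noteq> 0"
    and s_max: "\<And>t. t \<in> K \<Longrightarrow> cmp (X l) M (Y t) (q t) g \<noteq> 0 \<Longrightarrow> lin_le T (Y t) (Y s)"
    by (auto simp: B_def)
  define \<phi> where "\<phi> = cmp (X l) M (Y s) (q s) g"
  have \<phi>: "\<phi> \<in> hom (X l) (Y s)" "\<phi> \<noteq> 0" using g s rd' by (simp_all add: \<phi>_def)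
  note H = rd(3-5)[OF l(1)] rd'(3-5)[OF s(1)]
  have "\<exists>\<alpha>\<in>hom (X m) (X l). cmp (X m) M (Y s) (q s) (cmp (X m) N M f (i m)) = cmp (X m) (X l) (Y s) \<phi> \<alpha>"
    if m: "m \<in> L" for m
  proof (cases "cmp (X m) N M f (i m) = 0")
    case True
    then show ?thesis using \<phi> H by (intro bexI[of _ 0]) simp_all
  next
    case False
    then obtain e where e: "e \<in> hom (X m) (X l)" "e \<noteq> 0" using l_min[OF m] le_nonzero by blast
    have "cmp (X m) M (Y s) (q s) (cmp (X m) N M f (i m)) \<in> hom (X m) (Y s)"
      using rd m H f by simp
    from factor_scaled(1)[OF rd(3)[OF m] H(1,4) e \<phi> this] show ?thesis
      using e scale_Hom by blast
  qed
  then obtain \<alpha> where \<alpha>: "\<And>m. m \<in> L \<Longrightarrow> \<alpha> m \<in> hom (X m) (X l)"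
    "\<And>m. m \<in> L \<Longrightarrow> cmp (X m) M (Y s) (q s) (cmp (X m) N M f (i m)) = cmp (X m) (X l) (Y s) \<phi> (\<alpha> m)"
    by metis
  define a where "a = (\<Sum>m\<in>L. cmp N (X m) (X l) (\<alpha> m) (p m))"
  have a: "a \<in> hom N (X l)" unfolding a_def using \<alpha> rd by (intro sum_Hom) simp
  have qf: "cmp N M (Y s) (q s) f = cmp N (X l) (Y s) \<phi> a"
  proof -
    have "cmp N M (Y s) (q s) f
      = (\<Sum>m\<in>L. cmp N (X m) (Y s) (cmp (X m) N (Y s) (cmp N M (Y s) (q s) f) (i m)) (p m))"
      using res by (rule resolution_sum_right) (use H f in simp)
    also have "\<dots> = (\<Sum>m\<in>L. cmp N (X l) (Y s) \<phi> (cmp N (X m) (X l) (\<alpha> m) (p m)))"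
    proof (rule sum.cong[OF refl])
      fix m assume m: "m \<in> L"
      show "cmp N (X m) (Y s) (cmp (X m) N (Y s) (cmp N M (Y s) (q s) f) (i m)) (p m)
        = cmp N (X l) (Y s) \<phi> (cmp N (X m) (X l) (\<alpha> m) (p m))"
        using comp_eq_assoc[OF \<alpha>(2)[OF m], of "p m" N] rd(4,5)[OF m] \<alpha>(1)[OF m] f H \<phi> by simp
    qed
    also have "\<dots> = cmp N (X l) (Y s) \<phi> a"
      unfolding a_def using \<phi> \<alpha> rd by (intro comp_sum_right[symmetric]) simp_all
    finally show ?thesis .
  qed
  have "cmp (X l) (X l) (Y s) \<phi> (cmp (X l) N (X l) a (i l)) = cmp (X l) N (Y s) (cmp N M (Y s) (q s) f) (i l)"
    unfolding qf using \<phi> a H by simp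
  also have "\<dots> = \<phi>" unfolding \<phi>_def g_def using f H by simp
  finally have ai: "cmp (X l) N (X l) a (i l) = idm (X l)"
    using ind_scalar_one[OF H(1) _ \<phi>] a H by simp
  have "\<exists>\<beta>\<in>hom (Y s) (Y t). cmp (X l) M (Y t) (q t) g = cmp (X l) (Y s) (Y t) \<beta> \<phi>"
    if t: "t \<in> K" for t
  proof (cases "cmp (X l) M (Y t) (q t) g = 0")
    case True
    then show ?thesis using \<phi> H by (intro bexI[of _ 0]) simp_all
  next
    case False
    then obtain e where e: "e \<in> hom (Y s) (Y t)" "e \<noteq> 0" using s_max[OF t] le_nonzero by blast
    have "cmp (X l) M (Y t) (q t) g \<in> hom (X l) (Y t)"
      using rd' t g by simp
    from factor_scaled(2)[OF H(1,4) rd'(3)[OF t] \<phi> e this] show ?thesis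
      using e scale_Hom by blast
  qed
  then obtain \<beta> where \<beta>: "\<And>t. t \<in> K \<Longrightarrow> \<beta> t \<in> hom (Y s) (Y t)"
    "\<And>t. t \<in> K \<Longrightarrow> cmp (X l) M (Y t) (q t) g = cmp (X l) (Y s) (Y t) (\<beta> t) \<phi>"
    by metis
  define b where "b = (\<Sum>t\<in>K. cmp (Y s) (Y t) M (j t) (\<beta> t))"
  have b: "b \<in> hom (Y s) M" unfolding b_def using \<beta> rd' by (intro sum_Hom) simp
  have gb: "g = cmp (X l) (Y s) M b \<phi>"
  proof -
    have "g = (\<Sum>t\<in>K. cmp (X l) (Y t) M (j t) (cmp (X l) M (Y t) (q t) g))"
      using res' g(1) by (rule resolution_sum_left)
    also have "\<dots> = (\<Sum>t\<in>K. cmp (X l) (Y s) M (cmp (Y s) (Y t) M (j t) (\<beta> t)) \<phi>)"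
      using \<phi> \<beta> rd' by (intro sum.cong) simp_all
    also have "\<dots> = cmp (X l) (Y s) M b \<phi>"
      unfolding b_def using \<phi> \<beta> rd' by (intro comp_sum_left[symmetric]) simp_all
    finally show ?thesis .
  qed
  have "cmp (X l) (Y s) (Y s) (cmp (Y s) M (Y s) (q s) b) \<phi> = \<phi>"
    using arg_cong[OF gb, of "cmp (X l) M (Y s) (q s)"] b \<phi>(1) H unfolding \<phi>_def[symmetric] by simp
  then have "cmp (Y s) M (Y s) (q s) b = idm (Y s)"
    using ind_scalar_one'[OF H(4) _ \<phi>] b H by simp
  then show thesis
    using that[OF l(1) H(4) a b H(6) \<phi> ai] gb qf unfolding g_def by blast
qed

text \<open>
  A complement of the \<open>l\<close>-th summand has a resolution with one term less, because \<open>q\<close> kills the term of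
  index \<open>l\<close>. This makes the number of terms a measure for inductions that split off pivots.
\<close>

lemma resolution_complement:
  assumes res: "resolution L N X i p" and l: "l \<in> L"
    and c: "j \<in> hom C N" "q \<in> hom N C" "cmp C N C q j = idm C" "cmp (X l) N C q (i l) = 0"
  shows "resolution (L - {l}) C X (\<lambda>m. cmp (X m) N C q (i m)) (\<lambda>m. cmp C N (X m) (p m) j)"
proof -
  note rd = resolutionD[OF res]
  have "idm C = cmp C N C q (\<Sum>m\<in>L. cmp C (X m) N (i m) (cmp C N (X m) (p m) j))"
    using resolution_sum_left[OF res c(1)] c(3) by simp
  also have "\<dots> = (\<Sum>m\<in>L. cmp C (X m) C (cmp (X m) N C q (i m)) (cmp C N (X m) (p m) j))"
    using rd c by (subst comp_sum_right) simp_all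
  also have "\<dots> = (\<Sum>m\<in>L - {l}. cmp C (X m) C (cmp (X m) N C q (i m)) (cmp C N (X m) (p m) j))"
    using rd c l by (subst sum.remove[of L l]) simp_all
  finally show ?thesis unfolding resolution_def using rd c by simp
qed

text \<open>
  The source of a map \<open>f\<close> between objects of \<open>addG\<close> decomposes into a part \<open>Z\<close> on which \<open>f\<close> vanishes and
  a part \<open>N'\<close>, the sum of the sources of all pivots, on which \<open>f\<close> is injective as far as maps from
  indecomposables are concerned.
\<close>

lemma kernel_split:
  assumes "resolution L N X i p" "N \<in> addG" "M \<in> addG" "f \<in> hom N M"
  shows "\<exists>N'\<in>addG. \<exists>Z\<in>addG. \<exists>u\<in>hom N' N. \<exists>z\<in>hom Z N. \<exists>v\<in>hom N N'. \<exists>w\<in>hom N Z.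
    cmp Z N M f z = 0 \<and> cmp N N' N u v + cmp N Z N z w = idm N \<and>
    (\<forall>P\<in>ind. \<forall>x\<in>hom P N'. cmp P N' M (cmp N' N M f u) x = 0 \<longrightarrow> x = 0)"
  using assms
proof (induction "card L" arbitrary: L N i p f)
  case less: 0
  have "f = 0"
    using resolution_sum_right[OF less(2,5)] less(1) resolutionD(1)[OF less(2)] by simp
  obtain U where U: "zero_obj T U" using ex_zero_obj by blast
  then have "U \<in> addG" using closed_zero closed_addG by blast
  then show ?case using less \<open>f = 0\<close> U
    by (intro bexI[of _ U] bexI[of _ N] bexI[of _ 0] bexI[of _ "idm N"]) (auto simp: zero_obj_def)
next
  case (Suc n)
  show ?case
  proof (cases "f = 0")
    case True
    obtain U where U: "zero_obj T U" using ex_zero_obj by blast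
    then have "U \<in> addG" using closed_zero closed_addG by blast
    then show ?thesis using Suc True U
      by (intro bexI[of _ U] bexI[of _ N] bexI[of _ 0] bexI[of _ "idm N"]) (auto simp: zero_obj_def)
  next
    case False
    obtain l R a b q \<phi> where l: "l \<in> L" "R \<in> ind" "a \<in> hom N (X l)" "b \<in> hom R M" "q \<in> hom M R"
      "\<phi> \<in> hom (X l) R" "\<phi> \<noteq> 0" "cmp (X l) N (X l) a (i l) = idm (X l)" "cmp R M R q b = idm R"
      "cmp (X l) N M f (i l) = cmp (X l) R M b \<phi>" "cmp N M R q f = cmp N (X l) R \<phi> a"
      using pivot[OF Suc(3,5,6) False] .
    note rd = resolutionD[OF Suc(3)]
    note il = rd(4)[OF l(1)]
    obtain N1 j e where c: "j \<in> hom N1 N" "e \<in> hom N N1" "cmp N1 N N1 e j = idm N1"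
      "cmp N1 N (X l) a j = 0" "cmp (X l) N N1 e (i l) = 0"
      "cmp N (X l) N (i l) a + cmp N N1 N j e = idm N"
      using retract_complement[OF il l(3,8)] by metis
    have "biproduct T N1 (X l) N"
      using c il l by (intro biproductI[of j _ _ "i l" _ e a]) (simp_all add: add.commute)
    then have N1: "N1 \<in> addG" using closed_summand[OF closed_addG Suc(4)] by blast
    have n: "n = card (L - {l})" using Suc(2) l(1) rd(1) by simp
    have "\<exists>N'\<in>addG. \<exists>Z\<in>addG. \<exists>u\<in>hom N' N1. \<exists>z\<in>hom Z N1. \<exists>v\<in>hom N1 N'. \<exists>w\<in>hom N1 Z.
        cmp Z N1 M (cmp N1 N M f j) z = 0 \<and> cmp N1 N' N1 u v + cmp N1 Z N1 z w = idm N1 \<and>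
        (\<forall>P\<in>ind. \<forall>x\<in>hom P N'. cmp P N' M (cmp N' N1 M (cmp N1 N M f j) u) x = 0 \<longrightarrow> x = 0)"
      by (rule Suc(1)[OF _ resolution_complement[OF Suc(3) l(1) c(1,2,3,5)] N1 Suc(5)])
        (use n Suc(6) c(1) in simp_all)
    then obtain N' Z u z v w where h: "N' \<in> addG" "Z \<in> addG" "u \<in> hom N' N1" "z \<in> hom Z N1"
      "v \<in> hom N1 N'" "w \<in> hom N1 Z" "cmp Z N1 M (cmp N1 N M f j) z = 0"
      "cmp N1 N' N1 u v + cmp N1 Z N1 z w = idm N1"
      "\<And>P x. P \<in> ind \<Longrightarrow> x \<in> hom P N' \<Longrightarrow> cmp P N' M (cmp N' N1 M (cmp N1 N M f j) u) x = 0 \<Longrightarrow> x = 0"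
      by blast
    obtain S where S: "biproduct T (X l) N' S" using ex_biproduct by blast
    then obtain i1 i2 p1 p2 where s: "i1 \<in> hom (X l) S" "i2 \<in> hom N' S" "p1 \<in> hom S (X l)" "p2 \<in> hom S N'"
      "cmp (X l) S (X l) p1 i1 = idm (X l)" "cmp N' S N' p2 i2 = idm N'" "cmp N' S (X l) p1 i2 = 0"
      "cmp (X l) S N' p2 i1 = 0" "cmp S (X l) S i1 p1 + cmp S N' S i2 p2 = idm S"
      by (rule biproductE)
    note ss = comp_eq_assoc[OF s(5)] comp_eq_assoc[OF s(6)] comp_eq_assoc[OF s(7)] comp_eq_assoc[OF s(8)]
    have Xl: "X l \<in> ind" using rd l by blast
    have SG: "S \<in> addG" using closed_biproduct[OF closed_addG ind_addG[OF Xl] h(1) S] .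
    \<comment> \<open>the injective part of \<open>f\<close> is the pivot together with the injective part of \<open>f\<close> on \<open>N1\<close>\<close>
    define u' where "u' = cmp S (X l) N (i l) p1 + cmp S N1 N j (cmp S N' N1 u p2)"
    define v' where "v' = cmp N (X l) S i1 a + cmp N N' S i2 (cmp N N1 N' v e)"
    define z' where "z' = cmp Z N1 N j z"
    define w' where "w' = cmp N N1 Z w e"
    have H: "u' \<in> hom S N" "v' \<in> hom N S" "z' \<in> hom Z N" "w' \<in> hom N Z"
      unfolding u'_def v'_def z'_def w'_def using s h c l il by simp_all
    have "cmp N S N u' v' + cmp N Z N z' w'
      = cmp N (X l) N (i l) a + cmp N N1 N j (cmp N N1 N1 (cmp N1 N' N1 u v + cmp N1 Z N1 z w) e)"
      unfolding u'_def v'_def z'_def w'_def using s h(3-6) c l il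
      by (simp add: comp_linear ss add.assoc)
    also have "\<dots> = idm N" unfolding h(8) using c by simp
    finally have id: "cmp N S N u' v' + cmp N Z N z' w' = idm N" .
    have fz: "cmp Z N M f z' = 0" unfolding z'_def using h c Suc(6) by simp
    have mono: "x = 0" if P: "P \<in> ind" and x: "x \<in> hom P S" and 0: "cmp P S M (cmp S N M f u') x = 0" for P x
    proof -
      define x1 where "x1 = cmp P S (X l) p1 x"
      define x2 where "x2 = cmp P S N' p2 x"
      have xH: "x1 \<in> hom P (X l)" "x2 \<in> hom P N'" unfolding x1_def x2_def using s x by simp_all
      have split: "cmp P S M (cmp S N M f u') x = cmp P (X l) M (cmp (X l) N M f (i l)) x1
          + cmp P N' M (cmp N' N1 M (cmp N1 N M f j) u) x2"
        unfolding u'_def x1_def x2_def using s h(3) c il x Suc(6) by (simp add: comp_linear)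
      have "cmp P N M f (cmp P (X l) N (i l) x1) = cmp P R M b (cmp P (X l) R \<phi> x1)"
        using comp_eq_assoc[OF l(10)] il Suc(6) xH l by simp
      moreover have "cmp P M R q (cmp P N' M (cmp N' N1 M (cmp N1 N M f j) u) x2) = 0"
        using comp_eq_assoc[OF l(11)] comp_eq_assoc[OF c(4)] h(3) c Suc(6) xH l by simp
      ultimately have "cmp P M R q (cmp P S M (cmp S N M f u') x) = cmp P (X l) R \<phi> x1"
        unfolding split using comp_eq_assoc[OF l(9)] xH il h(3) c l Suc(6) by (simp add: comp_linear)
      then have "cmp P (X l) R \<phi> x1 = 0" unfolding 0 using l by simp
      then have x1: "x1 = 0" using comp_nonzero[OF P Xl l(2) xH(1) _ l(6,7)] by blast
      then have "x2 = 0" using split 0 h(9)[OF P xH(2)] il Suc(6) by simp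
      have "x = cmp P S S (cmp S (X l) S i1 p1 + cmp S N' S i2 p2) x" unfolding s(9) using x by simp
      also have "\<dots> = cmp P (X l) S i1 x1 + cmp P N' S i2 x2"
        unfolding x1_def x2_def using s(1-4) x by (simp add: comp_linear)
      finally show "x = 0" using x1 \<open>x2 = 0\<close> s by simp
    qed
    show ?thesis
      using SG h(2) H id fz mono by blast
  qed
qed

end

context klinear_triangulated_category
begin

lemma tri_morphism_middle:
  assumes t: "tri T X Y Z f g h" and t': "tri T X' Y' Z' f' g' h'"
    and a: "a \<in> hom X X'" and c: "c \<in> hom Z Z'"
    and comm: "cmp Z (sh X) (sh X') (ms X X' a) h = cmp Z Z' (sh X') h' c"
  obtains b where "b \<in> hom Y Y'" "cmp X Y Y' b f = cmp X X' Y' f' a" "cmp Y Z Z' c g = cmp Y Y' Z' g' b"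
proof -
  note H = tri_homs[OF t] tri_homs[OF t']
  obtain b' where b': "b' \<in> hom (sh Y) (sh Y')"
    "cmp (sh X) (sh Y) (sh Y') b' (- ms X Y f) = cmp (sh X) (sh X') (sh Y') (- ms X' Y' f') (ms X X' a)"
    "cmp (sh Y) (sh Z) (sh Z') (ms Z Z' c) (- ms Y Z g) = cmp (sh Y) (sh Y') (sh Z') (- ms Y' Z' g') b'"
    using tri_morphism[OF tri_rot[OF tri_rot[OF t]] tri_rot[OF tri_rot[OF t']] c ms_Hom[OF a]] comm
    by auto
  obtain b where b: "b \<in> hom Y Y'" "b' = ms Y Y' b" using b'(1) by (rule ms_full)
  have "ms X Y' (cmp X Y Y' b f) = ms X Y' (cmp X X' Y' f' a)"
    "ms Y Z' (cmp Y Z Z' c g) = ms Y Z' (cmp Y Y' Z' g' b)"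
    using b'(2,3) b H a c by simp_all
  then have "cmp X Y Y' b f = cmp X X' Y' f' a" "cmp Y Z Z' c g = cmp Y Y' Z' g' b"
    using ms_eq_iff b H a c by simp_all
  with b(1) show thesis by (rule that)
qed

lemma tri_shift:
  assumes "tri T X Y Z f g h"
  shows "tri T (sh X) (sh Y) (sh Z) (- ms X Y f) (- ms Y Z g) (- ms Z (sh X) h)"
  using assms tri_shift_iff[OF tri_homs[OF assms]] by blast

lemma tri_unshift:
  assumes "tri T (sh X) (sh Y) (sh Z) f g h"
  obtains f' g' h' where "tri T X Y Z f' g' h'" "f = - ms X Y f'" "g = - ms Y Z g'" "h = - ms Z (sh X) h'"
proof -
  note H = tri_homs[OF assms]
  obtain f' where f': "f' \<in> hom X Y" "- f = ms X Y f'" using ms_full uminus_Hom[OF H(1)] by metis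
  obtain g' where g': "g' \<in> hom Y Z" "- g = ms Y Z g'" using ms_full uminus_Hom[OF H(2)] by metis
  obtain h' where h': "h' \<in> hom Z (sh X)" "- h = ms Z (sh X) h'" using ms_full uminus_Hom[OF H(3)] by metis
  have *: "f = - ms X Y f'" "g = - ms Y Z g'" "h = - ms Z (sh X) h'"
    using f' g' h' by (metis minus_minus)+
  then have "tri T X Y Z f' g' h'"
    using assms tri_shift_iff[OF f'(1) g'(1) h'(1)] by simp
  then show thesis using * by (rule that)
qed

lemma tri_transport:
  assumes t: "tri T X Y Z f g h"
    and a: "a \<in> hom X X'" "a' \<in> hom X' X" "cmp X X' X a' a = idm X" "cmp X' X X' a a' = idm X'"
    and b: "b \<in> hom Y Y'" "b' \<in> hom Y' Y" "cmp Y Y' Y b' b = idm Y" "cmp Y' Y Y' b b' = idm Y'"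
    and c: "c \<in> hom Z Z'" "c' \<in> hom Z' Z" "cmp Z Z' Z c' c = idm Z" "cmp Z' Z Z' c c' = idm Z'"
  shows "tri T X' Y' Z' (cmp X' Y Y' b (cmp X' X Y f a')) (cmp Y' Z Z' c (cmp Y' Y Z g b'))
    (cmp Z' (sh X) (sh X') (ms X X' a) (cmp Z' Z (sh X) h c'))"
proof (rule tri_iso[OF t, where a = a and b = b and c = c])
  note H = tri_homs[OF t]
  show "iso_map T X X' a" "iso_map T Y Y' b" "iso_map T Z Z' c"
    using a b c by (auto intro: iso_mapI)
qed (use tri_homs[OF t] a b c in simp_all)

text \<open>
  Every triangle is, up to isomorphism and signs, the suspension of a triangle. The isomorphisms at the
  second and third objects are recorded, so that maps from and to these objects can be carried along.
\<close>

lemma desuspend: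
  assumes t: "tri T A B C f g h"
  obtains A' B' C' f' g' h' b b' c c' where
    "tri T A' B' C' f' g' h'" "isomorphic T (sh A') A" "isomorphic T (sh B') B"
    "b \<in> hom B (sh B')" "b' \<in> hom (sh B') B" "cmp B (sh B') B b' b = idm B"
    "c \<in> hom C (sh C')" "c' \<in> hom (sh C') C" "cmp C (sh C') C c' c = idm C"
    "f \<noteq> 0 \<longrightarrow> f' \<noteq> 0" "cmp (sh B') C (sh C') c (cmp (sh B') B C g b') = - ms B' C' g'"
proof -
  note H = tri_homs[OF t]
  obtain A' B' C' where ABC: "isomorphic T (sh A') A" "isomorphic T (sh B') B" "isomorphic T (sh C') C"
    using unshift by metis
  obtain a a' where a: "a \<in> hom A (sh A')" "a' \<in> hom (sh A') A"
    "cmp A (sh A') A a' a = idm A" "cmp (sh A') A (sh A') a a' = idm (sh A')"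
    using isomorphic_sym[OF ABC(1)] by (rule isomorphicE)
  obtain b b' where b: "b \<in> hom B (sh B')" "b' \<in> hom (sh B') B"
    "cmp B (sh B') B b' b = idm B" "cmp (sh B') B (sh B') b b' = idm (sh B')"
    using isomorphic_sym[OF ABC(2)] by (rule isomorphicE)
  obtain c c' where c: "c \<in> hom C (sh C')" "c' \<in> hom (sh C') C"
    "cmp C (sh C') C c' c = idm C" "cmp (sh C') C (sh C') c c' = idm (sh C')"
    using isomorphic_sym[OF ABC(3)] by (rule isomorphicE)
  obtain f' g' h' where t': "tri T A' B' C' f' g' h'"
    "cmp (sh A') B (sh B') b (cmp (sh A') A B f a') = - ms A' B' f'"
    "cmp (sh B') C (sh C') c (cmp (sh B') B C g b') = - ms B' C' g'"
    using tri_unshift[OF tri_transport[OF t a b c]] by metis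
  have "f' \<noteq> 0" if "f \<noteq> 0"
  proof
    assume "f' = 0"
    then have "cmp (sh A') B (sh B') b (cmp (sh A') A B f a') = 0" using t'(2) by simp
    then have "cmp A (sh B') B b' (cmp A (sh A') (sh B') (cmp (sh A') B (sh B') b (cmp (sh A') A B f a')) a) = 0"
      using a b by simp
    then show False using that a b H comp_eq_assoc[OF b(3)] by simp
  qed
  then show thesis using that[OF t'(1) ABC(1,2) b(1-3) c(1-3) _ t'(3)] by blast
qed

text \<open>
  Pushing a triangle \<open>X \<rightarrow> A \<rightarrow> C\<close> forward along a split monomorphism \<open>i : X \<rightarrow> X'\<close> gives a triangle
  \<open>X' \<rightarrow> A' \<rightarrow> C\<close> of which \<open>A\<close> is a retract.
\<close>

lemma middle_retract:
  assumes t: "tri T X A C u v w" and i: "i \<in> hom X X'" "p \<in> hom X' X" "cmp X X' X p i = idm X"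
  obtains A' u' v' w' d c where "tri T X' A' C u' v' w'" "d \<in> hom A A'" "c \<in> hom A' A"
    "iso_map T A A (cmp A A' A c d)"
proof -
  note H = tri_homs[OF t]
  define w' where "w' = cmp C (sh X) (sh X') (ms X X' i) w"
  have "w' \<in> hom C (sh X')" using H i by (simp add: w'_def)
  then obtain A' u' v' where t': "tri T X' A' C u' v' w'" by (rule complete_to_first)
  note H' = tri_homs[OF t']
  obtain d where d: "d \<in> hom A A'" "cmp X A A' d u = cmp X X' A' u' i" "cmp A C C (idm C) v = cmp A A' C v' d"
    using tri_morphism_middle[OF t t' i(1) mid_Hom] w'_def H' by auto
  have "cmp (sh X) (sh X') (sh X) (ms X' X p) (ms X X' i) = idm (sh X)" using i by simp
  then have "cmp C (sh X') (sh X) (ms X' X p) w' = cmp C C (sh X) w (idm C)"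
    using i H comp_eq_assoc[of "sh X" "sh X'" "sh X" "ms X' X p" "ms X X' i" "idm (sh X)" w C]
    by (simp add: w'_def)
  then obtain c where c: "c \<in> hom A' A" "cmp X' A' A c u' = cmp X' X A u p" "cmp A' C C (idm C) v' = cmp A' A C v c"
    using tri_morphism_middle[OF t' t i(2) mid_Hom] by auto
  have "iso_map T A A (cmp A A' A c d)"
  proof (rule tri_second_endo_iso[OF t])
    show "cmp X A A (cmp A A' A c d) u = u"
      using d c i H H' comp_eq_assoc[OF c(2)] by simp
    show "cmp A A C v (cmp A A' A c d) = v"
      using d c i H H' comp_eq_assoc[OF c(3)[symmetric]] by simp
  qed (use d c in simp)
  then show thesis using that t' d c by blast
qed

end

context linearly_generated
begin

section \<open>Covers by sums of indecomposables\<close>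

lemma unshift_addG:
  assumes "X \<in> addG"
  obtains X' a b where "X' \<in> addG" "a \<in> hom (sh X') X" "b \<in> hom X (sh X')"
    "cmp X (sh X') X a b = idm X" "cmp (sh X') X (sh X') b a = idm (sh X')"
proof -
  obtain X' where X': "isomorphic T (sh X') X" by (rule unshift)
  then have "X' \<in> addG"
    using assms closed_iso[OF closed_addG] closed_shift[OF closed_addG] isomorphic_sym by blast
  then show thesis using that X' by (metis isomorphicE)
qed

text \<open>
  \<open>B\<close> is covered if the functor \<open>Hom(-, B)\<close> on \<open>addG\<close> is finitely generated.
\<close>

definition covered :: "'o \<Rightarrow> bool" where
  "covered B \<longleftrightarrow> (\<exists>N\<in>addG. \<exists>n\<in>hom N B. \<forall>X\<in>addG. \<forall>x\<in>hom X B. \<exists>y\<in>hom X N. x = cmp X N B n y)"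

lemma coveredE:
  assumes "covered B"
  obtains N n where "N \<in> addG" "n \<in> hom N B"
    "\<And>X x. X \<in> addG \<Longrightarrow> x \<in> hom X B \<Longrightarrow> \<exists>y\<in>hom X N. x = cmp X N B n y"
  using assms unfolding covered_def by metis

lemma coveredI:
  assumes "N \<in> addG" "n \<in> hom N B"
    "\<And>X x. X \<in> addG \<Longrightarrow> x \<in> hom X B \<Longrightarrow> \<exists>y\<in>hom X N. x = cmp X N B n y"
  shows "covered B"
  unfolding covered_def using assms by metis

lemma covered_retract:
  assumes "covered B" "d \<in> hom A B" "c \<in> hom B A" "iso_map T A A (cmp A B A c d)"
  shows "covered A"
proof -
  obtain N n where N: "N \<in> addG" "n \<in> hom N B"
    "\<And>X x. X \<in> addG \<Longrightarrow> x \<in> hom X B \<Longrightarrow> \<exists>y\<in>hom X N. x = cmp X N B n y"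
    using assms(1) by (rule coveredE) blast
  obtain e where e: "e \<in> hom A A" "cmp A A A (cmp A B A c d) e = idm A"
    using assms(4) by (rule iso_mapE)
  show ?thesis
  proof (rule coveredI[of N "cmp N B A c n"])
    fix X x assume X: "X \<in> addG" "x \<in> hom X A"
    then obtain y where y: "y \<in> hom X N" "cmp X A B d (cmp X A A e x) = cmp X N B n y"
      using N(3)[of X "cmp X A B d (cmp X A A e x)"] assms e by auto
    have "x = cmp X A A (cmp A A A (cmp A B A c d) e) x" unfolding e(2) using X by simp
    also have "\<dots> = cmp X B A c (cmp X A B d (cmp X A A e x))" using assms e(1) X by simp
    finally show "\<exists>y\<in>hom X N. x = cmp X N A (cmp N B A c n) y"
      unfolding y(2) using y(1) N assms by auto
  qed (use N assms in simp_all)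
qed

lemma covered_iso: "isomorphic T A B \<Longrightarrow> covered B \<Longrightarrow> covered A"
  by (metis isomorphicE covered_retract iso_map_id)

lemma covered_shift: "covered (sh B) \<longleftrightarrow> covered B"
proof
  assume B: "covered B"
  obtain N n where N: "N \<in> addG" "n \<in> hom N B"
    "\<And>X x. X \<in> addG \<Longrightarrow> x \<in> hom X B \<Longrightarrow> \<exists>y\<in>hom X N. x = cmp X N B n y"
    using B by (rule coveredE) blast
  show "covered (sh B)"
  proof (rule coveredI[of "sh N" "ms N B n"])
    fix X x assume X: "X \<in> addG" "x \<in> hom X (sh B)"
    obtain X' a b where X': "X' \<in> addG" "a \<in> hom (sh X') X" "b \<in> hom X (sh X')"
      "cmp X (sh X') X a b = idm X" using X(1) by (rule unshift_addG)
    obtain x' where x': "x' \<in> hom X' B" "cmp (sh X') X (sh B) x a = ms X' B x'"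
      using ms_full[of "cmp (sh X') X (sh B) x a" X' B] X X' by auto
    obtain y where y: "y \<in> hom X' N" "x' = cmp X' N B n y" using N(3) X'(1) x'(1) by blast
    have "x = cmp X (sh X') (sh B) (cmp (sh X') X (sh B) x a) b" using X X' by simp
    also have "\<dots> = cmp X (sh N) (sh B) (ms N B n) (cmp X (sh X') (sh N) (ms X' N y) b)"
      unfolding x'(2) y(2) using y N X' by (simp add: mshift_mcomp del: ms_comp)
    finally show "\<exists>y\<in>hom X (sh N). x = cmp X (sh N) (sh B) (ms N B n) y"
      by (rule bexI) (use y X' in simp)
  qed (use N closed_shift[OF closed_addG] in simp_all)
next
  assume B: "covered (sh B)"
  obtain N n where N: "N \<in> addG" "n \<in> hom N (sh B)"
    "\<And>X x. X \<in> addG \<Longrightarrow> x \<in> hom X (sh B) \<Longrightarrow> \<exists>y\<in>hom X N. x = cmp X N (sh B) n y"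
    using B by (rule coveredE) blast
  obtain N' a b where N': "N' \<in> addG" "a \<in> hom (sh N') N" "b \<in> hom N (sh N')"
      "cmp N (sh N') N a b = idm N" using N(1) by (rule unshift_addG)
  obtain n' where n': "n' \<in> hom N' B" "cmp (sh N') N (sh B) n a = ms N' B n'"
    using ms_full[of "cmp (sh N') N (sh B) n a" N' B] N N' by auto
  show "covered B"
  proof (rule coveredI[OF N'(1) n'(1)])
    fix X x assume X: "X \<in> addG" "x \<in> hom X B"
    then have "sh X \<in> addG" using closed_shift[OF closed_addG] by blast
    then obtain y where y: "y \<in> hom (sh X) N" "ms X B x = cmp (sh X) N (sh B) n y"
      using N(3) X ms_Hom by blast
    obtain y' where y': "y' \<in> hom X N'" "cmp (sh X) N (sh N') b y = ms X N' y'"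
      using ms_full[of "cmp (sh X) N (sh N') b y" X N'] y N' by auto
    have "ms X B x = cmp (sh X) (sh N') (sh B) (cmp (sh N') N (sh B) n a) (cmp (sh X) N (sh N') b y)"
      unfolding y(2) using N N' y by (simp add: comp_eq_assoc[OF N'(4)])
    then have "ms X B x = ms X B (cmp X N' B n' y')"
      unfolding n'(2) y'(2) using n' y' by simp
    then show "\<exists>y\<in>hom X N'. x = cmp X N' B n' y" using y' n' X ms_eq_iff[of x X B "cmp X N' B n' y'"] by auto
  qed
qed

text \<open>Injectivity on maps from indecomposables extends to maps from objects of \<open>addG\<close>.\<close>

lemma addG_mono:
  assumes f: "f \<in> hom A B" and mono: "\<And>P x. P \<in> ind \<Longrightarrow> x \<in> hom P A \<Longrightarrow> cmp P A B f x = 0 \<Longrightarrow> x = 0"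
    and X: "X \<in> addG" "x \<in> hom X A" "cmp X A B f x = 0"
  shows "x = 0"
proof -
  obtain L Y i p where res: "resolution L X Y i p" using X(1) by (rule ex_resolution)
  note rd = resolutionD[OF res]
  have "cmp (Y l) X A x (i l) = 0" if l: "l \<in> L" for l
  proof (rule mono)
    show "cmp (Y l) A B f (cmp (Y l) X A x (i l)) = 0"
      using comp_eq_assoc[OF X(3)] rd l X f by simp
  qed (use rd l X in simp_all)
  then have "(\<Sum>l\<in>L. cmp X (Y l) A (cmp (Y l) X A x (i l)) (p l)) = 0"
    using rd by (intro sum.neutral) simp
  then show ?thesis using resolution_sum_right[OF res X(2)] by simp
qed

text \<open>
  In a triangle \<open>M \<rightarrow> A \<rightarrow> B\<close> with \<open>M\<close> in \<open>addG\<close>, a cover of \<open>B\<close> restricts to a cover of the kernel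
  of \<open>Hom(-, B) \<rightarrow> Hom(-, M[1])\<close>, because the connecting map splits as in \<open>kernel_split\<close>.
\<close>

lemma covered_extension:
  assumes M: "M \<in> addG" and t: "tri T M A B u v w" and B: "covered B"
  shows "covered A"
proof -
  note H = tri_homs[OF t]
  obtain N n where N: "N \<in> addG" "n \<in> hom N B"
    "\<And>X x. X \<in> addG \<Longrightarrow> x \<in> hom X B \<Longrightarrow> \<exists>y\<in>hom X N. x = cmp X N B n y"
    using B by (rule coveredE) blast
  define f where "f = cmp N B (sh M) w n"
  have f: "f \<in> hom N (sh M)" using N H by (simp add: f_def)
  have sM: "sh M \<in> addG" using M closed_shift[OF closed_addG] by blast
  obtain L X i p where res: "resolution L N X i p" using N(1) by (rule ex_resolution)
  obtain N' Z u' z v' w' where k: "N' \<in> addG" "Z \<in> addG" "u' \<in> hom N' N" "z \<in> hom Z N"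
    "v' \<in> hom N N'" "w' \<in> hom N Z" "cmp Z N (sh M) f z = 0" "cmp N N' N u' v' + cmp N Z N z w' = idm N"
    "\<And>P x. P \<in> ind \<Longrightarrow> x \<in> hom P N' \<Longrightarrow> cmp P N' (sh M) (cmp N' N (sh M) f u') x = 0 \<Longrightarrow> x = 0"
    using kernel_split[OF res N(1) sM f] by metis
  have "cmp Z B (sh M) w (cmp Z N B n z) = 0" using k(7) k(4) N H by (simp add: f_def)
  then obtain a where a: "a \<in> hom Z A" "cmp Z N B n z = cmp Z A B v a"
    using lift_through_g[OF t, of "cmp Z N B n z" Z] N k by auto
  obtain S where S: "biproduct T M Z S" using ex_biproduct by blast
  then obtain i1 i2 p1 p2 where s: "i1 \<in> hom M S" "i2 \<in> hom Z S" "p1 \<in> hom S M" "p2 \<in> hom S Z"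
    "cmp M S M p1 i1 = idm M" "cmp Z S Z p2 i2 = idm Z" "cmp Z S M p1 i2 = 0" "cmp M S Z p2 i1 = 0"
    by (rule biproductE)
  note ss = comp_eq_assoc[OF s(5)] comp_eq_assoc[OF s(6)] comp_eq_assoc[OF s(7)] comp_eq_assoc[OF s(8)]
  show "covered A"
  proof (rule coveredI[of S "cmp S M A u p1 + cmp S Z A a p2"])
    show "S \<in> addG" using closed_biproduct[OF closed_addG M k(2) S] .
    fix X x assume X: "X \<in> addG" "x \<in> hom X A"
    obtain y where y: "y \<in> hom X N" "cmp X A B v x = cmp X N B n y"
      using N(3)[OF X(1), of "cmp X A B v x"] X H by auto
    have "cmp X N (sh M) f y = cmp X B (sh M) w (cmp X N B n y)"
      using y N H by (simp add: f_def)
    also have "\<dots> = 0" using comp_eq_assoc[OF tri_hg[OF t]] X H by (simp flip: y(2))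
    finally have fy: "cmp X N (sh M) f y = 0" .
    have yy: "cmp X N' N u' (cmp X N N' v' y) + cmp X Z N z (cmp X N Z w' y) = y"
      using arg_cong[OF k(8), of "\<lambda>e. cmp X N N e y"] k(3-6) y by (simp add: comp_linear)
    have "cmp X N N' v' y = 0"
    proof (rule addG_mono[where f = "cmp N' N (sh M) f u'", OF _ _ X(1)])
      show "x = 0" if "P \<in> ind" "x \<in> hom P N'" "cmp P N' (sh M) (cmp N' N (sh M) f u') x = 0" for P x
        using k(9) that by blast
      show "cmp X N' (sh M) (cmp N' N (sh M) f u') (cmp X N N' v' y) = 0"
        using arg_cong[OF yy, of "cmp X N (sh M) f"] fy comp_eq_assoc[OF k(7)] k(3-6) y f
        by (simp add: comp_linear)
    qed (use k(3,5) y(1) f in simp_all)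
    then have y': "y = cmp X Z N z (cmp X N Z w' y)" using yy k(3) by simp
    define m where "m = cmp X N Z w' y"
    have m: "m \<in> hom X Z" using k y by (simp add: m_def)
    have "cmp X A B v x = cmp X Z B (cmp Z N B n z) m"
      unfolding y(2) using k N m y' by (simp add: m_def)
    then have "cmp X A B v (x - cmp X Z A a m) = 0"
      unfolding a(2) using a m X H by (simp add: comp_linear)
    then obtain l where l: "l \<in> hom X M" "x - cmp X Z A a m = cmp X M A u l"
      using lift_through_f[OF t, of "x - cmp X Z A a m" X] X a m by auto
    have "x = cmp X M A u l + cmp X Z A a m" using l(2) by (simp add: algebra_simps)
    also have "\<dots> = cmp X S A (cmp S M A u p1 + cmp S Z A a p2) (cmp X M S i1 l + cmp X Z S i2 m)"
      using s a m l(1) H by (simp add: comp_linear ss)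
    finally show "\<exists>y\<in>hom X S. x = cmp X S A (cmp S M A u p1 + cmp S Z A a p2) y"
      by (rule bexI) (use s l m in simp)
  qed (use s a H in simp)
qed

text \<open>
  Being covered is not shown to pass to cones directly. Instead the objects \<open>M\<close> for which extensions of
  covered objects by \<open>M\<close> are covered form a thick subcategory: extensions of such objects are handled by
  the octahedral axiom, direct summands by \<open>middle_retract\<close>.
\<close>

lemma all_covered: "covered A"
proof -
  define E where "E = {M. \<forall>A B u v w. tri T M A B u v w \<longrightarrow> covered B \<longrightarrow> covered A}"
  have addE: "addG \<subseteq> E" using covered_extension by (auto simp: E_def)
  have ED: "covered A" if "M \<in> E" "tri T M A B u v w" "covered B" for M A B u v w
    using that unfolding E_def by blast
  have shE: "sh M \<in> E \<longleftrightarrow> M \<in> E" for M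
  proof
    assume M: "M \<in> E"
    show "sh M \<in> E" unfolding E_def
    proof (intro CollectI allI impI)
      fix A B u v w assume t: "tri T (sh M) A B u v w" and B: "covered B"
      obtain A' B' where AB: "isomorphic T (sh A') A" "isomorphic T (sh B') B"
        using unshift by metis
      obtain b b' where b: "b \<in> hom A (sh A')" "b' \<in> hom (sh A') A"
        "cmp A (sh A') A b' b = idm A" "cmp (sh A') A (sh A') b b' = idm (sh A')"
        using isomorphic_sym[OF AB(1)] by (rule isomorphicE)
      obtain c c' where c: "c \<in> hom B (sh B')" "c' \<in> hom (sh B') B"
        "cmp B (sh B') B c' c = idm B" "cmp (sh B') B (sh B') c c' = idm (sh B')"
        using isomorphic_sym[OF AB(2)] by (rule isomorphicE)
      obtain u' v' w' where "tri T M A' B' u' v' w'"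
        using tri_unshift[OF tri_transport[OF t, of "idm (sh M)" "sh M" "idm (sh M)", OF _ _ _ _ b c]]
          mid_Hom mcomp_mid_left by metis
      moreover have "covered B'" using AB(2) B covered_iso covered_shift by blast
      ultimately have "covered A'" using M ED by blast
      then show "covered A" using AB(1) covered_iso covered_shift isomorphic_sym by blast
    qed
  next
    assume M: "sh M \<in> E"
    show "M \<in> E" unfolding E_def
      using ED[OF M tri_shift] covered_shift by blast
  qed
  have ext: "M \<in> E" if "M' \<in> E" "M'' \<in> E" and t': "tri T M' M M'' f g h" for M M' M'' f g h
    unfolding E_def
  proof (intro CollectI allI impI)
    fix A B u v w assume t: "tri T M A B u v w" and B: "covered B"
    have "cmp M' M A u f \<in> hom M' A" using tri_homs[OF t] tri_homs[OF t'] by simp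
    then obtain A'' m n where t'': "tri T M' A A'' (cmp M' M A u f) m n"
      using tri_complete by blast
    obtain a b c where "tri T M'' A'' B a b c"
      using tri_octahedral[OF t' t t''] by blast
    then have "covered A''" using ED that(2) B by blast
    then show "covered A" using ED[OF that(1) t''] by blast
  qed
  have "thick T E"
    unfolding thick_def
  proof (intro conjI allI impI)
    show "Z \<in> E" if "zero_obj T Z" for Z
      using addE closed_zero[OF closed_addG that] by blast
    show "sh X \<in> E \<longleftrightarrow> X \<in> E" for X by (rule shE)
    show "Z \<in> E" if "tri T X Y Z f g h" "X \<in> E" "Y \<in> E" for X Y Z f g h
      using ext[OF that(3) _ tri_rot[OF that(1)]] shE that by blast
    show "X \<in> E" if "B \<in> E" "biproduct T X Y B" for X Y B
      unfolding E_def
    proof (intro CollectI allI impI)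
      fix A C u v w assume t: "tri T X A C u v w" and C: "covered C"
      obtain i p where i: "i \<in> hom X B" "p \<in> hom B X" "cmp X B X p i = idm X"
        using \<open>biproduct T X Y B\<close> by (rule biproductE)
      obtain A' u' v' w' d c where A': "tri T B A' C u' v' w'" "d \<in> hom A A'" "c \<in> hom A' A"
        "iso_map T A A (cmp A A' A c d)" using middle_retract[OF t i] .
      have "covered A'" using ED[OF \<open>B \<in> E\<close> A'(1) C] .
      then show "covered A" using covered_retract A' by blast
    qed
  qed
  then have A: "A \<in> E" using thick_UNIV addE G_addG by blast
  obtain U where U: "zero_obj T U" using ex_zero_obj by blast
  have "U \<in> addG" using closed_zero[OF closed_addG U] .
  then have "covered U"
    by (rule coveredI[of U "idm U"]) auto
  then show ?thesis using ED[OF A tri_mid[OF U]] by blast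
qed

section \<open>Two-step presentations\<close>

text \<open>
  The objects that have only zero maps to all such \<open>E\<close> form a thick subcategory containing \<open>G\<close>, so that
  \<open>E\<close> is one of them.
\<close>

lemma orthogonal_zero:
  assumes "\<And>X x. X \<in> addG \<Longrightarrow> x \<in> hom X E \<Longrightarrow> x = 0"
  shows "zero_obj T E"
proof -
  define orth where "orth E \<longleftrightarrow> (\<forall>X\<in>addG. \<forall>x\<in>hom X E. x = 0)" for E
  define Z where "Z = {Y. \<forall>E. orth E \<longrightarrow> (\<forall>y\<in>hom Y E. y = 0)}"
  have orth_shift: "orth (sh E)" if "orth E" for E
    unfolding orth_def
  proof (intro ballI)
    fix X x assume X: "X \<in> addG" "x \<in> hom X (sh E)"
    obtain X' a b where X': "X' \<in> addG" "a \<in> hom (sh X') X" "b \<in> hom X (sh X')"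
      "cmp X (sh X') X a b = idm X" using X(1) by (rule unshift_addG)
    obtain x' where x': "x' \<in> hom X' E" "cmp (sh X') X (sh E) x a = ms X' E x'"
      using ms_full[of "cmp (sh X') X (sh E) x a" X' E] X X' by auto
    have "x = cmp X (sh X') (sh E) (cmp (sh X') X (sh E) x a) b" using X X' by simp
    also have "x' = 0" using that x' X'(1) by (simp add: orth_def)
    then have "cmp X (sh X') (sh E) (cmp (sh X') X (sh E) x a) b = 0" unfolding x'(2) using X' by simp
    finally show "x = 0" .
  qed
  have orth_unshift: "orth E" if "orth (sh E)" for E
    using that closed_shift[OF closed_addG] unfolding orth_def by (metis ms_Hom ms_eq_0_iff)
  have orth_iso: "orth E'" if E: "orth E" and iso: "isomorphic T E E'" for E E'
    unfolding orth_def
  proof (intro ballI)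
    fix X x assume X: "X \<in> addG" "x \<in> hom X E'"
    obtain f g where f: "f \<in> hom E E'" "g \<in> hom E' E" "cmp E' E E' f g = idm E'"
      using iso by (rule isomorphicE)
    have "cmp X E' E g x = 0" using X f E mcomp_Hom[of x X E' g E] unfolding orth_def by blast
    then show "x = 0" using comp_eq_assoc[OF f(3), of x X] f X by simp
  qed
  have ZD: "y = 0" if "Y \<in> Z" "orth E" "y \<in> hom Y E" for Y E y
    using that unfolding Z_def by blast
  have shZ: "sh Y \<in> Z \<longleftrightarrow> Y \<in> Z" for Y
  proof
    assume Y: "Y \<in> Z"
    show "sh Y \<in> Z" unfolding Z_def
    proof (intro CollectI allI impI ballI)
      fix E y assume E: "orth E" "y \<in> hom (sh Y) E"
      obtain E' where "isomorphic T (sh E') E" by (rule unshift)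
      then obtain f g where f: "f \<in> hom (sh E') E" "g \<in> hom E (sh E')" "cmp E (sh E') E f g = idm E"
        by (rule isomorphicE)
      have "orth E'" using orth_unshift orth_iso[OF E(1)] \<open>isomorphic T (sh E') E\<close> isomorphic_sym by blast
      obtain y' where y': "y' \<in> hom Y E'" "cmp (sh Y) E (sh E') g y = ms Y E' y'"
        using ms_full[of "cmp (sh Y) E (sh E') g y" Y E'] f E by auto
      then have "cmp (sh Y) E (sh E') g y = 0" using ZD[OF Y \<open>orth E'\<close> y'(1)] by simp
      then show "y = 0" using comp_eq_assoc[OF f(3), of y "sh Y"] f E by simp
    qed
  next
    assume Y: "sh Y \<in> Z"
    show "Y \<in> Z" unfolding Z_def
    proof (intro CollectI allI impI ballI)
      fix E y assume "orth E" "y \<in> hom Y E"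
      then show "y = 0" using ZD[OF Y orth_shift ms_Hom] by simp
    qed
  qed
  have "thick T Z"
    unfolding thick_def
  proof (intro conjI allI impI)
    show "Y \<in> Z" if "zero_obj T Y" for Y
      using that by (auto simp: Z_def zero_obj_def)
    show "sh X \<in> Z \<longleftrightarrow> X \<in> Z" for X by (rule shZ)
    show "W \<in> Z" if t: "tri T X Y W f g h" and XY: "X \<in> Z" "Y \<in> Z" for X Y W f g h
      unfolding Z_def
    proof (intro CollectI allI impI ballI)
      fix E y assume E: "orth E" "y \<in> hom W E"
      have "cmp Y W E y g = 0" using ZD[OF XY(2) E(1)] E tri_homs[OF t] by simp
      then obtain y' where "y' \<in> hom (sh X) E" "y = cmp W (sh X) E y' h"
        using extend_along_h[OF t E(2)] by blast
      then show "y = 0" using ZD[OF _ E(1)] shZ XY(1) tri_homs[OF t] by fastforce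
    qed
    show "X \<in> Z" if "B \<in> Z" "biproduct T X Y B" for X Y B
      unfolding Z_def
    proof (intro CollectI allI impI ballI)
      fix E y assume E: "orth E" "y \<in> hom X E"
      obtain i p where i: "i \<in> hom X B" "p \<in> hom B X" "cmp X B X p i = idm X"
        using \<open>biproduct T X Y B\<close> by (rule biproductE)
      have "cmp B X E y p = 0" using ZD[OF \<open>B \<in> Z\<close> E(1)] E i by simp
      then have "cmp X X E y (cmp X B X p i) = 0" using comp_eq_assoc[of B X E y p 0 i X] i E by simp
      then show "y = 0" using i E by simp
    qed
  qed
  moreover have "G \<in> Z" using G_addG by (auto simp: Z_def orth_def)
  ultimately have "E \<in> Z" using thick_UNIV by blast
  moreover have "orth E" using assms by (simp add: orth_def)
  ultimately have "idm E = 0" using ZD by simp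
  then show ?thesis by (simp add: zero_obj_iff)
qed

text \<open>
  Let \<open>n : N0 \<rightarrow> A\<close> be a cover with cocone \<open>\<kappa> : K \<rightarrow> N0\<close>, and \<open>k : N1 \<rightarrow> K\<close> a cover of \<open>K\<close>. As \<open>n\<close> is surjective
  on maps from \<open>addG\<close>, \<open>\<kappa>\<close> is injective on them. The summand of \<open>N1\<close> killed by \<open>\<kappa> k\<close> is therefore killed
  by \<open>k\<close>, and the complementary summand is isomorphic to \<open>K\<close>.
\<close>

theorem presentation:
  obtains N M f g h where "N \<in> addG" "M \<in> addG" "tri T N M A f g h"
proof -
  obtain N0 n where N0: "N0 \<in> addG" "n \<in> hom N0 A"
    "\<And>X x. X \<in> addG \<Longrightarrow> x \<in> hom X A \<Longrightarrow> \<exists>y\<in>hom X N0. x = cmp X N0 A n y"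
    using all_covered[of A] by (rule coveredE) blast
  obtain K \<kappa> w where t: "tri T K N0 A \<kappa> n w" using N0(2) by (rule complete_to_third)
  note H = tri_homs[OF t]
  have \<kappa>_mono: "x = 0" if X: "X \<in> addG" "x \<in> hom X K" "cmp X K N0 \<kappa> x = 0" for X x
  proof -
    have "cmp (sh X) (sh K) (sh N0) (ms K N0 \<kappa>) (ms X K x) = 0" using X H by simp
    then obtain y where y: "y \<in> hom (sh X) A" "ms X K x = cmp (sh X) A (sh K) w y"
      using lift_through_h[OF t ms_Hom[OF X(2)]] by blast
    have "sh X \<in> addG" using X(1) closed_shift[OF closed_addG] by blast
    then obtain y' where y': "y' \<in> hom (sh X) N0" "y = cmp (sh X) N0 A n y'" using N0(3) y(1) by blast
    have "ms X K x = 0" unfolding y(2) y'(2) using comp_eq_assoc[OF tri_hg[OF t]] H y' by simp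
    then show ?thesis using X by simp
  qed
  obtain N1 k where N1: "N1 \<in> addG" "k \<in> hom N1 K"
    "\<And>X x. X \<in> addG \<Longrightarrow> x \<in> hom X K \<Longrightarrow> \<exists>y\<in>hom X N1. x = cmp X N1 K k y"
    using all_covered[of K] by (rule coveredE) blast
  define f where "f = cmp N1 K N0 \<kappa> k"
  have f: "f \<in> hom N1 N0" using N1 H by (simp add: f_def)
  obtain L X i p where res: "resolution L N1 X i p" using N1(1) by (rule ex_resolution)
  obtain N Z u z v w' where s: "N \<in> addG" "Z \<in> addG" "u \<in> hom N N1" "z \<in> hom Z N1"
    "v \<in> hom N1 N" "w' \<in> hom N1 Z" "cmp Z N1 N0 f z = 0" "cmp N1 N N1 u v + cmp N1 Z N1 z w' = idm N1"
    "\<And>P x. P \<in> ind \<Longrightarrow> x \<in> hom P N \<Longrightarrow> cmp P N N0 (cmp N N1 N0 f u) x = 0 \<Longrightarrow> x = 0"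
    using kernel_split[OF res N1(1) N0(1) f] by metis
  define m where "m = cmp N N1 K k u"
  have m: "m \<in> hom N K" using N1 s by (simp add: m_def)
  have kz: "cmp Z N1 K k z = 0"
    using \<kappa>_mono[OF s(2), of "cmp Z N1 K k z"] s(4,7) N1 H by (simp add: f_def)
  have m_mono: "x = 0" if X: "X \<in> addG" "x \<in> hom X N" "cmp X N K m x = 0" for X x
  proof (rule addG_mono[where f = "cmp N N1 N0 f u", OF _ _ X(1,2)])
    show "x = 0" if "P \<in> ind" "x \<in> hom P N" "cmp P N N0 (cmp N N1 N0 f u) x = 0" for P x
      using s(9) that by blast
    show "cmp X N N0 (cmp N N1 N0 f u) x = 0"
      using arg_cong[OF X(3), of "cmp X K N0 \<kappa>"] X s(3) N1 H by (simp add: f_def m_def)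
  qed (use f s(3) in simp_all)
  have m_epi: "\<exists>y\<in>hom X N. x = cmp X N K m y" if X: "X \<in> addG" "x \<in> hom X K" for X x
  proof -
    obtain y where y: "y \<in> hom X N1" "x = cmp X N1 K k y" using N1(3) X by blast
    have "y = cmp X N1 N1 (cmp N1 N N1 u v + cmp N1 Z N1 z w') y" unfolding s(8) using y by simp
    also have "\<dots> = cmp X N N1 u (cmp X N1 N v y) + cmp X Z N1 z (cmp X N1 Z w' y)"
      using s(3-6) y by (simp add: comp_linear)
    finally have "x = cmp X N1 K k (cmp X N N1 u (cmp X N1 N v y) + cmp X Z N1 z (cmp X N1 Z w' y))"
      using y(2) by simp
    then have "x = cmp X N K m (cmp X N1 N v y)"
      using s(3-6) y(1) N1 by (simp add: comp_linear comp_eq_assoc[OF kz] m_def)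
    then show ?thesis by (rule bexI) (use s y in simp)
  qed
  obtain E g h where tE: "tri T N K E m g h" using tri_complete[OF m] by blast
  note HE = tri_homs[OF tE]
  have "zero_obj T E"
  proof (rule orthogonal_zero)
    fix X e assume X: "X \<in> addG" "e \<in> hom X E"
    obtain X' a b where X': "X' \<in> addG" "a \<in> hom (sh X') X" "b \<in> hom X (sh X')"
      "cmp X (sh X') X a b = idm X" using X(1) by (rule unshift_addG)
    obtain x where x: "x \<in> hom X' N" "cmp (sh X') X (sh N) (cmp X E (sh N) h e) a = ms X' N x"
      using ms_full[of "cmp (sh X') X (sh N) (cmp X E (sh N) h e) a" X' N] X X' HE by auto
    have "ms X' K (cmp X' N K m x) = cmp (sh X') (sh N) (sh K) (ms N K m) (ms X' N x)"
      using m x by simp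
    also have "\<dots> = 0"
      unfolding x(2)[symmetric] using comp_eq_assoc[OF tri_fh[OF tE]] HE X X' by simp
    finally have "x = 0" using m_mono[OF X'(1) x(1)] m x by simp
    then have "cmp X (sh X') (sh N) (cmp (sh X') X (sh N) (cmp X E (sh N) h e) a) b = 0"
      unfolding x(2) using X' by simp
    then have "cmp X E (sh N) h e = 0" using X X' HE by simp
    then obtain y where y: "y \<in> hom X K" "e = cmp X K E g y" using lift_through_g[OF tE X(2)] by blast
    obtain y' where "y' \<in> hom X N" "y = cmp X N K m y'" using m_epi[OF X(1) y(1)] by blast
    then show "e = 0" using y comp_eq_assoc[OF tri_gf[OF tE]] HE by simp
  qed
  then have "g = 0" using HE zero_obj_Hom by blast
  then obtain r where r: "r \<in> hom K N" "idm K = cmp K N K m r"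
    using lift_through_f[OF tE mid_Hom] by auto
  have "K \<in> addG"
    by (rule closed_retract[OF closed_addG s(1) r(1) m]) (use r iso_map_id in metis)
  then show thesis using that N0(1) t by blast
qed

lemma generated_in_2: "generated_in T G 2 = UNIV"
proof -
  have "A \<in> generated_in T G 2" for A
  proof -
    obtain N M f g h where p: "N \<in> addG" "M \<in> addG" "tri T N M A f g h" by (rule presentation)
    have "tri T M A (sh N) g h (- ms N M f)" using tri_rot p by blast
    moreover have "sh N \<in> addG" using p closed_shift[OF closed_addG] by blast
    ultimately show ?thesis using p(2) unfolding addG_def numeral_2_eq_2 by (simp add: Bex_def) blast
  qed
  then show ?thesis by blast
qed

end

section \<open>Infinite orbits of the suspension\<close>

text \<open>
  The orbit of an indecomposable under the suspension, indexed by the integers, in the case that the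
  indecomposable is not isomorphic to its suspension.
\<close>

locale suspension_orbit = linearly_generated +
  fixes P :: "int \<Rightarrow> 'b"
  assumes P_ind: "P j \<in> ind"
    and P_shift: "isomorphic T (sh (P j)) (P (j + 1))"
    and P_distinct: "\<not> isomorphic T (P j) (P (j + 1))"
begin

text \<open>\<open>level j\<close> is the isomorphism class of \<open>P j\<close>; the suspension takes it to \<open>level (j + 1)\<close>.\<close>

definition level :: "int \<Rightarrow> 'b \<Rightarrow> bool" where "level j A \<longleftrightarrow> isomorphic T A (P j)"

lemma level_P: "level j (P j)"
  by (simp add: level_def isomorphic_refl)

lemma level_ind: "level j A \<Longrightarrow> A \<in> ind"
  unfolding level_def using ind_iso[OF P_ind isomorphic_sym] by blast

lemma level_shift: "level (j + 1) (sh A) \<longleftrightarrow> level j A"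
proof
  assume "level (j + 1) (sh A)"
  then have "isomorphic T (sh A) (sh (P j))"
    unfolding level_def using isomorphic_trans isomorphic_sym[OF P_shift] by blast
  then show "level j A" by (simp add: level_def)
next
  assume "level j A"
  then have "isomorphic T (sh A) (sh (P j))" by (simp add: level_def)
  then show "level (j + 1) (sh A)" unfolding level_def using isomorphic_trans P_shift by blast
qed

lemma level_iso: "isomorphic T A B \<Longrightarrow> level j B \<Longrightarrow> level j A"
  unfolding level_def using isomorphic_trans by blast

lemma P_step: "\<exists>f\<in>hom (P (j + 1)) (P j). f \<noteq> 0"
proof -
  obtain e where e: "e \<in> hom (sh (P j)) (P j)" "e \<noteq> 0"
    using le_nonzero[OF G2[OF P_ind]] by blast
  have "P (j + 1) \<in> ind" "sh (P j) \<in> ind" using P_ind by simp_all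
  moreover obtain d where "d \<in> hom (P (j + 1)) (sh (P j))" "d \<noteq> 0"
    using iso_nonzero[OF P_ind isomorphic_sym[OF P_shift]] by blast
  ultimately show ?thesis using comp_nonzero P_ind e by (meson mcomp_Hom)
qed

lemma P_chain: "\<exists>f\<in>hom (P (j + int n)) (P j). f \<noteq> 0"
proof (induction n)
  case 0
  then show ?case using ind_idm[OF P_ind] by (intro bexI[of _ "idm (P j)"]) simp_all
next
  case (Suc n)
  then obtain f where "f \<in> hom (P (j + int n)) (P j)" "f \<noteq> 0" by blast
  moreover obtain g where "g \<in> hom (P (j + int n + 1)) (P (j + int n))" "g \<noteq> 0" using P_step by blast
  moreover have "j + int (Suc n) = j + int n + 1" by simp
  ultimately show ?case using comp_nonzero P_ind by (metis mcomp_Hom)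
qed

lemma level_nonzero:
  assumes "level a A" "level b B" "a \<le> b"
  obtains f where "f \<in> hom B A" "f \<noteq> 0"
proof -
  obtain f where f: "f \<in> hom (P b) (P a)" "f \<noteq> 0"
    using P_chain[of a "nat (b - a)"] assms(3) by auto
  obtain i where i: "i \<in> hom B (P b)" "i \<noteq> 0"
    using iso_nonzero[OF level_ind] assms(2) level_def by blast
  obtain k where k: "k \<in> hom (P a) A" "k \<noteq> 0"
    using iso_nonzero[OF P_ind isomorphic_sym] assms(1) level_def by blast
  have "cmp B (P b) (P a) f i \<noteq> 0"
    using comp_nonzero[OF level_ind[OF assms(2)] P_ind P_ind i f] .
  then have "cmp B (P a) A k (cmp B (P b) (P a) f i) \<noteq> 0"
    using comp_nonzero[OF level_ind[OF assms(2)] P_ind level_ind[OF assms(1)] _ _ k] i f by simp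
  then show thesis using that i f k by (meson mcomp_Hom)
qed

lemma level_zero:
  assumes A: "level a A" and B: "level b B" and ab: "a < b" and f: "f \<in> hom A B"
  shows "f = 0"
proof (rule ccontr)
  assume "f \<noteq> 0"
  then have 1: "lin_le T B A" using nonzero_le level_ind A B f by blast
  have le: "lin_le T (P i) (P j)" if "i \<le> j" for i j
    using level_nonzero[OF level_P level_P that] nonzero_le P_ind by metis
  obtain i where i: "i \<in> hom (P a) A" "i \<noteq> 0"
    using iso_nonzero[OF P_ind isomorphic_sym] A level_def by blast
  obtain k where k: "k \<in> hom B (P b)" "k \<noteq> 0"
    using iso_nonzero[OF level_ind] B level_def by blast
  have "lin_le T A (P a)" "lin_le T (P b) B"
    using nonzero_le i k P_ind level_ind A B by blast+
  then have "lin_le T (P b) (P a)" using 1 G1_trans P_ind level_ind A B by meson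
  then have "lin_le T (P (a + 1)) (P a)"
    using le[of "a + 1" b] ab G1_trans P_ind by (metis zless_imp_add1_zle)
  then have "isomorphic T (P a) (P (a + 1))" using le[of a "a + 1"] G1_antisym P_ind by simp
  then show False using P_distinct by blast
qed

subsection \<open>Jumps\<close>

text \<open>
  The groups \<open>Hom(P j, Y)\<close> form a sequence of maps; \<open>j\<close> is a jump of \<open>Y\<close> if the cone of a nonzero map
  \<open>P (j + 1) \<rightarrow> P j\<close> has a nonzero map to \<open>Y\<close>. The map \<open>Hom(P j, Y) \<rightarrow> Hom(P (j + 1), Y)\<close> is injective
  unless \<open>j\<close> is a jump, and surjective unless \<open>j - 1\<close> is a jump.
\<close>

definition jump :: "int \<Rightarrow> 'b \<Rightarrow> bool" where
  "jump j Y \<longleftrightarrow> (\<exists>A B C f g h. level (j + 1) A \<and> level j B \<and> tri T A B C f g h \<and> f \<noteq> 0 \<and>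
     (\<exists>c\<in>hom C Y. c \<noteq> 0))"

lemma jump_shift: "jump (j + 1) (sh Y) \<longleftrightarrow> jump j Y"
proof
  assume "jump j Y"
  then obtain A B C f g h c where j: "level (j + 1) A" "level j B" "tri T A B C f g h" "f \<noteq> 0"
    "c \<in> hom C Y" "c \<noteq> 0" unfolding jump_def by blast
  have "tri T (sh A) (sh B) (sh C) (- ms A B f) (- ms B C g) (- ms C (sh A) h)"
    using j(3) by (rule tri_shift)
  moreover have "- ms A B f \<noteq> 0" "ms C Y c \<noteq> 0" using j tri_homs[OF j(3)] by simp_all
  moreover have "level (j + 1 + 1) (sh A)" "level (j + 1) (sh B)" using j(1,2) level_shift by blast+
  ultimately show "jump (j + 1) (sh Y)" unfolding jump_def using ms_Hom[OF j(5)] by blast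
next
  assume "jump (j + 1) (sh Y)"
  then obtain A B C f g h x where j: "level (j + 1 + 1) A" "level (j + 1) B" "tri T A B C f g h" "f \<noteq> 0"
    "x \<in> hom C (sh Y)" "x \<noteq> 0" unfolding jump_def by blast
  obtain A' B' C' f' g' h' b b' c c' where d:
    "tri T A' B' C' f' g' h'" "isomorphic T (sh A') A" "isomorphic T (sh B') B"
    "b \<in> hom B (sh B')" "b' \<in> hom (sh B') B" "cmp B (sh B') B b' b = idm B"
    "c \<in> hom C (sh C')" "c' \<in> hom (sh C') C" "cmp C (sh C') C c' c = idm C"
    "f \<noteq> 0 \<longrightarrow> f' \<noteq> 0" "cmp (sh B') C (sh C') c (cmp (sh B') B C g b') = - ms B' C' g'"
    using desuspend[OF j(3)] .
  obtain x' where x': "x' \<in> hom C' Y" "cmp (sh C') C (sh Y) x c' = ms C' Y x'"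
    using ms_full[of "cmp (sh C') C (sh Y) x c'" C' Y] d j by auto
  have "x = cmp C (sh C') (sh Y) (cmp (sh C') C (sh Y) x c') c" using d j by simp
  then have "x' \<noteq> 0" using j(6) x' d(7) by auto
  moreover have "level (j + 1) A'" "level j B'" using d(2,3) j(1,2) level_iso level_shift by blast+
  ultimately show "jump j Y" unfolding jump_def using d(1,10) j(4) x'(1) by blast
qed

text \<open>
  These two properties determine the jump \<open>j\<close> of an indecomposable \<open>Q\<close>, as the groups \<open>Hom(P m, Q)\<close>
  stay nonzero for larger \<open>m\<close> once they are. The offsets arise because a nonzero map to \<open>Q\<close> from the cone
  \<open>C\<close> of \<open>P (j + 1) \<rightarrow> P j\<close> factors through \<open>C \<rightarrow> P (j + 1)[1]\<close>.
\<close>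

lemma jump_ind:
  assumes Q: "Q \<in> ind" and "jump j Q"
  shows "\<exists>x\<in>hom (P (j + 2)) Q. x \<noteq> 0" "x \<in> hom (P (j + 1)) Q \<Longrightarrow> x = 0"
proof -
  obtain A B C f g h c where j: "level (j + 1) A" "level j B" "tri T A B C f g h" "f \<noteq> 0"
    "c \<in> hom C Q" "c \<noteq> 0" using \<open>jump j Q\<close> unfolding jump_def by blast
  note H = tri_homs[OF j(3)]
  note AB = level_ind[OF j(1)] level_ind[OF j(2)]
  have "cmp A B Q (cmp B C Q c g) f = 0"
    using tri_gf[OF j(3)] H j(5) by simp
  \<comment> \<open>composites of nonzero maps between indecomposables are nonzero, and \<open>f \<noteq> 0\<close>\<close>
  then have "cmp B C Q c g = 0"
    using comp_nonzero[OF AB Q H(1) j(4)] H j(5) mcomp_Hom by blast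
  then obtain c' where c': "c' \<in> hom (sh A) Q" "c = cmp C (sh A) Q c' h"
    using extend_along_h[OF j(3,5)] by blast
  then have c'0: "c' \<noteq> 0" using j(6) H by auto
  have sA: "level (j + 2) (sh A)" using j(1) level_shift[of "j + 1" A] by (metis add.assoc one_add_one)
  obtain d where d: "d \<in> hom (P (j + 2)) (sh A)" "d \<noteq> 0"
    using level_nonzero[OF sA level_P] by blast
  have "cmp (P (j + 2)) (sh A) Q c' d \<noteq> 0"
    using comp_nonzero[OF P_ind level_ind[OF sA] Q d c'(1) c'0] .
  then show "\<exists>x\<in>hom (P (j + 2)) Q. x \<noteq> 0" using d c' mcomp_Hom by blast
  show "x = 0" if x: "x \<in> hom (P (j + 1)) Q"
  proof (rule ccontr)
    assume x0: "x \<noteq> 0"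
    have sB: "level (j + 1) (sh B)" using j(2) level_shift by simp
    obtain e where e: "e \<in> hom (sh B) (P (j + 1))" "e \<noteq> 0"
      using level_nonzero[OF level_P sB] by blast
    define y where "y = cmp (sh B) (P (j + 1)) Q x e"
    have y: "y \<in> hom (sh B) Q" "y \<noteq> 0"
      using comp_nonzero[OF level_ind[OF sB] P_ind Q e x x0] e x by (simp_all add: y_def)
    have "ms A B f \<in> hom (sh A) (sh B)" "ms A B f \<noteq> 0" using H j(4) by simp_all
    then obtain r where "c' = cmp (sh A) (sh B) Q (mscale T r y) (ms A B f)"
      using factor_scaled(2)[OF level_ind[OF sA] level_ind[OF sB] Q _ _ y c'(1)] by blast
    then have "c = cmp C (sh B) Q (mscale T r y) (cmp C (sh A) (sh B) (ms A B f) h)"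
      using c'(2) H y by simp
    then show False using tri_fh[OF j(3)] y j(6) by simp
  qed
qed

lemma finite_jumps: "finite {j. jump j Y}"
proof -
  define F where "F = {Y. finite {j. jump j Y}}"
  have shift: "{j. jump j (sh Y)} = (\<lambda>j. j + 1) ` {j. jump j Y}" for Y
    using jump_shift by (force simp: image_iff intro: exI[of _ "_ - 1"])
  have shF: "sh Y \<in> F \<longleftrightarrow> Y \<in> F" for Y
    unfolding F_def mem_Collect_eq shift by (rule finite_image_iff) (simp add: inj_on_def)
  have "thick T F"
    unfolding thick_def
  proof (intro conjI allI impI)
    show "Z \<in> F" if "zero_obj T Z" for Z
      using that by (simp add: F_def jump_def zero_obj_def)
    show "sh X \<in> F \<longleftrightarrow> X \<in> F" for X by (rule shF)
    show "Z \<in> F" if t: "tri T X Y Z u v w" and XY: "X \<in> F" "Y \<in> F" for X Y Z u v w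
    proof -
      have "jump j Y \<or> jump j (sh X)" if "jump j Z" for j
      proof -
        obtain A B C f g h c where j: "level (j + 1) A" "level j B" "tri T A B C f g h" "f \<noteq> 0"
          "c \<in> hom C Z" "c \<noteq> 0" using \<open>jump j Z\<close> unfolding jump_def by blast
        show ?thesis
        proof (cases "cmp C Z (sh X) w c = 0")
          case True
          then obtain d where d: "d \<in> hom C Y" "c = cmp C Y Z v d" using lift_through_g[OF t j(5)] by blast
          then have "d \<noteq> 0" using j(6) tri_homs[OF t] by auto
          then show ?thesis unfolding jump_def using j d by blast
        next
          case False
          moreover have "cmp C Z (sh X) w c \<in> hom C (sh X)" using tri_homs[OF t] j by simp
          ultimately show ?thesis unfolding jump_def using j by blast
        qed
      qed
      then have "{j. jump j Z} \<subseteq> {j. jump j Y} \<union> {j. jump j (sh X)}" by blast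
      moreover have "finite ({j. jump j Y} \<union> {j. jump j (sh X)})"
        using XY shF[of X] by (simp add: F_def)
      ultimately show ?thesis unfolding F_def using finite_subset by blast
    qed
    show "X \<in> F" if B: "B \<in> F" and S: "biproduct T X Y B" for X Y B
    proof -
      obtain i p where i: "i \<in> hom X B" "p \<in> hom B X" "cmp X B X p i = idm X"
        using S by (rule biproductE)
      have "\<exists>d\<in>hom C B. d \<noteq> 0" if "c \<in> hom C X" "c \<noteq> 0" for C c
        using comp_eq_assoc[OF i(3), of c C] i that by (intro bexI[of _ "cmp C X B i c"]) auto
      then have "{j. jump j X} \<subseteq> {j. jump j B}" unfolding jump_def by blast
      then show ?thesis using B unfolding F_def using finite_subset by blast
    qed
  qed
  moreover have "G \<in> F"
  proof -
    obtain L X i p where res: "resolution L G X i p" using G_addG by (rule ex_resolution)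
    note rd = resolutionD[OF res]
    have one: "j = j'" if Q: "Q \<in> ind" and j: "jump j Q" "jump j' Q" for Q j j'
    proof -
      have False if m: "jump m Q" and n: "jump n Q" and mn: "m < n" for m n
      proof -
        obtain x where x: "x \<in> hom (P (m + 2)) Q" "x \<noteq> 0" using jump_ind(1)[OF Q m] by blast
        obtain y where y: "y \<in> hom (P (n + 1)) (P (m + 2))" "y \<noteq> 0"
          using level_nonzero[OF level_P level_P, of "m + 2" "n + 1"] mn by auto
        have "cmp (P (n + 1)) (P (m + 2)) Q x y \<noteq> 0"
          using comp_nonzero[OF P_ind P_ind Q y x] .
        then show False using jump_ind(2)[OF Q n] x y by simp
      qed
      then show ?thesis using j by (meson linorder_neqE)
    qed
    have "\<exists>l\<in>L. jump j (X l)" if "jump j G" for j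
    proof -
      obtain A B C f g h c where j: "level (j + 1) A" "level j B" "tri T A B C f g h" "f \<noteq> 0"
        "c \<in> hom C G" "c \<noteq> 0" using \<open>jump j G\<close> unfolding jump_def by blast
      have "\<exists>l\<in>L. cmp C G (X l) (p l) c \<noteq> 0"
      proof (rule ccontr)
        assume "\<not> ?thesis"
        then have "(\<Sum>l\<in>L. cmp C (X l) G (i l) (cmp C G (X l) (p l) c)) = 0"
          using rd by (intro sum.neutral) simp
        then show False using resolution_sum_left[OF res j(5)] j(6) by simp
      qed
      then obtain l where "l \<in> L" "cmp C G (X l) (p l) c \<noteq> 0" by blast
      moreover have "cmp C G (X l) (p l) c \<in> hom C (X l)" using rd \<open>l \<in> L\<close> j by simp
      ultimately show ?thesis unfolding jump_def using j by blast
    qed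
    then have "{j. jump j G} \<subseteq> (\<Union>l\<in>L. {j. jump j (X l)})" by blast
    moreover have "finite {j. jump j (X l)}" if "l \<in> L" for l
    proof (cases "\<exists>j. jump j (X l)")
      case True
      then obtain j where "jump j (X l)" by blast
      then have "{j. jump j (X l)} \<subseteq> {j}" using one rd(3)[OF that] by blast
      then show ?thesis using finite_subset by blast
    qed simp
    ultimately show ?thesis unfolding F_def using rd(1) finite_subset by blast
  qed
  ultimately show ?thesis using thick_UNIV unfolding F_def by blast
qed

subsection \<open>Cones that occur in an object\<close>

text \<open>
  For \<open>i > 0\<close> the cone \<open>C\<close> of a nonzero map \<open>P (j + i) \<rightarrow> P j\<close> has \<open>Hom(P m, C) \<noteq> 0\<close> exactly for
  \<open>j \<le> m < j + i\<close>. It occurs in \<open>Y\<close> if some \<open>C \<rightarrow> Y \<rightarrow> C\<close> does not vanish on \<open>P j \<rightarrow> C\<close>. Then this interval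
  is a direct summand of the sequence of \<open>Y\<close>, whose maps therefore fail to be isomorphisms at both of
  its ends.
\<close>

definition occurs :: "int \<Rightarrow> 'b \<Rightarrow> bool" where
  "occurs i Y \<longleftrightarrow> (\<exists>j A B C f g h a b. level (j + i) A \<and> level j B \<and> tri T A B C f g h \<and> f \<noteq> 0 \<and>
     a \<in> hom C Y \<and> b \<in> hom Y C \<and> cmp B C C (cmp C Y C b a) g \<noteq> 0)"

lemma occursI:
  assumes "level (j + i) A" "level j B" "tri T A B C f g h" "f \<noteq> 0"
     "a \<in> hom C Y" "b \<in> hom Y C" "cmp B C C (cmp C Y C b a) g \<noteq> 0"
  shows "occurs i Y"
  using assms unfolding occurs_def by blast

lemma occursE:
  assumes "occurs i Y"
  obtains j A B C f g h a b where "level (j + i) A" "level j B" "tri T A B C f g h" "f \<noteq> 0"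
     "a \<in> hom C Y" "b \<in> hom Y C" "cmp B C C (cmp C Y C b a) g \<noteq> 0"
  using assms unfolding occurs_def by blast

lemma occurs_shift: "occurs i (sh Y) \<longleftrightarrow> occurs i Y"
proof
  assume "occurs i Y"
  then obtain j A B C f g h a b where j: "level (j + i) A" "level j B" "tri T A B C f g h" "f \<noteq> 0"
     "a \<in> hom C Y" "b \<in> hom Y C" "cmp B C C (cmp C Y C b a) g \<noteq> 0" by (rule occursE)
  note H = tri_homs[OF j(3)]
  show "occurs i (sh Y)"
  proof (rule occursI[OF _ _ tri_shift[OF j(3)]])
    show "level ((j + 1) + i) (sh A)" "level (j + 1) (sh B)"
      using level_shift[of "j + i" A] level_shift[of j B] j by (simp_all add: algebra_simps)
    show "ms C Y a \<in> hom (sh C) (sh Y)" "ms Y C b \<in> hom (sh Y) (sh C)" using j by simp_all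
    show "cmp (sh B) (sh C) (sh C) (cmp (sh C) (sh Y) (sh C) (ms Y C b) (ms C Y a)) (- ms B C g) \<noteq> 0"
      using j(5-7) H by simp
  qed (use j H in simp)
next
  assume "occurs i (sh Y)"
  then obtain j A B C f g h x y where j: "level (j + i) A" "level j B" "tri T A B C f g h" "f \<noteq> 0"
     "x \<in> hom C (sh Y)" "y \<in> hom (sh Y) C" "cmp B C C (cmp C (sh Y) C y x) g \<noteq> 0" by (rule occursE)
  note H = tri_homs[OF j(3)]
  obtain A' B' C' f' g' h' b b' c c' where d:
    "tri T A' B' C' f' g' h'" "isomorphic T (sh A') A" "isomorphic T (sh B') B"
    "b \<in> hom B (sh B')" "b' \<in> hom (sh B') B" "cmp B (sh B') B b' b = idm B"
    "c \<in> hom C (sh C')" "c' \<in> hom (sh C') C" "cmp C (sh C') C c' c = idm C"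
    "f \<noteq> 0 \<longrightarrow> f' \<noteq> 0" "cmp (sh B') C (sh C') c (cmp (sh B') B C g b') = - ms B' C' g'"
    using desuspend[OF j(3)] .
  note H' = tri_homs[OF d(1)]
  obtain x' where x': "x' \<in> hom C' Y" "cmp (sh C') C (sh Y) x c' = ms C' Y x'"
    using ms_full[of "cmp (sh C') C (sh Y) x c'" C' Y] d j by auto
  obtain y' where y': "y' \<in> hom Y C'" "cmp (sh Y) C (sh C') c y = ms Y C' y'"
    using ms_full[of "cmp (sh Y) C (sh C') c y" Y C'] d j by auto
  show "occurs i Y"
  proof (rule occursI[OF _ _ d(1) d(10)[rule_format, OF j(4)] x'(1) y'(1)])
    show "level ((j - 1) + i) A'" "level (j - 1) B'"
      using level_shift[of "(j - 1) + i" A'] level_shift[of "j - 1" B'] level_iso d(2,3) j(1,2)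
      by (simp_all add: algebra_simps)
    show "cmp B' C' C' (cmp C' Y C' y' x') g' \<noteq> 0"
    proof
      assume "cmp B' C' C' (cmp C' Y C' y' x') g' = 0"
      then have "ms B' C' (cmp B' Y C' y' (cmp B' C' Y x' g')) = 0" using x' y' H' by simp
      then have 0: "cmp (sh B') (sh Y) (sh C') (ms Y C' y') (cmp (sh B') (sh C') (sh Y) (ms C' Y x') (- ms B' C' g')) = 0"
        using x' y' H' by simp
      have "cmp (sh B') C (sh C') c (cmp (sh B') (sh Y) C y (cmp (sh B') C (sh Y) x (cmp (sh B') B C g b'))) = 0"
        using 0 comp_eq_assoc[OF d(9), of "cmp (sh B') B C g b'" "sh B'"] d(4-9) j(5,6) H
        unfolding x'(2)[symmetric] y'(2)[symmetric] d(11)[symmetric] by simp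
      from arg_cong[OF this, of "\<lambda>z. cmp B (sh B') C (cmp (sh B') (sh C') C c' z) b"]
      have "cmp B (sh Y) C y (cmp B C (sh Y) x g) = 0"
        using comp_eq_assoc[OF d(9)] d(4-9) j(5,6) H by simp
      then show False using j(5-7) H by simp
    qed
  qed
qed

text \<open>\<open>occurs i\<close> behaves additively: it holds for a biproduct if and only if it holds for a summand.\<close>

lemma closed_occurs: "closed {Y. \<forall>i>0. occurs i Y \<longrightarrow> occurs i X}"
  unfolding additive_summand_shift_closed_def mem_Collect_eq
proof (intro conjI allI impI)
  fix Z i assume Z: "zero_obj T Z" and "occurs i Z"
  from this(2) show "occurs i X"
  proof (rule occursE)
    fix j A B C f g h a b
    assume "tri T A B C f g h" "a \<in> hom C Z" "b \<in> hom Z C" "cmp B C C (cmp C Z C b a) g \<noteq> 0"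
    moreover have "a = 0" using zero_obj_Hom Z \<open>a \<in> hom C Z\<close> by blast
    ultimately show ?thesis using tri_homs by fastforce
  qed
next
  fix Y Y' S i assume Y: "\<forall>i>0. occurs i Y \<longrightarrow> occurs i X" "\<forall>i>0. occurs i Y' \<longrightarrow> occurs i X"
    and S: "biproduct T Y Y' S" and i: "(0::int) < i" and "occurs i S"
  obtain j A B C f g h a b where j: "level (j + i) A" "level j B" "tri T A B C f g h" "f \<noteq> 0"
     "a \<in> hom C S" "b \<in> hom S C" "cmp B C C (cmp C S C b a) g \<noteq> 0"
    using \<open>occurs i S\<close> by (rule occursE)
  note H = tri_homs[OF j(3)]
  obtain s s' p p' where s: "s \<in> hom Y S" "s' \<in> hom Y' S" "p \<in> hom S Y" "p' \<in> hom S Y'"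
    "cmp S Y S s p + cmp S Y' S s' p' = idm S"
    using S by (rule biproductE)
  have "cmp B C C (cmp C S C b a) g
    = cmp B C C (cmp C S C b (cmp C S S (cmp S Y S s p + cmp S Y' S s' p') a)) g"
    unfolding s(5) using j by simp
  also have "\<dots> = cmp B C C (cmp C Y C (cmp Y S C b s) (cmp C S Y p a)) g
      + cmp B C C (cmp C Y' C (cmp Y' S C b s') (cmp C S Y' p' a)) g"
    using s(1-4) j(5,6) H by (simp add: comp_linear)
  finally have "cmp B C C (cmp C Y C (cmp Y S C b s) (cmp C S Y p a)) g \<noteq> 0
      \<or> cmp B C C (cmp C Y' C (cmp Y' S C b s') (cmp C S Y' p' a)) g \<noteq> 0"
    using j(7) by auto
  then have "occurs i Y \<or> occurs i Y'"
    using occursI[OF j(1-4), of "cmp C S Y p a" Y "cmp Y S C b s"]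
      occursI[OF j(1-4), of "cmp C S Y' p' a" Y' "cmp Y' S C b s'"] s(1-4) j(5,6) by auto
  then show "occurs i X" using Y i by blast
next
  fix Y Y' S i assume SX: "\<forall>i>0. occurs i S \<longrightarrow> occurs i X"
    and S: "biproduct T Y Y' S" and i: "(0::int) < i" and "occurs i Y"
  obtain j A B C f g h a b where j: "level (j + i) A" "level j B" "tri T A B C f g h" "f \<noteq> 0"
     "a \<in> hom C Y" "b \<in> hom Y C" "cmp B C C (cmp C Y C b a) g \<noteq> 0"
    using \<open>occurs i Y\<close> by (rule occursE)
  note H = tri_homs[OF j(3)]
  obtain s p where s: "s \<in> hom Y S" "p \<in> hom S Y" "cmp Y S Y p s = idm Y"
    using S by (rule biproductE)
  have "occurs i S"
    by (rule occursI[OF j(1-4), of "cmp C Y S s a" S "cmp S Y C b p"])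
      (use s j(5-7) H in \<open>simp_all add: comp_eq_assoc[OF s(3)]\<close>)
  then show "occurs i X" using SX i by blast
next
  fix Y
  show "(\<forall>i>0. occurs i (sh Y) \<longrightarrow> occurs i X) = (\<forall>i>0. occurs i Y \<longrightarrow> occurs i X)"
    by (simp add: occurs_shift)
qed

lemma ex_occurs:
  assumes "0 < i" shows "\<exists>Y. occurs i Y"
proof -
  obtain f where f: "f \<in> hom (P i) (P 0)" "f \<noteq> 0" using level_nonzero[OF level_P level_P, of 0 i] assms by auto
  obtain C g h where t: "tri T (P i) (P 0) C f g h" using tri_complete[OF f(1)] by blast
  note H = tri_homs[OF t]
  have "g \<noteq> 0"
  proof
    assume "g = 0"
    then obtain s where s: "s \<in> hom (P 0) (P i)" "idm (P 0) = cmp (P 0) (P i) (P 0) f s"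
      using lift_through_f[OF t, of "idm (P 0)" "P 0"] by auto
    have "s = 0" using level_zero[OF level_P level_P assms s(1)] .
    then show False using s(2) f ind_idm[OF P_ind] by simp
  qed
  then have "occurs i C"
    using occursI[OF _ level_P t f(2), of i "idm C" C "idm C"] level_P[of i] H by simp
  then show ?thesis ..
qed

text \<open>
  Let \<open>c : P j \<rightarrow> Y\<close> be the image of \<open>g\<close> in \<open>Y\<close>. It does not extend along \<open>P j \<rightarrow> P (j - 1)\<close>, because
  \<open>Hom(P (j - 1), C) = 0\<close>; hence the cone of that map has a nonzero map to \<open>Y[1]\<close>. The restriction of
  \<open>c\<close> to \<open>P (j + i - 1)\<close> is nonzero, because \<open>b c\<close> is a nonzero multiple of \<open>g\<close>, but it vanishes on
  \<open>P (j + i)\<close>.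
\<close>

lemma occurs_jumps:
  assumes i: "0 < i" and Y: "occurs i Y"
  shows "\<exists>j. jump j (sh Y) \<and> jump (j + i) Y"
proof -
  obtain j A B C f g h a b where j: "level (j + i) A" "level j B" "tri T A B C f g h" "f \<noteq> 0"
     "a \<in> hom C Y" "b \<in> hom Y C" "cmp B C C (cmp C Y C b a) g \<noteq> 0"
    using Y by (rule occursE)
  note H = tri_homs[OF j(3)]
  note AB = level_ind[OF j(1)] level_ind[OF j(2)]
  have sA: "level (j + i + 1) (sh A)" using level_shift j(1) by simp
  define c where "c = cmp B C Y a g"
  have c: "c \<in> hom B Y" "cmp B Y C b c \<noteq> 0" "cmp A B Y c f = 0"
    using j(5-7) H tri_gf[OF j(3)] by (simp_all add: c_def)
  have "jump (j - 1) (sh Y)"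
  proof -
    define B' where "B' = P (j - 1)"
    have B': "level (j - 1) B'" by (simp add: B'_def level_P)
    obtain v where v: "v \<in> hom B B'" "v \<noteq> 0" using level_nonzero[OF B' j(2)] by auto
    obtain D s t where t: "tri T B B' D v s t" using tri_complete[OF v(1)] by blast
    note HD = tri_homs[OF t]
    have "cmp D (sh B) (sh Y) (ms B Y c) t \<noteq> 0"
    proof
      assume "cmp D (sh B) (sh Y) (ms B Y c) t = 0"
      then obtain e' where e': "e' \<in> hom (sh B') (sh Y)" "ms B Y c = cmp (sh B) (sh B') (sh Y) e' (- ms B B' v)"
        using extend_along_h[OF tri_rot[OF t] ms_Hom[OF c(1)]] by blast
      obtain e where e: "e \<in> hom B' Y" "e' = ms B' Y e" using e'(1) by (rule ms_full)
      have "ms B Y c = ms B Y (- cmp B B' Y e v)" using e' e v by simp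
      then have ce: "c = - cmp B B' Y e v" using ms_eq_iff[of c B Y "- cmp B B' Y e v"] c e v by simp
      have be: "cmp B' Y C b e \<in> hom B' C" using e j by simp
      have "cmp B' C (sh A) h (cmp B' Y C b e) = 0"
        using level_zero[OF B' sA] i be H by simp
      then obtain k where k: "k \<in> hom B' B" "cmp B' Y C b e = cmp B' B C g k"
        using lift_through_g[OF j(3) be] by blast
      have "k = 0" using level_zero[OF B' j(2) _ k(1)] by simp
      then have "cmp B' Y C b e = 0" using k H by simp
      then have "cmp B Y C b c = 0" unfolding ce using comp_eq_assoc[of B' Y C b e 0 v B] e v j by simp
      then show False using c by simp
    qed
    then show ?thesis
      unfolding jump_def using j(2) B' t v(2) HD c(1)
      by (intro exI[of _ B] exI[of _ B'] exI[of _ D] exI[of _ v] exI[of _ s] exI[of _ t])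
        (auto intro!: bexI[of _ "cmp D (sh B) (sh Y) (ms B Y c) t"])
  qed
  moreover have "jump (j - 1 + i) Y"
  proof -
    define A' where "A' = P (j - 1 + i)"
    have A': "level (j - 1 + i) A'" by (simp add: A'_def level_P)
    note A'I = level_ind[OF A']
    obtain f' where f': "f' \<in> hom A' B" "f' \<noteq> 0" using level_nonzero[OF j(2) A'] i by auto
    obtain w where w: "w \<in> hom A A'" "w \<noteq> 0" using level_nonzero[OF A' j(1)] by auto
    obtain D s t where t: "tri T A A' D w s t" using tri_complete[OF w(1)] by blast
    note HD = tri_homs[OF t]
    define x where "x = cmp A' B Y c f'"
    have x: "x \<in> hom A' Y" using c f' by (simp add: x_def)
    obtain r where r: "cmp A A' B f' w = mscale T r f"
      using one_dim[OF AB H(1) j(4), of "cmp A A' B f' w"] f' w by auto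
    have "cmp A A' Y x w = cmp A B Y c (cmp A A' B f' w)" using f' w c by (simp add: x_def)
    also have "\<dots> = 0" unfolding r using c H by (simp add: comp_linear)
    finally have xw: "cmp A A' Y x w = 0" .
    have "x \<noteq> 0"
    proof
      assume x0: "x = 0"
      have bc: "cmp B Y C b c \<in> hom B C" using j c by simp
      have "cmp B C (sh A) h (cmp B Y C b c) = 0"
        using level_zero[OF j(2) sA] i bc H by simp
      then obtain k where k: "k \<in> hom B B" "cmp B Y C b c = cmp B B C g k"
        using lift_through_g[OF j(3) bc] by blast
      obtain l where l: "k = mscale T l (idm B)" using ind_endo[OF AB(2) k(1)] by blast
      have bcl: "cmp B Y C b c = mscale T l g" using k(2) l H by (simp add: comp_linear)
      then have l0: "l \<noteq> 0" using c(2) by auto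
      have "mscale T l (cmp A' B C g f') = cmp A' B C (cmp B Y C b c) f'"
        unfolding bcl using H f' by (simp add: comp_linear)
      also have "\<dots> = 0" using x0 j c f' by (simp add: x_def)
      finally have "cmp A' B C g f' = 0" using l0 by simp
      then obtain m where m: "m \<in> hom A' A" "f' = cmp A' A B f m"
        using lift_through_f[OF j(3) f'(1)] by blast
      have "m = 0" using level_zero[OF A' j(1) _ m(1)] by simp
      then show False using m f' H by simp
    qed
    moreover obtain e where e: "e \<in> hom D Y" "x = cmp A' D Y e s"
      using extend_along_g[OF t x xw] by blast
    ultimately have "e \<noteq> 0" using HD by auto
    then show ?thesis
      unfolding jump_def using j(1) A' t w(2) e(1)
      by (intro exI[of _ A] exI[of _ A'] exI[of _ D] exI[of _ w] exI[of _ s] exI[of _ t])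
        (auto simp: algebra_simps)
  qed
  ultimately show ?thesis by blast
qed

theorem no_additive_generator: "closed hull {X} \<noteq> UNIV"
proof
  assume U: "closed hull {X} = UNIV"
  have "closed hull {X} \<subseteq> {Y. \<forall>i>0. occurs i Y \<longrightarrow> occurs i X}"
    by (rule hull_minimal) (use closed_occurs in auto)
  then have all: "occurs i X" if "0 < i" for i using ex_occurs[OF that] that U by blast
  define D where "D = (\<lambda>(m, n). n - m) ` ({j. jump j (sh X)} \<times> {j. jump j X})"
  have "finite D" unfolding D_def using finite_jumps by blast
  moreover have "{0<..} \<subseteq> D"
  proof
    fix i :: int assume "i \<in> {0<..}"
    then obtain j where "jump j (sh X)" "jump (j + i) X" using occurs_jumps[of i X] all[of i] by auto
    then show "i \<in> D" unfolding D_def by (force intro: image_eqI[of _ _ "(j, j + i)"])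
  qed
  ultimately show False using infinite_Ioi finite_subset by blast
qed

end

context linearly_generated
begin

lemma infinite_orbit_no_additive_generator:
  assumes Q: "Q \<in> ind" and n: "\<not> isomorphic T Q (sh Q)"
  shows "closed hull {X} \<noteq> UNIV"
proof -
  define un where "un Y = (SOME X. isomorphic T (sh X) Y)" for Y
  have un: "isomorphic T (sh (un Y)) Y" for Y
    unfolding un_def using shift_ess_surj by (rule someI_ex)
  \<comment> \<open>the suspension need not be invertible on objects, so desuspensions are chosen\<close>
  define P where "P j = (if 0 \<le> j then (sh ^^ nat j) Q else (un ^^ nat (- j)) Q)" for j :: int
  have P_shift: "isomorphic T (sh (P j)) (P (j + 1))" for j
  proof (cases "0 \<le> j")
    case True
    then have "P (j + 1) = sh (P j)" by (simp add: P_def nat_add_distrib)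
    then show ?thesis by (simp add: isomorphic_refl)
  next
    case False
    then have "nat (- j) = Suc (nat (- (j + 1)))" by simp
    then have "P j = un (P (j + 1))" using False by (auto simp: P_def)
    then show ?thesis by (simp add: un)
  qed
  have ind_step: "P (j + 1) \<in> ind \<longleftrightarrow> P j \<in> ind" for j
    using ind_iso[OF _ P_shift] ind_iso[OF _ isomorphic_sym[OF P_shift]] ind_shift by blast
  have step: "isomorphic T (P (j + 1)) (P (j + 1 + 1)) \<longleftrightarrow> isomorphic T (P j) (P (j + 1))" for j
  proof -
    have "isomorphic T (P (j + 1)) (P (j + 1 + 1)) \<longleftrightarrow> isomorphic T (sh (P j)) (sh (P (j + 1)))"
      using P_shift[of j] P_shift[of "j + 1"] isomorphic_trans isomorphic_sym by blast
    then show ?thesis by simp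
  qed
  have "P j \<in> ind \<and> \<not> isomorphic T (P j) (P (j + 1))" for j
  proof (induction j rule: int_induct[where k = 0])
    case base
    then show ?case using Q n by (simp add: P_def)
  next
    case (step1 i)
    then show ?case using ind_step step by simp
  next
    case (step2 i)
    then show ?case using ind_step[of "i - 1"] step[of "i - 1"] by simp
  qed
  then interpret suspension_orbit T G P
    using P_shift by unfold_locales blast+
  show ?thesis by (rule no_additive_generator)
qed

end

context klinear_triangulated_category
begin

lemma biproduct_isomorphic:
  assumes "biproduct T X Y S" "biproduct T X' Y' S'" "isomorphic T X X'" "isomorphic T Y Y'"
  shows "isomorphic T S S'"
proof -
  obtain i j p q where b: "i \<in> hom X S" "j \<in> hom Y S" "p \<in> hom S X" "q \<in> hom S Y"
    "cmp X S X p i = idm X" "cmp Y S Y q j = idm Y" "cmp Y S X p j = 0" "cmp X S Y q i = 0"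
    "cmp S X S i p + cmp S Y S j q = idm S"
    using assms(1) by (rule biproductE)
  obtain i' j' p' q' where b': "i' \<in> hom X' S'" "j' \<in> hom Y' S'" "p' \<in> hom S' X'" "q' \<in> hom S' Y'"
    "cmp X' S' X' p' i' = idm X'" "cmp Y' S' Y' q' j' = idm Y'" "cmp Y' S' X' p' j' = 0" "cmp X' S' Y' q' i' = 0"
    "cmp S' X' S' i' p' + cmp S' Y' S' j' q' = idm S'"
    using assms(2) by (rule biproductE)
  obtain f f' where f: "f \<in> hom X X'" "f' \<in> hom X' X" "cmp X X' X f' f = idm X" "cmp X' X X' f f' = idm X'"
    using assms(3) by (rule isomorphicE)
  obtain g g' where g: "g \<in> hom Y Y'" "g' \<in> hom Y' Y" "cmp Y Y' Y g' g = idm Y" "cmp Y' Y Y' g g' = idm Y'"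
    using assms(4) by (rule isomorphicE)
  note r = b(5-8)[THEN comp_eq_assoc] b'(5-8)[THEN comp_eq_assoc] f(3,4)[THEN comp_eq_assoc] g(3,4)[THEN comp_eq_assoc]
  show ?thesis
  proof (rule isomorphicI)
    show "cmp S X' S' i' (cmp S X X' f p) + cmp S Y' S' j' (cmp S Y Y' g q) \<in> hom S S'"
      "cmp S' X S i (cmp S' X' X f' p') + cmp S' Y S j (cmp S' Y' Y g' q') \<in> hom S' S"
      using b b' f g by simp_all
    show "cmp S S' S (cmp S' X S i (cmp S' X' X f' p') + cmp S' Y S j (cmp S' Y' Y g' q'))
      (cmp S X' S' i' (cmp S X X' f p) + cmp S Y' S' j' (cmp S Y Y' g q)) = idm S"
      "cmp S' S S' (cmp S X' S' i' (cmp S X X' f p) + cmp S Y' S' j' (cmp S Y Y' g q))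
        (cmp S' X S i (cmp S' X' X f' p') + cmp S' Y S j (cmp S' Y' Y g' q')) = idm S'"
      using b b' f g by (simp_all add: comp_linear r)
  qed
qed

text \<open>If a map is a retract of another map, then its cone is a retract of the cone of the other.\<close>

lemma cone_retract:
  assumes t: "tri T X Y Z f g h" and t': "tri T X' Y' Z' f' g' h'"
    and a: "a \<in> hom X X'" "a' \<in> hom X' X" "cmp X X' X a' a = idm X"
    and b: "b \<in> hom Y Y'" "b' \<in> hom Y' Y" "cmp Y Y' Y b' b = idm Y"
    and comm: "cmp X Y Y' b f = cmp X X' Y' f' a" "cmp X' Y' Y b' f' = cmp X' X Y f a'"
    and S: "closed S" "Z' \<in> S"
  shows "Z \<in> S"
proof -
  note H = tri_homs[OF t] tri_homs[OF t']
  obtain c where c: "c \<in> hom Z Z'" "cmp Y Z Z' c g = cmp Y Y' Z' g' b"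
    "cmp Z (sh X) (sh X') (ms X X' a) h = cmp Z Z' (sh X') h' c"
    using tri_morphism[OF t t' a(1) b(1) comm(1)] by blast
  obtain d where d: "d \<in> hom Z' Z" "cmp Y' Z' Z d g' = cmp Y' Y Z g b'"
    "cmp Z' (sh X') (sh X) (ms X' X a') h' = cmp Z' Z (sh X) h d"
    using tri_morphism[OF t' t a(2) b(2) comm(2)] by blast
  have sa: "cmp (sh X) (sh X') (sh X) (ms X' X a') (ms X X' a) = idm (sh X)" using a by simp
  have "iso_map T Z Z (cmp Z Z' Z d c)"
  proof (rule tri_third_endo_iso[OF t])
    show "cmp Y Z Z (cmp Z Z' Z d c) g = g"
      using c(1,2) d(1) b H comp_eq_assoc[OF d(2)] by simp
    have "cmp Z Z (sh X) h (cmp Z Z' Z d c) = cmp Z Z' (sh X) (cmp Z' Z (sh X) h d) c"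
      using c d H by simp
    also have "\<dots> = cmp Z (sh X') (sh X) (ms X' X a') (cmp Z Z' (sh X') h' c)"
      unfolding d(3)[symmetric] using c(1) a H by simp
    also have "\<dots> = h"
      unfolding c(3)[symmetric] using a H comp_eq_assoc[OF sa, of h Z] by simp
    finally show "cmp Z Z (sh X) h (cmp Z Z' Z d c) = h" .
  qed (use c d in simp)
  then show ?thesis using closed_retract[OF S c(1) d(1)] by blast
qed

text \<open>If a map is a direct sum of two maps, then its cone is a retract of the sum of their cones.\<close>

lemma cone_sum:
  assumes t: "tri T X Y Z f g h" and t1: "tri T X1 Y1 Z1 f1 g1 h1" and t2: "tri T X2 Y2 Z2 f2 g2 h2"
    and X: "i1 \<in> hom X1 X" "p1 \<in> hom X X1" "i2 \<in> hom X2 X" "p2 \<in> hom X X2"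
      "cmp X X1 X i1 p1 + cmp X X2 X i2 p2 = idm X"
    and Y: "j1 \<in> hom Y1 Y" "q1 \<in> hom Y Y1" "j2 \<in> hom Y2 Y" "q2 \<in> hom Y Y2"
      "cmp Y Y1 Y j1 q1 + cmp Y Y2 Y j2 q2 = idm Y"
    and comm: "cmp X1 Y1 Y j1 f1 = cmp X1 X Y f i1" "cmp X Y Y1 q1 f = cmp X X1 Y1 f1 p1"
      "cmp X2 Y2 Y j2 f2 = cmp X2 X Y f i2" "cmp X Y Y2 q2 f = cmp X X2 Y2 f2 p2"
    and S: "closed S" "Z1 \<in> S" "Z2 \<in> S"
  shows "Z \<in> S"
proof -
  note H = tri_homs[OF t] tri_homs[OF t1] tri_homs[OF t2]
  obtain c1 where c1: "c1 \<in> hom Z1 Z" "cmp Y1 Z1 Z c1 g1 = cmp Y1 Y Z g j1"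
    "cmp Z1 (sh X1) (sh X) (ms X1 X i1) h1 = cmp Z1 Z (sh X) h c1"
    using tri_morphism[OF t1 t X(1) Y(1) comm(1)] by blast
  obtain d1 where d1: "d1 \<in> hom Z Z1" "cmp Y Z Z1 d1 g = cmp Y Y1 Z1 g1 q1"
    "cmp Z (sh X) (sh X1) (ms X X1 p1) h = cmp Z Z1 (sh X1) h1 d1"
    using tri_morphism[OF t t1 X(2) Y(2) comm(2)] by blast
  obtain c2 where c2: "c2 \<in> hom Z2 Z" "cmp Y2 Z2 Z c2 g2 = cmp Y2 Y Z g j2"
    "cmp Z2 (sh X2) (sh X) (ms X2 X i2) h2 = cmp Z2 Z (sh X) h c2"
    using tri_morphism[OF t2 t X(3) Y(3) comm(3)] by blast
  obtain d2 where d2: "d2 \<in> hom Z Z2" "cmp Y Z Z2 d2 g = cmp Y Y2 Z2 g2 q2"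
    "cmp Z (sh X) (sh X2) (ms X X2 p2) h = cmp Z Z2 (sh X2) h2 d2"
    using tri_morphism[OF t t2 X(4) Y(4) comm(4)] by blast
  define e where "e = cmp Z Z1 Z c1 d1 + cmp Z Z2 Z c2 d2"
  have "iso_map T Z Z e"
  proof (rule tri_third_endo_iso[OF t])
    have "cmp Y Z Z e g = cmp Y Y Z g (cmp Y Y1 Y j1 q1 + cmp Y Y2 Y j2 q2)"
      unfolding e_def using c1(1) d1(1,2) c2(1) d2(1,2) X(1-4) Y(1-4) H
        comp_eq_assoc[OF c1(2)] comp_eq_assoc[OF c2(2)] by (simp add: comp_linear)
    then show "cmp Y Z Z e g = g" unfolding Y(5) using H by simp
    have "cmp Z Z (sh X) h e = cmp Z Z1 (sh X) (cmp Z1 Z (sh X) h c1) d1 + cmp Z Z2 (sh X) (cmp Z2 Z (sh X) h c2) d2"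
      unfolding e_def using c1(1) d1(1) c2(1) d2(1) H by (simp add: comp_linear)
    also have "\<dots> = cmp Z (sh X1) (sh X) (ms X1 X i1) (cmp Z Z1 (sh X1) h1 d1)
        + cmp Z (sh X2) (sh X) (ms X2 X i2) (cmp Z Z2 (sh X2) h2 d2)"
      unfolding c1(3)[symmetric] c2(3)[symmetric] using d1(1) d2(1) X(1-4) H by simp
    also have "\<dots> = cmp Z (sh X) (sh X) (ms X X (cmp X X1 X i1 p1 + cmp X X2 X i2 p2)) h"
      unfolding d1(3)[symmetric] d2(3)[symmetric] using X(1-4) H
      by (simp add: comp_linear mshift_mcomp del: ms_comp)
    also have "\<dots> = h" unfolding X(5) using H by simp
    finally show "cmp Z Z (sh X) h e = h" .
  qed (use c1 d1 c2 d2 in \<open>simp add: e_def\<close>)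
  then show ?thesis
    using closed_retract_sum[OF S d1(1) c1(1) d2(1) c2(1)] unfolding e_def by blast
qed

lemma cone_zero:
  assumes t: "tri T X Y Z 0 g h" and S: "closed S" "X \<in> S" "Y \<in> S"
  shows "Z \<in> S"
proof -
  note H = tri_homs[OF t]
  obtain s where s: "s \<in> hom (sh X) Z" "idm (sh X) = cmp (sh X) Z (sh X) h s"
    using lift_through_h[OF t mid_Hom] by auto
  obtain r where r: "r \<in> hom Z Y" "idm Y = cmp Y Z Y r g"
    using extend_along_g[OF t mid_Hom] by auto
  define e where "e = cmp Z Y Z g r + cmp Z (sh X) Z s h"
  have "iso_map T Z Z e"
  proof (rule tri_third_endo_iso[OF t])
    show "cmp Y Z Z e g = g"
      unfolding e_def using H s(1) r(1) tri_hg[OF t] by (simp add: comp_linear flip: r(2))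
    show "cmp Z Z (sh X) h e = h"
      unfolding e_def using H s(1) r(1) comp_eq_assoc[OF tri_hg[OF t]] comp_eq_assoc[OF s(2)[symmetric]]
      by (simp add: comp_linear)
  qed (use H s r in \<open>simp add: e_def\<close>)
  then show ?thesis
    using closed_retract_sum[OF S(1) S(3) _ r(1) H(2) H(3) s(1)] closed_shift[OF S(1)] S(2)
    unfolding e_def by blast
qed

text \<open>A finite set of objects is contained in every closed class that contains their direct sum \<open>W\<close>.\<close>

lemma finite_common_sum:
  "finite K \<Longrightarrow> \<exists>W. \<forall>S. closed S \<longrightarrow> W \<in> S \<longrightarrow> K \<subseteq> S"
proof (induction K rule: finite_induct)
  case (insert X K)
  then obtain W where W: "\<And>S. closed S \<Longrightarrow> W \<in> S \<Longrightarrow> K \<subseteq> S" by blast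
  obtain B where B: "biproduct T X W B" using ex_biproduct by blast
  have "insert X K \<subseteq> S" if "closed S" "B \<in> S" for S
    using W closed_summand[OF that B] closed_summand[OF that biproduct_commute[OF B]] that(1) by blast
  then show ?case by blast
qed simp

end

context linearly_generated
begin

section \<open>Generators isomorphic to their suspension\<close>

lemma ex_moved_indecomposable:
  assumes "\<not> isomorphic T G (sh G)"
  shows "\<exists>Q\<in>ind. \<not> isomorphic T Q (sh Q)"
proof (rule ccontr)
  assume "\<not> ?thesis"
  then have fixed: "isomorphic T Q (sh Q)" if "Q \<in> ind" for Q using that by blast
  have "isomorphic T S (sh S)"
    if "finite_direct_sum T Xs S" "S \<in> addG" "\<forall>Y\<in>set Xs. local_End T Y" for Xs S
    using that
  proof (induction rule: finite_direct_sum.induct)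
    case (1 S)
    then have "idm S = 0" "idm (sh S) = 0" using zero_obj_iff zero_obj_shift by blast+
    then show ?case by (intro isomorphicI[of 0 _ _ 0]) simp_all
  next
    case (2 Xs R X S)
    have "X \<in> addG" "R \<in> addG"
      using closed_summand[OF closed_addG 2(4)] 2(2) biproduct_commute by blast+
    then have "X \<in> ind" using 2(5) local_End_imp_indecomposable by (simp add: ind_def)
    then show ?case
      using biproduct_isomorphic[OF 2(2) biproduct_shift[OF 2(2)] fixed] 2(3,5) \<open>R \<in> addG\<close> by simp
  qed
  then show False using assms ks G_addG unfolding krull_schmidt_def by blast
qed

text \<open>
  The objects \<open>Y\<close> such that every indecomposable that is a retract of \<open>Y\<close> is a retract of \<open>G\<close> form a closed
  class, where the isomorphism between \<open>G\<close> and its suspension gives closure under suspension. So this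
  class contains \<open>addG\<close>. Since endomorphisms of indecomposables are scalars, \<open>Q\<close> is a retract of \<open>Y\<close> as
  soon as some composite \<open>Q \<rightarrow> Y \<rightarrow> Q\<close> is nonzero.
\<close>

lemma finitely_many_indecomposables:
  assumes "isomorphic T G (sh G)"
  shows "\<exists>(L :: nat set) X. finite L \<and> (\<forall>l\<in>L. X l \<in> ind) \<and>
    (\<forall>Q\<in>ind. \<exists>l\<in>L. isomorphic T Q (X l))"
proof -
  obtain s s' where s: "s \<in> hom G (sh G)" "s' \<in> hom (sh G) G"
    "cmp G (sh G) G s' s = idm G" "cmp (sh G) G (sh G) s s' = idm (sh G)"
    using assms by (rule isomorphicE)
  define via where "via Q \<longleftrightarrow> (\<exists>a\<in>hom Q G. \<exists>b\<in>hom G Q. cmp Q G Q b a \<noteq> 0)" for Q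
  define S where "S = {Y. \<forall>Q\<in>ind. \<forall>x\<in>hom Q Y. \<forall>y\<in>hom Y Q. cmp Q Y Q y x \<noteq> 0 \<longrightarrow> via Q}"
  have SD: "via Q" if "Y \<in> S" "Q \<in> ind" "x \<in> hom Q Y" "y \<in> hom Y Q" "cmp Q Y Q y x \<noteq> 0" for Y Q x y
    using that unfolding S_def by blast
  have "closed S"
    unfolding additive_summand_shift_closed_def
  proof (intro conjI allI impI)
    show "Z \<in> S" if "zero_obj T Z" for Z
    proof -
      have "cmp Q Z Q y x = 0" if "x \<in> hom Q Z" "y \<in> hom Z Q" for Q x y
        using zero_obj_Hom(1)[OF \<open>zero_obj T Z\<close> that(1)] that by simp
      then show ?thesis unfolding S_def by blast
    qed
    show "B \<in> S" if XY: "X \<in> S" "Y \<in> S" and B: "biproduct T X Y B" for X Y B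
      unfolding S_def
    proof (intro CollectI ballI impI)
      fix Q x y assume Q: "Q \<in> ind" "x \<in> hom Q B" "y \<in> hom B Q" "cmp Q B Q y x \<noteq> 0"
      obtain i j p q where b: "i \<in> hom X B" "j \<in> hom Y B" "p \<in> hom B X" "q \<in> hom B Y"
        "cmp B X B i p + cmp B Y B j q = idm B"
        using B by (rule biproductE)
      have "cmp Q B Q y x = cmp Q B Q y (cmp Q B B (cmp B X B i p + cmp B Y B j q) x)"
        unfolding b(5) using Q by simp
      also have "\<dots> = cmp Q X Q (cmp X B Q y i) (cmp Q B X p x) + cmp Q Y Q (cmp Y B Q y j) (cmp Q B Y q x)"
        using Q b(1-4) by (simp add: comp_linear)
      finally have "cmp Q X Q (cmp X B Q y i) (cmp Q B X p x) \<noteq> 0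
          \<or> cmp Q Y Q (cmp Y B Q y j) (cmp Q B Y q x) \<noteq> 0"
        using Q(4) by auto
      then show "via Q"
        using SD[OF XY(1) Q(1), of "cmp Q B X p x" "cmp X B Q y i"]
          SD[OF XY(2) Q(1), of "cmp Q B Y q x" "cmp Y B Q y j"] Q b(1-4) mcomp_Hom by blast
    qed
    show "X \<in> S" if BS: "B \<in> S" and B: "biproduct T X Y B" for X Y B
      unfolding S_def
    proof (intro CollectI ballI impI)
      fix Q x y assume Q: "Q \<in> ind" "x \<in> hom Q X" "y \<in> hom X Q" "cmp Q X Q y x \<noteq> 0"
      obtain i p where b: "i \<in> hom X B" "p \<in> hom B X" "cmp X B X p i = idm X"
        using B by (rule biproductE)
      show "via Q"
        using SD[OF BS Q(1), of "cmp Q X B i x" "cmp B X Q y p"] Q b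
        by (simp add: comp_eq_assoc[OF b(3)])
    qed
    show "sh Y \<in> S \<longleftrightarrow> Y \<in> S" for Y
    proof
      assume Y: "sh Y \<in> S"
      show "Y \<in> S" unfolding S_def
      proof (intro CollectI ballI impI)
        fix Q x y assume Q: "Q \<in> ind" "x \<in> hom Q Y" "y \<in> hom Y Q" "cmp Q Y Q y x \<noteq> 0"
        have "via (sh Q)"
          by (rule SD[OF Y _ ms_Hom[OF Q(2)] ms_Hom[OF Q(3)]]) (use Q in simp_all)
        then obtain a b where a: "a \<in> hom (sh Q) G" "b \<in> hom G (sh Q)" "cmp (sh Q) G (sh Q) b a \<noteq> 0"
          unfolding via_def by blast
        obtain a' where a': "a' \<in> hom Q G" "cmp (sh Q) G (sh G) s a = ms Q G a'"
          using ms_full[of "cmp (sh Q) G (sh G) s a" Q G] a s by auto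
        obtain b' where b': "b' \<in> hom G Q" "cmp (sh G) G (sh Q) b s' = ms G Q b'"
          using ms_full[of "cmp (sh G) G (sh Q) b s'" G Q] a s by auto
        have "cmp (sh Q) G (sh Q) b a = cmp (sh Q) (sh G) (sh Q) (cmp (sh G) G (sh Q) b s') (cmp (sh Q) G (sh G) s a)"
          using a s by (simp add: comp_eq_assoc[OF s(3)])
        also have "\<dots> = ms Q Q (cmp Q G Q b' a')" unfolding a'(2) b'(2) using a' b' by simp
        finally have "cmp Q G Q b' a' \<noteq> 0" using a(3) by auto
        then show "via Q" unfolding via_def using a' b' by blast
      qed
    next
      assume Y: "Y \<in> S"
      show "sh Y \<in> S" unfolding S_def
      proof (intro CollectI ballI impI)
        fix Q x y assume Q: "Q \<in> ind" "x \<in> hom Q (sh Y)" "y \<in> hom (sh Y) Q" "cmp Q (sh Y) Q y x \<noteq> 0"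
        obtain Q' c d where Q': "c \<in> hom (sh Q') Q" "d \<in> hom Q (sh Q')"
          "cmp Q (sh Q') Q c d = idm Q" "cmp (sh Q') Q (sh Q') d c = idm (sh Q')"
          using ind_addG[OF Q(1)] by (rule unshift_addG)
        have "isomorphic T Q (sh Q')" using isomorphicI[OF Q'(2,1,3,4)] .
        then have "Q' \<in> ind" using ind_iso[OF Q(1)] ind_shift by blast
        obtain x' where x': "x' \<in> hom Q' Y" "cmp (sh Q') Q (sh Y) x c = ms Q' Y x'"
          using ms_full[of "cmp (sh Q') Q (sh Y) x c" Q' Y] Q Q' by auto
        obtain y' where y': "y' \<in> hom Y Q'" "cmp (sh Y) Q (sh Q') d y = ms Y Q' y'"
          using ms_full[of "cmp (sh Y) Q (sh Q') d y" Y Q'] Q Q' by auto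
        have "cmp Q' Y Q' y' x' \<noteq> 0"
        proof
          assume "cmp Q' Y Q' y' x' = 0"
          then have "cmp (sh Q') (sh Y) (sh Q') (ms Y Q' y') (ms Q' Y x') = 0" using x' y' by simp
          then have "cmp (sh Q') Q (sh Q') d (cmp (sh Q') (sh Y) Q y (cmp (sh Q') Q (sh Y) x c)) = 0"
            unfolding x'(2)[symmetric] y'(2)[symmetric] using Q Q' by simp
          from arg_cong[OF this, of "\<lambda>z. cmp Q (sh Q') Q (cmp (sh Q') (sh Q') Q c z) d"]
          have "cmp Q (sh Y) Q y x = 0" using Q Q' by (simp add: comp_eq_assoc[OF Q'(3)])
          then show False using Q by blast
        qed
        then have "via Q'" using SD[OF Y \<open>Q' \<in> ind\<close> x'(1) y'(1)] by blast
        then obtain a b where a: "a \<in> hom Q' G" "b \<in> hom G Q'" "cmp Q' G Q' b a \<noteq> 0"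
          unfolding via_def by blast
        define a' where "a' = cmp Q (sh G) G s' (cmp Q (sh Q') (sh G) (ms Q' G a) d)"
        define b' where "b' = cmp G (sh Q') Q c (cmp G (sh G) (sh Q') (ms G Q' b) s)"
        have H: "a' \<in> hom Q G" "b' \<in> hom G Q" using a s Q' by (simp_all add: a'_def b'_def)
        have "cmp Q G Q b' a' = cmp Q (sh Q') Q c (cmp Q (sh Q') (sh Q') (ms Q' Q' (cmp Q' G Q' b a)) d)"
          unfolding a'_def b'_def using a s Q'
          by (simp add: comp_eq_assoc[OF s(4)] mshift_mcomp del: ms_comp)
        moreover have "cmp Q (sh Q') Q c (cmp Q (sh Q') (sh Q') (ms Q' Q' (cmp Q' G Q' b a)) d) \<noteq> 0"
        proof
          assume "cmp Q (sh Q') Q c (cmp Q (sh Q') (sh Q') (ms Q' Q' (cmp Q' G Q' b a)) d) = 0"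
          from arg_cong[OF this, of "\<lambda>z. cmp (sh Q') Q (sh Q') (cmp Q Q (sh Q') d z) c"]
          have "ms Q' Q' (cmp Q' G Q' b a) = 0"
            using a Q' by (simp add: comp_eq_assoc[OF Q'(4)])
          then show False using a by simp
        qed
        ultimately show "via Q" unfolding via_def using H by metis
      qed
    qed
  qed
  moreover have "G \<in> S" unfolding S_def via_def by blast
  ultimately have "addG \<subseteq> S" unfolding addG_def by (intro hull_minimal) simp_all
  obtain L X i p where res: "resolution L G X i p" using G_addG by (rule ex_resolution)
  note rd = resolutionD[OF res]
  show ?thesis
  proof (intro exI[of _ L] exI[of _ X] conjI ballI)
    fix Q assume Q: "Q \<in> ind"
    then have "via Q"
      using SD[of Q Q "idm Q" "idm Q"] \<open>addG \<subseteq> S\<close> ind_addG ind_idm by auto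
    then obtain a b where a: "a \<in> hom Q G" "b \<in> hom G Q" "cmp Q G Q b a \<noteq> 0" unfolding via_def by blast
    have "\<exists>l\<in>L. cmp Q (X l) Q (cmp (X l) G Q b (i l)) (cmp Q G (X l) (p l) a) \<noteq> 0"
    proof (rule ccontr)
      assume n: "\<not> ?thesis"
      have "cmp Q G Q b a = cmp Q G Q b (\<Sum>l\<in>L. cmp Q (X l) G (i l) (cmp Q G (X l) (p l) a))"
        using resolution_sum_left[OF res a(1)] by simp
      also have "\<dots> = (\<Sum>l\<in>L. cmp Q G Q b (cmp Q (X l) G (i l) (cmp Q G (X l) (p l) a)))"
        using rd a by (intro comp_sum_right) simp_all
      also have "\<dots> = 0" using n rd a by (intro sum.neutral) simp
      finally show False using a by blast
    qed
    then obtain l where l: "l \<in> L" "cmp Q (X l) Q (cmp (X l) G Q b (i l)) (cmp Q G (X l) (p l) a) \<noteq> 0"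
      by blast
    define x where "x = cmp Q G (X l) (p l) a"
    define y where "y = cmp (X l) G Q b (i l)"
    have xy: "x \<in> hom Q (X l)" "y \<in> hom (X l) Q" using rd l(1) a by (simp_all add: x_def y_def)
    have "cmp Q (X l) Q y x \<noteq> 0" using l(2) by (simp add: x_def y_def)
    then have "x \<noteq> 0" "y \<noteq> 0" using xy by auto
    then have "lin_le T (X l) Q" "lin_le T Q (X l)"
      using nonzero_le[OF Q rd(3)[OF l(1)]] nonzero_le[OF rd(3)[OF l(1)] Q] xy by blast+
    then show "\<exists>l\<in>L. isomorphic T Q (X l)" using G1_antisym[OF Q rd(3)[OF l(1)]] l(1) by blast
  qed (use rd in simp_all)
qed

text \<open>
  Splitting off pivots writes the cone of a map between objects of \<open>addG\<close> as a direct sum of objects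
  of \<open>addG\<close> and cones of maps between indecomposables.
\<close>

lemma cone_decomposition:
  assumes S: "closed S" "addG \<subseteq> S"
    and cones: "\<And>Q R C \<phi> g h. Q \<in> ind \<Longrightarrow> R \<in> ind \<Longrightarrow> \<phi> \<noteq> 0 \<Longrightarrow> tri T Q R C \<phi> g h \<Longrightarrow> C \<in> S"
    and "resolution L N X i p" "N \<in> addG" "M \<in> addG" "tri T N M A f g h"
  shows "A \<in> S"
  using assms(4-)
proof (induction "card L" arbitrary: L N M A i p f g h rule: less_induct)
  case less
  note t = less.prems(4)
  note H = tri_homs[OF t]
  note rd = resolutionD[OF less.prems(1)]
  show ?case
  proof (cases "f = 0")
    case True
    then show ?thesis using cone_zero[OF _ S(1)] t less.prems S(2) by blast
  next
    case False
    obtain l R a b q \<phi> where l: "l \<in> L" "R \<in> ind" "a \<in> hom N (X l)" "b \<in> hom R M" "q \<in> hom M R"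
      "\<phi> \<in> hom (X l) R" "\<phi> \<noteq> 0" "cmp (X l) N (X l) a (i l) = idm (X l)" "cmp R M R q b = idm R"
      "cmp (X l) N M f (i l) = cmp (X l) R M b \<phi>" "cmp N M R q f = cmp N (X l) R \<phi> a"
      using pivot[OF less.prems(1,3) H(1) False] .
    note il = rd(4)[OF l(1)]
    obtain N1 j e where c: "j \<in> hom N1 N" "e \<in> hom N N1" "cmp N1 N N1 e j = idm N1"
      "cmp N1 N (X l) a j = 0" "cmp (X l) N N1 e (i l) = 0"
      "cmp N (X l) N (i l) a + cmp N N1 N j e = idm N"
      using retract_complement[OF il l(3,8)] by metis
    obtain M1 k u where d: "k \<in> hom M1 M" "u \<in> hom M M1" "cmp M1 M M1 u k = idm M1"
      "cmp M1 M R q k = 0" "cmp R M M1 u b = 0" "cmp M R M b q + cmp M M1 M k u = idm M"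
      using retract_complement[OF l(4,5,9)] by metis
    have "biproduct T N1 (X l) N"
      using c il l by (intro biproductI[of j _ _ "i l" _ e a]) (simp_all add: add.commute)
    then have N1: "N1 \<in> addG" using closed_summand[OF closed_addG less.prems(2)] by blast
    have "biproduct T M1 R M"
      using d l by (intro biproductI[of k _ _ b _ u q]) (simp_all add: add.commute)
    then have M1: "M1 \<in> addG" using closed_summand[OF closed_addG less.prems(3)] by blast
    define f1 where "f1 = cmp N1 M M1 u (cmp N1 N M f j)"
    have f1: "f1 \<in> hom N1 M1" using c d H by (simp add: f1_def)
    obtain C1 g1 h1 where t1: "tri T (X l) R C1 \<phi> g1 h1" using tri_complete[OF l(6)] by blast
    obtain C2 g2 h2 where t2: "tri T N1 M1 C2 f1 g2 h2" using tri_complete[OF f1] by blast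
    have "C1 \<in> S" using cones[OF rd(3)[OF l(1)] l(2,7) t1] .
    moreover have "C2 \<in> S"
    proof (rule less.hyps[OF _ resolution_complement[OF less.prems(1) l(1) c(1,2,3,5)] N1 M1 t2])
      show "card (L - {l}) < card L" using rd(1) l(1) by (rule card_Diff1_less)
    qed
    moreover have "cmp N1 M1 M k f1 = cmp N1 N M f j"
    proof -
      have "cmp N1 N M f j = cmp N1 M M (cmp M R M b q + cmp M M1 M k u) (cmp N1 N M f j)"
        unfolding d(6) using c H by simp
      also have "\<dots> = cmp N1 R M b (cmp N1 M R q (cmp N1 N M f j)) + cmp N1 M1 M k f1"
        using c(1) d(1,2) l(4,5) H by (simp add: comp_linear f1_def)
      also have "cmp N1 M R q (cmp N1 N M f j) = 0"
        using comp_eq_assoc[OF l(11)] c l H by simp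
      finally show ?thesis using l by simp
    qed
    moreover have "cmp N M M1 u f = cmp N N1 M1 f1 e"
    proof -
      have "cmp N M M1 u f = cmp N N M1 (cmp N M M1 u f) (cmp N (X l) N (i l) a + cmp N N1 N j e)"
        unfolding c(6) using d H by simp
      also have "\<dots> = cmp N M M1 u (cmp N (X l) M (cmp (X l) N M f (i l)) a) + cmp N N1 M1 f1 e"
        using c(1,2) d(2) l(3) H il by (simp add: comp_linear f1_def)
      also have "cmp N M M1 u (cmp N (X l) M (cmp (X l) N M f (i l)) a) = 0"
        unfolding l(10) using comp_eq_assoc[OF d(5)] d l by simp
      finally show ?thesis by simp
    qed
    ultimately show ?thesis
      using cone_sum[OF t t1 t2 il l(3) c(1,2,6) l(4,5) d(1,2,6) l(10)[symmetric] l(11) _ _ S(1)] by blast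
  qed
qed

lemma additive_generator:
  assumes "isomorphic T G (sh G)"
  shows "\<exists>W. closed hull {W} = UNIV"
proof -
  obtain L :: "nat set" and X where L: "finite L" "\<And>l. l \<in> L \<Longrightarrow> X l \<in> ind"
    "\<And>Q. Q \<in> ind \<Longrightarrow> \<exists>l\<in>L. isomorphic T Q (X l)"
    using finitely_many_indecomposables[OF assms] by metis
  \<comment> \<open>the morphism spaces are lines, so one nonzero map for each pair accounts for all cones\<close>
  have "\<exists>K \<phi> g h. tri T (X l) (X m) K \<phi> g h \<and> ((\<exists>\<psi>\<in>hom (X l) (X m). \<psi> \<noteq> 0) \<longrightarrow> \<phi> \<noteq> 0)" for l m
  proof (cases "\<exists>\<psi>\<in>hom (X l) (X m). \<psi> \<noteq> 0")
    case True
    then obtain \<psi> where \<psi>: "\<psi> \<in> hom (X l) (X m)" "\<psi> \<noteq> 0" by blast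
    obtain K g h where "tri T (X l) (X m) K \<psi> g h" using tri_complete[OF \<psi>(1)] by blast
    then show ?thesis using \<psi>(2) by blast
  next
    case False
    obtain K g h where "tri T (X l) (X m) K 0 g h"
      using tri_complete[OF zero_Hom, of "X l" "X m"] by blast
    then show ?thesis using False by blast
  qed
  then obtain K \<phi> g h where K: "\<And>l m. tri T (X l) (X m) (K l m) (\<phi> l m) (g l m) (h l m)"
    "\<And>l m \<psi>. \<psi> \<in> hom (X l) (X m) \<Longrightarrow> \<psi> \<noteq> 0 \<Longrightarrow> \<phi> l m \<noteq> 0"
    by metis
  have "finite (insert G ((\<lambda>(l, m). K l m) ` (L \<times> L)))" using L(1) by simp
  then obtain W where W: "\<And>S. closed S \<Longrightarrow> W \<in> S \<Longrightarrow> insert G ((\<lambda>(l, m). K l m) ` (L \<times> L)) \<subseteq> S"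
    using finite_common_sum by blast
  define S where "S = closed hull {W}"
  have S: "closed S" unfolding S_def by (rule closed_hull)
  have "W \<in> S" unfolding S_def using hull_inc[of W "{W}" closed] by simp
  note WS = W[OF S this]
  have GS: "addG \<subseteq> S" unfolding addG_def using WS S by (intro hull_minimal) simp_all
  have KS: "K l m \<in> S" if "l \<in> L" "m \<in> L" for l m using WS that by auto
  have cones: "C \<in> S" if Q: "Q \<in> ind" "R \<in> ind" "\<psi> \<noteq> 0" and t: "tri T Q R C \<psi> g' h'" for Q R C \<psi> g' h'
  proof -
    note H = tri_homs[OF t]
    obtain l where l: "l \<in> L" "isomorphic T Q (X l)" using L(3)[OF Q(1)] by blast
    obtain m where m: "m \<in> L" "isomorphic T R (X m)" using L(3)[OF Q(2)] by blast
    note lm = l(1) m(1) l(2) m(2)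
    note HK = tri_homs[OF K(1)[of l m]]
    obtain a a' where a: "a \<in> hom Q (X l)" "a' \<in> hom (X l) Q" "cmp Q (X l) Q a' a = idm Q"
      "cmp (X l) Q (X l) a a' = idm (X l)" using lm(3) by (rule isomorphicE)
    obtain b b' where b: "b \<in> hom R (X m)" "b' \<in> hom (X m) R" "cmp R (X m) R b' b = idm R"
      "cmp (X m) R (X m) b b' = idm (X m)" using lm(4) by (rule isomorphicE)
    define \<psi>' where "\<psi>' = cmp (X l) R (X m) b (cmp (X l) Q R \<psi> a')"
    have \<psi>': "\<psi>' \<in> hom (X l) (X m)" using a b H by (simp add: \<psi>'_def)
    have b\<psi>: "cmp Q R (X m) b \<psi> = cmp Q (X l) (X m) \<psi>' a"
      unfolding \<psi>'_def using a b H by simp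
    have \<psi>a: "cmp (X l) Q R \<psi> a' = cmp (X l) (X m) R b' \<psi>'"
      unfolding \<psi>'_def using a b H by (simp add: comp_eq_assoc[OF b(3)])
    have "\<psi>' \<noteq> 0"
    proof
      assume "\<psi>' = 0"
      then have "cmp Q R (X m) b \<psi> = 0" using b\<psi> a by simp
      then show False using comp_eq_assoc[OF b(3) b(1,2) H(1)] b(2) Q(3) H(1) by simp
    qed
    then have \<phi>0: "\<phi> l m \<noteq> 0" using K(2) \<psi>' by blast
    obtain r where r: "\<psi>' = mscale T r (\<phi> l m)"
      using one_dim[OF L(2)[OF lm(1)] L(2)[OF lm(2)] HK(1) \<phi>0 \<psi>'] by blast
    then have r0: "r \<noteq> 0" using \<open>\<psi>' \<noteq> 0\<close> by auto
    have comm1: "cmp Q R (X m) b \<psi> = cmp Q (X l) (X m) (\<phi> l m) (mscale T r a)"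
      unfolding b\<psi> r using a HK by (simp add: comp_linear)
    have comm2: "cmp (X l) (X m) R b' (\<phi> l m) = cmp (X l) Q R \<psi> (mscale T (inverse r) a')"
    proof -
      have "cmp (X l) Q R \<psi> (mscale T (inverse r) a') = mscale T (inverse r) (cmp (X l) (X m) R b' \<psi>')"
        using a H by (simp add: comp_linear \<psi>a)
      also have "\<dots> = cmp (X l) (X m) R b' (\<phi> l m)"
        unfolding r using r0 b HK by (simp add: comp_linear)
      finally show ?thesis by simp
    qed
    have "cmp Q (X l) Q (mscale T (inverse r) a') (mscale T r a) = idm Q"
      using a r0 by (simp add: comp_linear)
    then show "C \<in> S"
      using cone_retract[OF t K(1)[of l m] _ _ _ b(1-3) comm1 comm2 S KS[OF lm(1,2)]] a by simp
  qed
  have "A \<in> S" for A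
  proof -
    obtain N M f g' h' where p: "N \<in> addG" "M \<in> addG" "tri T N M A f g' h'" by (rule presentation)
    obtain L' X' i p' where res: "resolution L' N X' i p'" using p(1) by (rule ex_resolution)
    show ?thesis
    proof (rule cone_decomposition[OF S GS _ res p])
      show "C \<in> S" if "Q \<in> ind" "R \<in> ind" "\<psi> \<noteq> 0" "tri T Q R C \<psi> u v" for Q R C \<psi> u v
        using that by (rule cones)
    qed
  qed
  then show ?thesis unfolding S_def by blast
qed

end

section \<open>The Rouquier dimension\<close>

context klinear_triangulated_category
begin

lemma additive_generator_time:
  assumes "closed hull {W} = UNIV"
  shows "classical_generator T W" "generation_time T W = 0"
proof -
  have "t = UNIV" if "thick T t" "W \<in> t" for t
    using hull_minimal[of "{W}" t closed] thick_closed[OF that(1)] that(2) assms by auto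
  then show "classical_generator T W"
    unfolding classical_generator_def hull_def by auto
  have "generated_in T W 1 = UNIV" using assms by simp
  then have "(LEAST n. 1 \<le> n \<and> generated_in T W n = UNIV) = 1" "\<exists>n\<ge>1. generated_in T W n = UNIV"
    by (auto intro!: Least_equality exI[of _ 1] simp del: One_nat_def)
  then show "generation_time T W = 0"
    unfolding generation_time_def by (simp only: if_True) (simp add: enat_0)
qed

lemma generation_time_ge_1:
  assumes "closed hull {W} \<noteq> UNIV"
  shows "1 \<le> generation_time T W"
proof (cases "\<exists>n\<ge>1. generated_in T W n = UNIV")
  case True
  define m where "m = (LEAST n. 1 \<le> n \<and> generated_in T W n = UNIV)"
  have m: "1 \<le> m" "generated_in T W m = UNIV"
    using LeastI_ex[OF True] unfolding m_def by auto
  then have "m \<noteq> 1" using assms by auto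
  then have "1 \<le> m - 1" using m(1) by simp
  moreover have "generation_time T W = enat (m - 1)"
    using True unfolding generation_time_def m_def by simp
  ultimately show ?thesis by (simp add: one_enat_def)
next
  case False
  then show ?thesis unfolding generation_time_def by (simp only: if_False) simp
qed

end

context linearly_generated
begin

lemma generation_time_le_1: "generation_time T G \<le> 1"
proof -
  have "(LEAST n. 1 \<le> n \<and> generated_in T G n = UNIV) \<le> 2"
    using generated_in_2 by (intro Least_le) simp
  moreover have "\<exists>n\<ge>1. generated_in T G n = UNIV" using generated_in_2 by (intro exI[of _ 2]) simp
  ultimately show ?thesis unfolding generation_time_def by (simp add: one_enat_def)
qed

lemma rouquier_dimension_eq_1_iff:
  "rouquier_dimension T = 1 \<longleftrightarrow> \<not> isomorphic T G (sh G)"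
proof
  assume 1: "rouquier_dimension T = 1"
  show "\<not> isomorphic T G (sh G)"
  proof
    assume "isomorphic T G (sh G)"
    then obtain W where "closed hull {W} = UNIV" using additive_generator by blast
    then have "classical_generator T W" "generation_time T W = 0" using additive_generator_time by blast+
    then have "rouquier_dimension T \<le> 0"
      unfolding rouquier_dimension_def by (metis INF_lower mem_Collect_eq)
    then show False using 1 by simp
  qed
next
  assume "\<not> isomorphic T G (sh G)"
  then obtain Q where "Q \<in> ind" "\<not> isomorphic T Q (sh Q)" using ex_moved_indecomposable by blast
  then have "1 \<le> generation_time T W" for W
    using infinite_orbit_no_additive_generator generation_time_ge_1 by blast
  then have "1 \<le> rouquier_dimension T"
    unfolding rouquier_dimension_def by (intro INF_greatest)
  moreover have "rouquier_dimension T \<le> generation_time T G"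
    unfolding rouquier_dimension_def using linear_generator.generator[OF lin] by (intro INF_lower) simp
  ultimately show "rouquier_dimension T = 1"
    using generation_time_le_1 by (metis order_antisym order_trans)
qed

end

theorem corollary2p17:
  fixes T :: "('k::alg_closed_field, 'o, 'm::ab_group_add) tricat" and G :: 'o
  assumes "klinear_triangulated_category T"
    and "hom_finite T"
    and "krull_schmidt T"
    and "linear_generator T G"
  shows "rouquier_dimension T = 1 \<longleftrightarrow> \<not> isomorphic T G (shift T G)"
proof -
  interpret linearly_generated T G
    using assms by (simp add: linearly_generated_def linearly_generated_axioms_def)
  show ?thesis by (rule rouquier_dimension_eq_1_iff)
qed

end
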